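(* Let $\Omega\subseteq\mathbb{R}^N$ be a bounded open set with $C^1$ boundary and let $s\in(0,1)$. Assume that $\Omega$ is strictly convex and let $\bar C>0$. Let $u\in H^1(\mathbb{R}^N)$ be such that $$\begin{cases}\mathcal{L}u\le\bar C & \text{in }\Omega,\\ u=0 & \text{in }\mathbb{R}^N\setminus\Omega,\\ u\le\bar C & \text{in }\mathbb{R}^N.\end{cases}$$ Then there exist $C,\ell>0$ such that, for every $p\in\partial\Omega$, $$u(x)\le C\,\bar C\,|x-p|\qquad\text{for a.e. }x\in B(p,\ell).$$
   Context: $\mathcal{L}:=-\Delta+(-\Delta)^s$, where $(-\Delta)^s u(x)=c_{N,s}\,\mathrm{P.V.}\int_{\mathbb{R}^N}\frac{u(x)-u(y)}{|x-y|^{N+2s}}\,dy$ and $c_{N,s}=\Big(\int_{\mathbb{R}^N}\frac{1-\cos(\zeta_1)}{|\zeta|^{N+2s}}\,d\zeta\Big)^{-1}$. $B(p,\ell)$ is the Euclidean ball of center $p$ and radius $\ell$. The statement that $u\in H^1(\mathbb{R}^N)$ satisfies the system in the claim means precisely that $u\le\bar C$ a.e. in $\mathbb{R}^N$, $u\equiv 0$ a.e. in $\mathbb{R}^N\setminus\Omega$, and, for every non-negative $\varphi\in C_0^\infty(\Omega,\mathbb{R})$, $$\int_\Omega\langle\nabla u,\nabla\varphi\rangle\,dx+\frac{c_{N,s}}{2}\int_{\mathbb{R}^N\times\mathbb{R}^N}\frac{(u(x)-u(y))(\varphi(x)-\varphi(y))}{|x-y|^{N+2s}}\,dx\,dy\le\bar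 C\int_\Omega\varphi\,dx.$$ *)

theory Defs
  imports "HOL-Analysis.Analysis"
begin

definition grad :: "('a::euclidean_space \<Rightarrow> real) \<Rightarrow> 'a \<Rightarrow> 'a" where
  "grad f x = (THE D. GDERIV f x :> D)"

primrec C_k :: "nat \<Rightarrow> ('a::euclidean_space \<Rightarrow> real) \<Rightarrow> bool" where
  "C_k 0 f \<longleftrightarrow> continuous_on UNIV f"
| "C_k (Suc k) f \<longleftrightarrow>
     (\<forall>x. f differentiable (at x)) \<and> (\<forall>b\<in>Basis. C_k k (\<lambda>x. grad f x \<bullet> b))"

text \<open>The space of smooth functions with compact support in \<open>\<Omega>\<close>, each extended by zero to
  the whole space.\<close>

definition test_functions :: "'a::euclidean_space set \<Rightarrow> ('a \<Rightarrow> real) set" where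
  "test_functions \<Omega> = {\<phi>. (\<forall>k. C_k k \<phi>) \<and>
     compact (closure {x. \<phi> x \<noteq> 0}) \<and> closure {x. \<phi> x \<noteq> 0} \<subseteq> \<Omega>}"

definition has_L2_weak_gradient :: "('a::euclidean_space \<Rightarrow> real) \<Rightarrow> ('a \<Rightarrow> 'a) \<Rightarrow> bool" where
  "has_L2_weak_gradient u g \<longleftrightarrow>
     g \<in> borel_measurable lebesgue \<and> integrable lebesgue (\<lambda>x. (norm (g x))\<^sup>2) \<and>
     (\<forall>\<phi>\<in>test_functions UNIV. \<forall>b\<in>Basis.
        (LINT x|lebesgue. u x * (grad \<phi> x \<bullet> b)) = - (LINT x|lebesgue. (g x \<bullet> b) * \<phi> x))"

definition H1 :: "('a::euclidean_space \<Rightarrow> real) set" where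
  "H1 = {u. u \<in> borel_measurable lebesgue \<and> integrable lebesgue (\<lambda>x. (u x)\<^sup>2) \<and>
     (\<exists>g. has_L2_weak_gradient u g)}"

text \<open>Weak gradients are determined only up to null sets; one representative is chosen.\<close>

definition weak_grad :: "('a::euclidean_space \<Rightarrow> real) \<Rightarrow> 'a \<Rightarrow> 'a" where
  "weak_grad u = (SOME g. has_L2_weak_gradient u g)"

text \<open>The first coordinate \<open>\<zeta>\<^sub>1\<close> is the one along an arbitrary vector of \<^const>\<open>Basis\<close>, which is an
  unordered set; by rotation invariance the constant does not depend on that choice.
  At \<open>\<zeta> = 0\<close> the integrand is \<open>0 / 0 = 0\<close>, and similarly on the diagonal in
  \<open>mixed_form\<close> below; both are null sets.\<close>

definition frac_const :: "'a::euclidean_space itself \<Rightarrow> real \<Rightarrow> real" where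
  "frac_const _ s = inverse (LINT \<zeta>::'a|lebesgue.
     (1 - cos (\<zeta> \<bullet> (SOME b. b \<in> Basis))) / norm \<zeta> powr (real DIM('a) + 2 * s))"

definition mixed_form ::
    "'a::euclidean_space set \<Rightarrow> real \<Rightarrow> ('a \<Rightarrow> real) \<Rightarrow> ('a \<Rightarrow> real) \<Rightarrow> real" where
  "mixed_form \<Omega> s u \<phi> =
     (LINT x:\<Omega>|lebesgue. weak_grad u x \<bullet> grad \<phi> x) +
     frac_const TYPE('a) s / 2 *
       (LINT (x, y)|(lebesgue :: ('a \<times> 'a) measure).
          (u x - u y) * (\<phi> x - \<phi> y) / norm (x - y) powr (real DIM('a) + 2 * s))"

text \<open>The weak meaning, for \<open>u \<in> H1\<close>, of the system: \<open>L u \<le> K\<close> in \<open>\<Omega>\<close>, \<open>u = 0\<close> outside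
  \<open>\<Omega>\<close>, and \<open>u \<le> K\<close> everywhere, where \<open>L = - \<Delta> + (- \<Delta>)\<^sup>s\<close>.\<close>

definition satisfies_system ::
    "'a::euclidean_space set \<Rightarrow> real \<Rightarrow> real \<Rightarrow> ('a \<Rightarrow> real) \<Rightarrow> bool" where
  "satisfies_system \<Omega> s K u \<longleftrightarrow>
     (AE x in lebesgue. u x \<le> K) \<and>
     (AE x in lebesgue. x \<notin> \<Omega> \<longrightarrow> u x = 0) \<and>
     (\<forall>\<phi>\<in>test_functions \<Omega>. (\<forall>x. \<phi> x \<ge> 0) \<longrightarrow>
        mixed_form \<Omega> s u \<phi> \<le> K * (LINT x:\<Omega>|lebesgue. \<phi> x))"

text \<open>Near each boundary point, \<open>\<Omega>\<close> is the region above the graph of a \<open>C\<^sup>1\<close> function in suitable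
  orthonormal coordinates. The last coordinate axis is spanned by \<open>e\<close>, and \<open>x - (x \<bullet> e) *\<^sub>R e\<close>
  is the projection of \<open>x\<close> onto the hyperplane of the remaining coordinates, so only the
  restriction of \<open>\<gamma>\<close> to that hyperplane matters.\<close>

definition C1_boundary :: "'a::euclidean_space set \<Rightarrow> bool" where
  "C1_boundary \<Omega> \<longleftrightarrow>
     (\<forall>p\<in>frontier \<Omega>. \<exists>r>0. \<exists>e \<gamma>. norm e = 1 \<and> C_k 1 \<gamma> \<and>
        \<Omega> \<inter> ball p r = {x \<in> ball p r. x \<bullet> e > \<gamma> (x - (x \<bullet> e) *\<^sub>R e)})"

definition strictly_convex :: "'a::euclidean_space set \<Rightarrow> bool" where
  "strictly_convex S \<longleftrightarrow>
     (\<forall>x\<in>closure S. \<forall>y\<in>closure S. open_segment x y \<subseteq> interior S)"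

end

(*
  By convexity the domain lies, at each boundary point p, in a half space t > 0, where
  t = (x - p) . e.  There A W(t) is a barrier, where W vanishes for t <= 0 and equals
  2t - t^(2 - sigma), with s < sigma < 1, up to a small width delta, after which it is constant.
  The local term -W'' is of order t^(-sigma).  As W is concave on t >= 0, the nonlocal term is
  negative only because of the kink at 0, and then at worst of order t^(-s), so it is absorbed
  for small t.  Where t >= delta/2 the barrier exceeds the upper bound of u, so comparison gives
  u <= A W(t) <= 2 A |x - p|.

  Comparison needs no regularity of u.  Dilating and mollifying u gives test functions v on the
  domain that converge to u in H^1.  The weak inequality is tested with f(v - A W), where
  f(r) = exp(-1/r) for r > 0 and f = 0 otherwise: it vanishes wherever W is not smooth, hence is
  itself a test function.  Since the H^1 norm controls the Gagliardo energy, replacing u by v in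
  the weak form costs arbitrarily little.  As f is increasing, the form of v dominates that of
  A W, and the strict inequality for W forces the integral of f(v - A W) to tend to 0.
*)
theory Submission
  imports Defs
begin

subsection \<open>Gradients and test functions\<close>

text \<open>The inequality for u may only be tested with non-negative smooth functions supported in
  the domain, and the positive part of u - A W is not of this kind. This dictates both the
  approximation of u from inside the domain and the flat function f: all derivatives of f(v - A W)
  die out where it is cut off, so the class of admissible functions never has to be enlarged. A
  second obstacle is that W, as a function on the whole space, need not have finite energy. Its form
  against a test function is therefore expanded only for a kernel truncated near the diagonal. The
  resulting lower bound does not see the truncation, which is removed afterwards in the form of v
  alone. The barrier depends on one direction only and the tail bound of the kernel is rotation
  invariant, so one width and one height serve all boundary points. The width is fixed before the
  bound on u enters, and the height is proportional to that bound; hence the linear dependence in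
  the conclusion.\<close>

lemma GDERIV_unique: "GDERIV f x :> D \<Longrightarrow> GDERIV f x :> E \<Longrightarrow> D = E"
  unfolding gderiv_def by (metis (no_types, lifting) has_derivative_unique inner_commute vector_eq_rdot)

lemma has_derivative_grad:
  fixes f :: "'a::euclidean_space \<Rightarrow> real"
  assumes "f differentiable (at x)"
  shows "(f has_derivative (\<lambda>h. h \<bullet> grad f x)) (at x)"
proof -
  obtain f' where f': "(f has_derivative f') (at x)"
    using assms by (auto simp: differentiable_def)
  have lin: "linear f'" using f' by (rule has_derivative_linear)
  define D where "D = (\<Sum>b\<in>Basis. f' b *\<^sub>R b)"
  have "f' h = h \<bullet> D" for h
  proof -
    have "f' h = f' (\<Sum>b\<in>Basis. (h \<bullet> b) *\<^sub>R b)" by (simp add: euclidean_representation)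
    also have "\<dots> = (\<Sum>b\<in>Basis. (h \<bullet> b) * f' b)"
      by (simp add: linear_sum[OF lin] linear_cmul[OF lin])
    also have "\<dots> = h \<bullet> D" by (simp add: D_def inner_sum_right mult.commute)
    finally show ?thesis .
  qed
  then have "f' = (\<lambda>h. h \<bullet> D)" by blast
  then have "GDERIV f x :> D" using f' by (simp add: gderiv_def)
  then have "GDERIV f x :> grad f x"
    unfolding grad_def by (rule theI) (use \<open>GDERIV f x :> D\<close> in \<open>auto intro: GDERIV_unique\<close>)
  then show ?thesis by (simp add: gderiv_def)
qed

lemma grad_eqI:
  assumes "(f has_derivative (\<lambda>h. h \<bullet> D)) (at x)"
  shows "grad f x = D"
proof -
  have D: "GDERIV f x :> D" using assms by (simp add: gderiv_def)
  then show ?thesis unfolding grad_def by (intro the_equality) (auto intro: GDERIV_unique)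
qed

lemma grad_inner_Basis:
  assumes "(f has_derivative f') (at x)"
  shows "grad f x \<bullet> b = f' b"
proof -
  have "f differentiable (at x)" using assms by (auto simp: differentiable_def)
  from has_derivative_unique[OF assms has_derivative_grad[OF this]]
  show ?thesis by (simp add: inner_commute)
qed

text \<open>Smoothness is always proved by exhibiting a family of functions that contains the partial
  derivatives of its members.\<close>

lemma C_k_family:
  assumes "\<And>f x. f \<in> F \<Longrightarrow> f differentiable (at x)"
    and "\<And>f b. f \<in> F \<Longrightarrow> b \<in> Basis \<Longrightarrow> (\<lambda>x. grad f x \<bullet> b) \<in> F"
    and "f \<in> F"
  shows "C_k k f"
  using assms(3)
proof (induction k arbitrary: f)
  case 0
  then show ?case
    using assms(1) by (auto intro!: differentiable_imp_continuous_on simp: differentiable_on_def)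
next
  case (Suc k)
  then show ?case using assms(1,2) by auto
qed

lemma test_functions_UNIV_iff:
  "\<phi> \<in> test_functions UNIV \<longleftrightarrow> (\<forall>k. C_k k \<phi>) \<and> bounded {x. \<phi> x \<noteq> 0}"
  by (auto simp: test_functions_def)

lemma test_functions_differentiable:
  assumes "\<phi> \<in> test_functions \<Omega>"
  shows "\<phi> differentiable (at x)"
proof -
  have "C_k (Suc 0) \<phi>" using assms unfolding test_functions_def by blast
  then show ?thesis by simp
qed

lemma test_functions_has_derivative:
  "\<phi> \<in> test_functions \<Omega> \<Longrightarrow> (\<phi> has_derivative (\<lambda>h. h \<bullet> grad \<phi> x)) (at x)"
  by (rule has_derivative_grad) (rule test_functions_differentiable)

lemma test_functions_continuous: "\<phi> \<in> test_functions \<Omega> \<Longrightarrow> continuous_on UNIV \<phi>"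
  by (metis (mono_tags, lifting) C_k.simps(1) mem_Collect_eq test_functions_def)

lemma grad_eq_0:
  assumes "x \<notin> closure {x. \<phi> x \<noteq> 0}"
  shows "grad \<phi> x = 0"
proof (rule grad_eqI)
  have "((\<lambda>_. 0) has_derivative (\<lambda>h. h \<bullet> 0)) (at x)" by simp
  then show "(\<phi> has_derivative (\<lambda>h. h \<bullet> 0)) (at x)"
    by (rule has_derivative_transform_within_open[where s="- closure {x. \<phi> x \<noteq> 0}"])
       (use assms in \<open>auto dest: contra_subsetD[OF closure_subset]\<close>)
qed

lemma test_functions_grad:
  assumes "\<phi> \<in> test_functions \<Omega>" "b \<in> Basis"
  shows "(\<lambda>x. grad \<phi> x \<bullet> b) \<in> test_functions \<Omega>"
proof -
  have "C_k k (\<lambda>x. grad \<phi> x \<bullet> b)" for k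
  proof -
    have "C_k (Suc k) \<phi>" using assms(1) unfolding test_functions_def by blast
    then show ?thesis using assms(2) by simp
  qed
  moreover have sub: "closure {x. grad \<phi> x \<bullet> b \<noteq> 0} \<subseteq> closure {x. \<phi> x \<noteq> 0}"
    by (rule closure_minimal) (use grad_eq_0 in force)+
  moreover have "compact (closure {x. grad \<phi> x \<bullet> b \<noteq> 0})"
    using assms(1) closed_Int_compact[OF closed_closure, of "closure {x. \<phi> x \<noteq> 0}" "{x. grad \<phi> x \<bullet> b \<noteq> 0}"]
      Int_absorb2[OF sub] by (simp add: test_functions_def)
  ultimately show ?thesis using assms(1) by (auto simp: test_functions_def)
qed

lemma continuous_on_grad:
  assumes "\<phi> \<in> test_functions \<Omega>"
  shows "continuous_on UNIV (grad \<phi>)"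
proof -
  have "continuous_on UNIV (\<lambda>x. \<Sum>b\<in>Basis. (grad \<phi> x \<bullet> b) *\<^sub>R b)"
    using test_functions_continuous[OF test_functions_grad[OF assms]]
    by (intro continuous_on_sum continuous_on_scaleR continuous_on_const) auto
  then show ?thesis by (simp only: euclidean_representation)
qed

text \<open>With \<open>a = -1\<close> this makes the reflected mollifier \<eta>(x - y), as a
  function of y, admissible in the weak gradient identity; with \<open>a = 1\<close> it absorbs
  constant factors.\<close>

lemma test_functions_affine:
  fixes \<psi> :: "'a::euclidean_space \<Rightarrow> real"
  assumes "\<psi> \<in> test_functions UNIV" "a \<noteq> 0"
  shows "(\<lambda>y. c * \<psi> (a *\<^sub>R y + v)) \<in> test_functions UNIV"
    and "grad (\<lambda>y. c * \<psi> (a *\<^sub>R y + v)) x = (c * a) *\<^sub>R grad \<psi> (a *\<^sub>R x + v)"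
proof -
  define F where "F = {\<lambda>y. c * \<psi> (a *\<^sub>R y + v) | (\<psi> :: 'a \<Rightarrow> real) c. \<psi> \<in> test_functions UNIV}"
  have der: "((\<lambda>y. c * \<psi> (a *\<^sub>R y + v)) has_derivative (\<lambda>h. h \<bullet> ((c * a) *\<^sub>R grad \<psi> (a *\<^sub>R x + v)))) (at x)"
    if "\<psi> \<in> test_functions UNIV" for \<psi> :: "'a \<Rightarrow> real" and c x
  proof -
    have 1: "((\<lambda>y. a *\<^sub>R y + v) has_derivative (\<lambda>h. a *\<^sub>R h)) (at x)"
      by (auto intro!: derivative_eq_intros)
    from has_derivative_mult_right[OF has_derivative_compose[OF this test_functions_has_derivative[OF that]], of c]
    show ?thesis by (simp add: mult.assoc)
  qed
  note g = grad_eqI[OF der]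
  have "C_k k f" if "f \<in> F" for k f
  proof (rule C_k_family[OF _ _ that])
    show "f differentiable at x" if "f \<in> F" for f x
      using that der unfolding F_def by (auto simp: differentiable_def)
    show "(\<lambda>x. grad f x \<bullet> b) \<in> F" if F: "f \<in> F" and b: "b \<in> Basis" for f b
    proof -
      obtain \<psi> c where f: "f = (\<lambda>y. c * \<psi> (a *\<^sub>R y + v))" "\<psi> \<in> test_functions UNIV"
        using F by (auto simp: F_def)
      have "(\<lambda>x. grad f x \<bullet> b) = (\<lambda>x. (c * a) * (\<lambda>x. grad \<psi> x \<bullet> b) (a *\<^sub>R x + v))"
        unfolding f(1) g[OF f(2)] by simp
      then show ?thesis unfolding F_def using test_functions_grad[OF f(2) b]
        by (intro CollectI exI[of _ "\<lambda>x. grad \<psi> x \<bullet> b"] exI[of _ "c * a"]) simp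
    qed
  qed
  moreover have "bounded {y. c * \<psi> (a *\<^sub>R y + v) \<noteq> 0}"
  proof -
    have "bounded ((\<lambda>z. (1 / a) *\<^sub>R z) ` (\<lambda>z. z - v) ` {z. \<psi> z \<noteq> 0})"
      using assms(1) unfolding test_functions_UNIV_iff
      by (intro bounded_scaling bounded_translation_minus) auto
    then have "bounded ((\<lambda>z. (1 / a) *\<^sub>R (z - v)) ` {z. \<psi> z \<noteq> 0})"
      by (simp add: image_image)
    moreover have "{y. c * \<psi> (a *\<^sub>R y + v) \<noteq> 0} \<subseteq> (\<lambda>z. (1 / a) *\<^sub>R (z - v)) ` {z. \<psi> z \<noteq> 0}"
    proof
      fix y assume "y \<in> {y. c * \<psi> (a *\<^sub>R y + v) \<noteq> 0}"
      then have "a *\<^sub>R y + v \<in> {z. \<psi> z \<noteq> 0}" by auto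
      moreover have "y = (1 / a) *\<^sub>R ((a *\<^sub>R y + v) - v)" using assms(2) by simp
      ultimately show "y \<in> (\<lambda>z. (1 / a) *\<^sub>R (z - v)) ` {z. \<psi> z \<noteq> 0}" by blast
    qed
    ultimately show ?thesis by (rule bounded_subset)
  qed
  ultimately show "(\<lambda>y. c * \<psi> (a *\<^sub>R y + v)) \<in> test_functions UNIV"
    using assms(1) unfolding test_functions_UNIV_iff[of "\<lambda>y. c * \<psi> (a *\<^sub>R y + v)"] F_def by blast
  show "grad (\<lambda>y. c * \<psi> (a *\<^sub>R y + v)) x = (c * a) *\<^sub>R grad \<psi> (a *\<^sub>R x + v)"
    by (rule g[OF assms(1)])
qed

section \<open>The flat function exp(-1/t) and bump functions\<close>

definition flat :: "nat \<Rightarrow> real \<Rightarrow> real" where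
  "flat j t = (if t > 0 then exp (- (1 / t)) / t ^ j else 0)"

lemma flat_nonneg: "flat j t \<ge> 0"
  by (simp add: flat_def)

lemma flat_pos_iff: "flat j t > 0 \<longleftrightarrow> t > 0"
  by (simp add: flat_def)

lemma flat_eq_0: "t \<le> 0 \<Longrightarrow> flat j t = 0"
  by (simp add: flat_def)

lemma power_div_fact_le_exp:
  fixes x :: real
  assumes "x \<ge> 0"
  shows "x ^ j / fact j \<le> exp x"
proof -
  have "(\<Sum>n\<in>{j}. x ^ n /\<^sub>R fact n) \<le> (\<Sum>n. x ^ n /\<^sub>R fact n)"
    using assms by (intro sum_le_suminf summable_exp_generic) auto
  also have "\<dots> = exp x" by (simp add: exp_def)
  finally show ?thesis by (simp add: field_simps)
qed

text \<open>A single term of the exponential series at \<open>1 / t\<close> dominates the power. The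
  case \<open>j = 2\<close> matters most: \<open>flat 2\<close> is the derivative of
  \<open>flat 0\<close>, so 2 bounds the slope of \<open>flat 0\<close>.\<close>

lemma flat_le: "flat j t \<le> fact j"
proof (cases "t > 0")
  case True
  have "(1 / t) ^ j / fact j \<le> exp (1 / t)"
    using True by (intro power_div_fact_le_exp) auto
  then show ?thesis using True by (simp add: flat_def exp_minus field_simps)
qed (simp add: flat_def)

lemma flat_Suc: "t * flat (Suc j) t = flat j t"
  by (simp add: flat_def)

text \<open>Differentiating exp(-1/t) produces inverse powers of t. This is the reason for the index
  j: the linear span of the whole family is closed under differentiation.\<close>

lemma DERIV_flat: "(flat j has_real_derivative (flat (j + 2) t - j * flat (j + 1) t)) (at t)"
proof -
  consider "t > 0" | "t < 0" | "t = 0" by linarith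
  then show ?thesis
  proof cases
    case 1
    have "((\<lambda>t. exp (- (1 / t)) * inverse t ^ j) has_real_derivative
       (flat (j + 2) t - j * flat (j + 1) t)) (at t)"
    proof (cases j)
      case 0
      then show ?thesis using 1
        by (auto intro!: derivative_eq_intros simp: flat_def field_simps power2_eq_square)
    next
      case (Suc i)
      then show ?thesis using 1
        by (auto intro!: derivative_eq_intros simp: flat_def divide_simps power2_eq_square)
           (cases i; simp add: algebra_simps)
    qed
    then show ?thesis
      by (rule has_field_derivative_transform_within_open[where S="{0<..}"])
         (use 1 in \<open>auto simp: flat_def field_simps\<close>)
  next
    case 2
    have "((\<lambda>t. 0) has_real_derivative (flat (j + 2) t - j * flat (j + 1) t)) (at t)"
      using 2 by (simp add: flat_def)
    then show ?thesis
      by (rule has_field_derivative_transform_within_open[where S="{..<0}"])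
         (use 2 in \<open>auto simp: flat_def\<close>)
  next
    \<comment> \<open>At 0 the quotient \<open>flat j h / h\<close> equals
      \<open>h * flat (j + 2) h\<close>, and \<open>flat (j + 2)\<close> is bounded, so the
      derivative there is 0.\<close>
    case 3
    have "((\<lambda>h. (flat j (0 + h) - flat j 0) / h) \<longlongrightarrow> 0) (at 0)"
    proof (rule Lim_null_comparison)
      have "norm (flat j h / h) \<le> \<bar>h\<bar> * fact (j + 2)" for h
      proof (cases "h = 0")
        case False
        have "flat j h / h = h * flat (j + 2) h"
          using False flat_Suc[of h j] flat_Suc[of h "Suc j"] by (simp add: field_simps)
        then show ?thesis using flat_le[of "j+2" h] flat_nonneg[of "j+2" h]
          by (simp add: abs_mult mult_left_mono)
      qed (simp add: flat_def)
      then show "\<forall>\<^sub>F h in at 0. norm ((flat j (0 + h) - flat j 0) / h) \<le> \<bar>h\<bar> * fact (j + 2)"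
        by (simp add: flat_eq_0)
      show "((\<lambda>h. \<bar>h\<bar> * fact (j + 2)) \<longlongrightarrow> (0::real)) (at 0)"
        by (auto intro!: tendsto_eq_intros)
    qed
    then show ?thesis using 3 by (simp add: DERIV_def flat_eq_0)
  qed
qed

lemma flat_mono: "a \<le> b \<Longrightarrow> flat 0 a \<le> flat 0 b"
  by (auto simp: flat_def frac_le)

lemma flat_0_le_1: "flat 0 t \<le> 1"
  using flat_le[of 0 t] by simp

lemma flat_lipschitz: "\<bar>flat 0 a - flat 0 b\<bar> \<le> 2 * \<bar>a - b\<bar>"
proof -
  have "norm (flat 0 a - flat 0 b) \<le> 2 * norm (a - b)"
  proof (rule differentiable_bound[OF convex_UNIV])
    show "(flat 0 has_derivative (*) (flat 2 x)) (at x within UNIV)" for x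
      using DERIV_flat[of 0 x] by (simp add: has_field_derivative_def numeral_2_eq_2)
    show "onorm ((*) (flat 2 x)) \<le> 2" for x
      using flat_le[of 2 x] flat_nonneg[of 2 x]
      by (intro onorm_bound) (auto simp: abs_mult mult_right_mono)
  qed auto
  then show ?thesis by simp
qed

text \<open>Derivatives of the radial bump bring in coordinates as factors and higher flat
  functions. Closing under sums and products gives an algebra that is stable under partial
  derivatives, as \<open>C_k_family\<close> requires.\<close>

inductive_set bump_algebra :: "real \<Rightarrow> ('a::euclidean_space \<Rightarrow> real) set" for \<epsilon> where
  const: "(\<lambda>_. c) \<in> bump_algebra \<epsilon>"
| coord: "(\<lambda>x. x \<bullet> b) \<in> bump_algebra \<epsilon>"
| flat: "(\<lambda>x. flat j (\<epsilon>\<^sup>2 - x \<bullet> x)) \<in> bump_algebra \<epsilon>"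
| add: "f \<in> bump_algebra \<epsilon> \<Longrightarrow> g \<in> bump_algebra \<epsilon> \<Longrightarrow> (\<lambda>x. f x + g x) \<in> bump_algebra \<epsilon>"
| mult: "f \<in> bump_algebra \<epsilon> \<Longrightarrow> g \<in> bump_algebra \<epsilon> \<Longrightarrow> (\<lambda>x. f x * g x) \<in> bump_algebra \<epsilon>"

lemma bump_algebra_derivative:
  fixes f :: "'a::euclidean_space \<Rightarrow> real"
  assumes "f \<in> bump_algebra \<epsilon>"
  shows "(\<forall>x. f differentiable (at x)) \<and> (\<forall>b\<in>Basis. (\<lambda>x. grad f x \<bullet> b) \<in> bump_algebra \<epsilon>)"
  using assms
proof induction
  case (const c)
  have "((\<lambda>_. c) has_derivative (\<lambda>_. 0)) (at x)" for x :: 'a by simp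
  from grad_inner_Basis[OF this] show ?case by (simp add: bump_algebra.const)
next
  case (coord d)
  have "((\<lambda>x. x \<bullet> d) has_derivative (\<lambda>h. h \<bullet> d)) (at x)" for x :: 'a
    by (auto intro!: derivative_eq_intros)
  from grad_inner_Basis[OF this] this show ?case
    by (auto simp: bump_algebra.const differentiable_def)
next
  case (flat j)
  have der: "((\<lambda>x. flat j (\<epsilon>\<^sup>2 - x \<bullet> x)) has_derivative
      (\<lambda>h. (flat (j + 2) (\<epsilon>\<^sup>2 - x \<bullet> x) + (- j) * flat (j + 1) (\<epsilon>\<^sup>2 - x \<bullet> x)) * (- 2 * (x \<bullet> h)))) (at x)" for x :: 'a
  proof -
    have "((\<lambda>x. \<epsilon>\<^sup>2 - x \<bullet> x) has_derivative (\<lambda>h. - 2 * (x \<bullet> h))) (at x)"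
      by (auto intro!: derivative_eq_intros simp: inner_commute)
    from has_derivative_compose[OF this DERIV_flat[unfolded has_field_derivative_def]]
    show ?thesis by simp
  qed
  have "(\<lambda>x. (flat (j + 2) (\<epsilon>\<^sup>2 - x \<bullet> x) + (- j) * flat (j + 1) (\<epsilon>\<^sup>2 - x \<bullet> x)) * (- 2 * (x \<bullet> b))) \<in> bump_algebra \<epsilon>"
    for b :: 'a
    by (intro bump_algebra.intros)
  with grad_inner_Basis[OF der] der show ?case
    by (auto simp: differentiable_def)
next
  case (add f g)
  then have der: "((\<lambda>x. f x + g x) has_derivative (\<lambda>h. h \<bullet> grad f x + h \<bullet> grad g x)) (at x)" for x
    by (auto intro!: derivative_intros has_derivative_grad)
  from grad_inner_Basis[OF der] der add show ?case
    by (auto simp: inner_commute[of _ "grad _ _"] differentiable_def intro: bump_algebra.add)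
next
  case (mult f g)
  then have der: "((\<lambda>x. f x * g x) has_derivative (\<lambda>h. f x * (h \<bullet> grad g x) + (h \<bullet> grad f x) * g x)) (at x)" for x
    by (auto intro!: derivative_intros has_derivative_grad)
  from grad_inner_Basis[OF der] der mult show ?case
    by (auto simp: inner_commute[of _ "grad _ _"] differentiable_def
        intro!: bump_algebra.add bump_algebra.mult)
qed

lemma exists_mollifier:
  assumes "\<epsilon> > 0"
  shows "\<exists>\<eta>::'a::euclidean_space \<Rightarrow> real. \<eta> \<in> test_functions UNIV \<and> (\<forall>x. \<eta> x \<ge> 0) \<and>
    (\<forall>x. \<eta> x \<noteq> 0 \<longrightarrow> norm x < \<epsilon>) \<and> integrable lborel \<eta> \<and> integral\<^sup>L lborel \<eta> = 1"
proof -
  define f where "f = (\<lambda>x::'a. flat 0 (\<epsilon>\<^sup>2 - x \<bullet> x))"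
  have f_alg: "f \<in> bump_algebra \<epsilon>" unfolding f_def by (rule bump_algebra.flat)
  have supp: "norm x < \<epsilon>" if "f x \<noteq> 0" for x
  proof -
    have "(norm x)\<^sup>2 < \<epsilon>\<^sup>2"
      using that flat_eq_0[of "\<epsilon>\<^sup>2 - x \<bullet> x" 0] by (force simp: f_def power2_norm_eq_inner)
    then show ?thesis using assms by (simp add: power_less_imp_less_base)
  qed
  have "C_k k f" for k
    by (rule C_k_family[of "bump_algebra \<epsilon>"]) (use bump_algebra_derivative f_alg in auto)
  moreover have "bounded {x. f x \<noteq> 0}"
    using supp by (intro bounded_subset[OF bounded_ball[of 0 \<epsilon>]]) auto
  ultimately have f_test: "f \<in> test_functions UNIV" by (simp add: test_functions_UNIV_iff)
  have cont: "continuous_on UNIV f" using f_test by (rule test_functions_continuous)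
  have "integrable lborel (\<lambda>x. indicator (cball 0 \<epsilon>) x *\<^sub>R f x)"
    by (rule borel_integrable_compact) (auto intro: continuous_on_subset[OF cont])
  moreover have "(\<lambda>x. indicator (cball 0 \<epsilon>) x *\<^sub>R f x) = f"
    using supp by (force simp: indicator_def)
  ultimately have int: "integrable lborel f" by simp
  define Z where "Z = integral\<^sup>L lborel f"
  \<comment> \<open>If the integral vanished, f would be 0 almost everywhere, yet f is positive on a
    ball of positive measure.\<close>
  have "Z \<noteq> 0"
  proof
    assume "Z = 0"
    then have "AE x in lborel. f x = 0"
      using int unfolding Z_def
      by (subst (asm) integral_nonneg_eq_0_iff_AE) (auto simp: f_def flat_nonneg)
    then have "AE x::'a in lborel. x \<notin> ball 0 \<epsilon>"
    proof eventually_elim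
      case (elim x)
      then have "\<epsilon>\<^sup>2 - x \<bullet> x \<le> 0" using flat_pos_iff[of 0 "\<epsilon>\<^sup>2 - x \<bullet> x"] by (auto simp: f_def)
      then have "\<epsilon>\<^sup>2 \<le> (norm x)\<^sup>2" by (simp add: power2_norm_eq_inner)
      then show ?case using assms by (auto dest: power_less_imp_less_base power_strict_mono[of _ _ 2])
    qed
    then have "emeasure lborel (ball (0::'a) \<epsilon>) = 0"
      by (subst (asm) AE_iff_measurable[OF _ refl]) (auto simp: ball_def)
    then show False
      using assms emeasure_lborel_ball_finite[of "0::'a" \<epsilon>] content_ball_pos[of \<epsilon> "0::'a"]
      by (simp add: measure_def)
  qed
  moreover have "Z \<ge> 0" unfolding Z_def by (auto simp: f_def flat_nonneg)
  ultimately have Z: "Z > 0" by simp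
  define \<eta> where "\<eta> = (\<lambda>x. (1 / Z) * f (1 *\<^sub>R x + 0))"
  have "\<eta> \<in> test_functions UNIV" unfolding \<eta>_def by (rule test_functions_affine(1)[OF f_test]) simp
  moreover have "\<forall>x. \<eta> x \<ge> 0" using Z by (simp add: \<eta>_def f_def flat_nonneg)
  moreover have "\<forall>x. \<eta> x \<noteq> 0 \<longrightarrow> norm x < \<epsilon>" using supp by (simp add: \<eta>_def)
  moreover have "integrable lborel \<eta>" using int by (simp add: \<eta>_def)
  moreover have "integral\<^sup>L lborel \<eta> = 1" using int Z by (simp add: \<eta>_def Z_def[symmetric])
  ultimately show ?thesis by blast
qed

subsection \<open>Square integrable functions\<close>

text \<open>The squared L^2 norm is kept in the extended non-negative reals, so that inequalities
  between norms carry no integrability conditions.\<close>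

definition L2sq :: "('a::euclidean_space \<Rightarrow> real) \<Rightarrow> ennreal" where
  "L2sq f = (\<integral>\<^sup>+x. ennreal ((f x)\<^sup>2) \<partial>lborel)"

lemma numeral_mult_ennreal: "x \<ge> 0 \<Longrightarrow> numeral n * ennreal x = ennreal (numeral n * x)"
  by (simp add: ennreal_mult)

lemma L2sq_finite_iff:
  assumes "f \<in> borel_measurable borel"
  shows "L2sq f < \<infinity> \<longleftrightarrow> integrable lborel (\<lambda>x. (f x)\<^sup>2)"
  using assms by (auto simp: L2sq_def integrable_iff_bounded)

lemma L2sq_eq_integral:
  assumes "integrable lborel (\<lambda>x. (f x)\<^sup>2)"
  shows "L2sq f = ennreal (LBINT x. (f x)\<^sup>2)"
  unfolding L2sq_def by (rule nn_integral_eq_integral[OF assms]) simp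

lemma sum_squares_bound2: "(a + b)\<^sup>2 \<le> 2 * a\<^sup>2 + 2 * (b::real)\<^sup>2"
  using sum_squares_bound[of a b] by (simp add: power2_sum)

lemma L2sq_add:
  assumes [measurable]: "f \<in> borel_measurable borel" "g \<in> borel_measurable borel"
  shows "L2sq (\<lambda>x. f x + g x) \<le> 2 * L2sq f + 2 * L2sq g"
proof -
  have "L2sq (\<lambda>x. f x + g x) \<le> (\<integral>\<^sup>+x. 2 * ennreal ((f x)\<^sup>2) + 2 * ennreal ((g x)\<^sup>2) \<partial>lborel)"
    unfolding L2sq_def
  proof (rule nn_integral_mono)
    fix x
    have "ennreal ((f x + g x)\<^sup>2) \<le> ennreal (2 * (f x)\<^sup>2 + 2 * (g x)\<^sup>2)"
      by (intro ennreal_leI sum_squares_bound2)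
    then show "ennreal ((f x + g x)\<^sup>2) \<le> 2 * ennreal ((f x)\<^sup>2) + 2 * ennreal ((g x)\<^sup>2)"
      by (simp add: ennreal_mult)
  qed
  also have "\<dots> = 2 * L2sq f + 2 * L2sq g"
    unfolding L2sq_def by (subst nn_integral_add) (auto simp: nn_integral_cmult)
  finally show ?thesis .
qed

lemma L2sq_diff:
  assumes [measurable]: "f \<in> borel_measurable borel" "g \<in> borel_measurable borel"
  shows "L2sq (\<lambda>x. f x - g x) \<le> 2 * L2sq f + 2 * L2sq g"
  using L2sq_add[of f "\<lambda>x. - g x"] by (simp add: L2sq_def)

lemma L2sq_cmult:
  assumes [measurable]: "f \<in> borel_measurable borel"
  shows "L2sq (\<lambda>x. c * f x) = ennreal (c\<^sup>2) * L2sq f"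
  unfolding L2sq_def by (subst nn_integral_cmult[symmetric]) (auto simp: power_mult_distrib ennreal_mult)

lemma nn_integral_lborel_affine:
  fixes c :: real and t :: "'a::euclidean_space"
  assumes [measurable]: "f \<in> borel_measurable borel" and c: "c \<noteq> 0"
  shows "(\<integral>\<^sup>+x. f x \<partial>lborel) = ennreal (\<bar>c\<bar> ^ DIM('a)) * (\<integral>\<^sup>+x. f (c *\<^sub>R x + t) \<partial>lborel)"
  by (subst lborel_affine[OF c, of t])
     (simp add: nn_integral_density nn_integral_distr nn_integral_cmult add.commute)

lemma L2sq_affine:
  fixes c :: real and t :: "'a::euclidean_space"
  assumes [measurable]: "f \<in> borel_measurable borel" and c: "c \<noteq> 0"
  shows "L2sq f = ennreal (\<bar>c\<bar> ^ DIM('a)) * L2sq (\<lambda>x. f (c *\<^sub>R x + t))"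
  unfolding L2sq_def by (rule nn_integral_lborel_affine[OF _ c]) simp

text \<open>The change of variables costs a factor c^(-N), where N is the dimension, and this is at
  most 2^N once c is at least 1/2.\<close>

lemma L2sq_affine_le:
  fixes c :: real and t :: "'a::euclidean_space"
  assumes [measurable]: "f \<in> borel_measurable borel" and c: "c \<ge> 1/2"
  shows "L2sq (\<lambda>x. f (c *\<^sub>R x + t)) \<le> ennreal (2 ^ DIM('a)) * L2sq f"
proof -
  have "1 \<le> (2 * \<bar>c\<bar>) ^ DIM('a)" using c by (intro one_le_power) auto
  then have "ennreal 1 * L2sq (\<lambda>x. f (c *\<^sub>R x + t)) \<le> ennreal ((2 * \<bar>c\<bar>) ^ DIM('a)) * L2sq (\<lambda>x. f (c *\<^sub>R x + t))"
    by (intro mult_right_mono ennreal_leI) auto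
  also have "\<dots> = ennreal (2 ^ DIM('a)) * L2sq f"
    using c by (subst L2sq_affine[of f c t]) (auto simp: power_mult_distrib ennreal_mult mult.assoc)
  finally show ?thesis by simp
qed

lemma L2sq_translate:
  fixes t :: "'a::euclidean_space"
  assumes [measurable]: "f \<in> borel_measurable borel"
  shows "L2sq (\<lambda>x. f (x + t)) = L2sq f"
  using L2sq_affine[of f 1 t] by simp

section \<open>Continuity of dilations and translations in L^2\<close>

definition L2_affine_continuous :: "('a::euclidean_space \<Rightarrow> real) \<Rightarrow> bool" where
  "L2_affine_continuous f \<longleftrightarrow> (\<forall>e>0. \<exists>d>0. \<forall>c v. \<bar>c - 1\<bar> < d \<longrightarrow> norm v < d \<longrightarrow>
     L2sq (\<lambda>x. f (c *\<^sub>R x + v) - f x) \<le> ennreal e)"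

text \<open>Either x or its image may be the point known to lie in a given ball, hence the
  disjunction. In both cases x has norm at most 2R + 1, because c is at least 1/2.\<close>

lemma affine_near_identity:
  fixes c :: real
  assumes "\<bar>c - 1\<bar> < d" "norm v < d" "d \<le> 1/2" "norm x \<le> R \<or> norm (c *\<^sub>R x + v) \<le> R"
  shows "norm (c *\<^sub>R x + v - x) \<le> d * (2 * R + 2)"
proof -
  have R: "R \<ge> 0" using assms(4) norm_ge_zero order_trans by blast
  have c: "c \<ge> 1/2" using assms by linarith
  have "norm x \<le> 2 * R + 1"
  proof (cases "norm x \<le> R")
    case False
    then have "norm (c *\<^sub>R x + v) \<le> R" using assms(4) by blast
    moreover have "norm (c *\<^sub>R x) \<le> norm (c *\<^sub>R x + v) + norm v"
      by (metis add_diff_cancel_right' norm_triangle_ineq4)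
    ultimately have "c * norm x \<le> R + 1/2" using assms c by simp
    moreover have "(1/2) * norm x \<le> c * norm x" using c by (intro mult_right_mono) auto
    ultimately show ?thesis by linarith
  qed (use R in linarith)
  moreover have "norm (c *\<^sub>R x + v - x) \<le> \<bar>c - 1\<bar> * norm x + norm v"
  proof -
    have "c *\<^sub>R x + v - x = (c - 1) *\<^sub>R x + v" by (simp add: algebra_simps)
    then show ?thesis using norm_triangle_ineq[of "(c - 1) *\<^sub>R x" v] by (simp only: norm_scaleR)
  qed
  moreover have "\<bar>c - 1\<bar> * norm x \<le> d * (2 * R + 1)"
    using calculation assms by (intro mult_mono) auto
  ultimately show ?thesis using assms(2) by (simp add: algebra_simps)
qed

text \<open>Squeeze B between a compact K and an open U with U - K of small measure. An affine map
  close to the identity, and likewise its inverse, moves points of K by less than the distance to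
  the complement of U. So if exactly one of x and its image lies in B, then one of them lies in U -
  K.\<close>

lemma L2_affine_continuous_indicator:
  fixes B :: "'a::euclidean_space set"
  assumes [measurable]: "B \<in> sets borel" and "bounded B"
  shows "L2_affine_continuous (indicator B)"
  unfolding L2_affine_continuous_def
proof (intro allI impI)
  fix e :: real assume e: "e > 0"
  define N where "N = 1 + (2::real) ^ DIM('a)"
  have N: "N > 0" by (simp add: N_def add_pos_pos)
  \<comment> \<open>U - K has measure at most 2e'. It is counted once directly and once through its
    affine preimage, which costs 2^N more with N the dimension; this yields the factor
    \<open>N\<close> defined above.\<close>
  define e' where "e' = e / (2 * N)"
  have e': "e' > 0" using e N by (simp add: e'_def)
  have "B \<in> sets lebesgue" by (simp add: assms(1) sets_completionI_sets)
  then obtain U K where U: "open U" "B \<subseteq> U" "emeasure lebesgue (U - B) < ennreal e'"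
    and K: "closed K" "K \<subseteq> B" "emeasure lebesgue (B - K) < ennreal e'"
    using sets_lebesgue_outer_open[OF _ e'] sets_lebesgue_inner_closed[OF _ e'] by metis
  have [measurable]: "U \<in> sets borel" "K \<in> sets borel" using U K by auto
  have cK: "compact K" using K assms(2) by (meson bounded_subset compact_eq_bounded_closed)
  have UK: "emeasure lborel (U - K) \<le> ennreal (2 * e')"
  proof -
    have "emeasure lborel (U - K) \<le> emeasure lborel ((U - B) \<union> (B - K))"
      using U K by (intro emeasure_mono) auto
    also have "\<dots> \<le> emeasure lborel (U - B) + emeasure lborel (B - K)"
      by (intro emeasure_subadditive) auto
    also have "\<dots> \<le> ennreal e' + ennreal e'"
      using U(3) K(3) by (intro add_mono) (auto simp: less_imp_le)
    finally show ?thesis using e' by (simp flip: ennreal_plus)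
  qed
  obtain r where r: "r > 0" "\<And>x y. x \<in> K \<Longrightarrow> dist x y < r \<Longrightarrow> y \<in> U"
  proof -
    have "K \<subseteq> U" using K(2) U(2) by blast
    from compact_subset_open_imp_ball_epsilon_subset[OF cK U(1) this]
    obtain r where "r > 0" "(\<Union>x\<in>K. ball x r) \<subseteq> U" .
    then show ?thesis using that unfolding mem_ball[symmetric] by blast
  qed
  obtain R where R: "\<And>x. x \<in> K \<Longrightarrow> norm x \<le> R" "R > 0"
    using compact_imp_bounded[OF cK] by (meson bounded_pos)
  \<comment> \<open>The second entry makes the displacement on the relevant points at most r/2; the
    first keeps c at least 1/2.\<close>
  define d where "d = min (1/2) (r / (2 * (2 * R + 2)))"
  have d: "d > 0" "d \<le> 1/2" using r(1) R(2) unfolding d_def by (simp_all only: min.cobounded1 min_less_iff_conj) simp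
  have dR: "d * (2 * R + 2) < r"
  proof -
    have "d * (2 * R + 2) \<le> (r / (2 * (2 * R + 2))) * (2 * R + 2)"
      using R by (intro mult_right_mono) (auto simp: d_def)
    also have "\<dots> = r / 2" using R by (simp add: field_simps)
    finally show ?thesis using r by simp
  qed
  have "L2sq (\<lambda>x. indicator B (c *\<^sub>R x + v) - indicator B x) \<le> ennreal e"
    if c: "\<bar>c - 1\<bar> < d" and v: "norm v < d" for c v
  proof -
    have c2: "c \<ge> 1/2" using c d by linarith
    have "L2sq (\<lambda>x. indicator B (c *\<^sub>R x + v) - indicator B x)
      \<le> (\<integral>\<^sup>+x. indicator (U - K) x + indicator (U - K) (c *\<^sub>R x + v) \<partial>lborel)"
      unfolding L2sq_def
    proof (rule nn_integral_mono)
      fix x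
      have "x \<in> U - K \<or> c *\<^sub>R x + v \<in> U - K" if ne: "(x \<in> B) \<noteq> (c *\<^sub>R x + v \<in> B)"
      proof -
        have near: "norm (c *\<^sub>R x + v - x) < r" if "norm x \<le> R \<or> norm (c *\<^sub>R x + v) \<le> R"
          using affine_near_identity[OF c v d(2) that] dR by linarith
        have "c *\<^sub>R x + v \<in> U" if "x \<in> K"
          using near R(1)[OF that] r(2)[OF that] by (auto simp: dist_norm norm_minus_commute)
        moreover have "x \<in> U" if "c *\<^sub>R x + v \<in> K"
          using near R(1)[OF that] r(2)[OF that] by (auto simp: dist_norm)
        ultimately show ?thesis using ne K U by blast
      qed
      then show "ennreal ((indicator B (c *\<^sub>R x + v) - indicator B x)\<^sup>2)
        \<le> indicator (U - K) x + indicator (U - K) (c *\<^sub>R x + v)"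
        by (cases "(x \<in> B) \<noteq> (c *\<^sub>R x + v \<in> B)") (auto simp: indicator_def)
    qed
    also have "\<dots> = emeasure lborel (U - K) + (\<integral>\<^sup>+x. indicator (U - K) (c *\<^sub>R x + v) \<partial>lborel)"
      by (subst nn_integral_add) auto
    also have "(\<integral>\<^sup>+x. indicator (U - K) (c *\<^sub>R x + v) \<partial>lborel) = L2sq (\<lambda>x. indicator (U - K) (c *\<^sub>R x + v))"
      by (auto simp: L2sq_def indicator_def intro!: nn_integral_cong)
    also have "\<dots> \<le> ennreal (2 ^ DIM('a)) * L2sq (indicator (U - K) :: 'a \<Rightarrow> real)"
      by (rule L2sq_affine_le[OF _ c2]) simp
    also have "L2sq (indicator (U - K) :: 'a \<Rightarrow> real) = emeasure lborel (U - K)"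
    proof -
      have "L2sq (indicator (U - K) :: 'a \<Rightarrow> real) = (\<integral>\<^sup>+x. indicator (U - K) x \<partial>lborel)"
        unfolding L2sq_def by (intro nn_integral_cong) (auto simp: indicator_def)
      then show ?thesis by simp
    qed
    also have "emeasure lborel (U - K) + ennreal (2 ^ DIM('a)) * emeasure lborel (U - K)
      = ennreal N * emeasure lborel (U - K)"
      by (simp add: N_def distrib_right)
    also have "\<dots> \<le> ennreal N * ennreal (2 * e')"
      by (intro mult_left_mono UK) auto
    also have "\<dots> = ennreal e" using N e by (simp add: e'_def flip: ennreal_mult)
    finally show ?thesis by (simp add: add_left_mono)
  qed
  then show "\<exists>d>0. \<forall>c v. \<bar>c - 1\<bar> < d \<longrightarrow> norm v < d \<longrightarrow>
     L2sq (\<lambda>x. indicator B (c *\<^sub>R x + v) - indicator B x) \<le> ennreal e"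
    using d by blast
qed

lemma L2_affine_continuous_add:
  fixes f g :: "'a::euclidean_space \<Rightarrow> real"
  assumes [measurable]: "f \<in> borel_measurable borel" "g \<in> borel_measurable borel"
    and f: "L2_affine_continuous f" and g: "L2_affine_continuous g"
  shows "L2_affine_continuous (\<lambda>x. f x + g x)"
  unfolding L2_affine_continuous_def
proof (intro allI impI)
  fix e :: real assume e: "e > 0"
  have e4: "e / 4 > 0" using e by simp
  obtain d1 where d1: "d1 > 0"
    "\<And>c v. \<bar>c - 1\<bar> < d1 \<Longrightarrow> norm v < d1 \<Longrightarrow> L2sq (\<lambda>x. f (c *\<^sub>R x + v) - f x) \<le> ennreal (e / 4)"
    using f[unfolded L2_affine_continuous_def, rule_format, OF e4] by blast
  obtain d2 where d2: "d2 > 0"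
    "\<And>c v. \<bar>c - 1\<bar> < d2 \<Longrightarrow> norm v < d2 \<Longrightarrow> L2sq (\<lambda>x. g (c *\<^sub>R x + v) - g x) \<le> ennreal (e / 4)"
    using g[unfolded L2_affine_continuous_def, rule_format, OF e4] by blast
  note d = d1 d2
  have "L2sq (\<lambda>x. f (c *\<^sub>R x + v) + g (c *\<^sub>R x + v) - (f x + g x)) \<le> ennreal e"
    if "\<bar>c - 1\<bar> < min d1 d2" "norm v < min d1 d2" for c v
  proof -
    have "L2sq (\<lambda>x. f (c *\<^sub>R x + v) + g (c *\<^sub>R x + v) - (f x + g x)) =
      L2sq (\<lambda>x. (f (c *\<^sub>R x + v) - f x) + (g (c *\<^sub>R x + v) - g x))"
      by (simp add: algebra_simps)
    also have "\<dots> \<le> 2 * L2sq (\<lambda>x. f (c *\<^sub>R x + v) - f x) + 2 * L2sq (\<lambda>x. g (c *\<^sub>R x + v) - g x)"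
      by (rule L2sq_add) measurable
    also have "\<dots> \<le> 2 * ennreal (e / 4) + 2 * ennreal (e / 4)"
      using that by (intro add_mono mult_left_mono d) auto
    also have "\<dots> = ennreal (2 * (e / 4) + 2 * (e / 4))"
      using e by (simp add: numeral_mult_ennreal flip: ennreal_plus)
    finally show ?thesis by simp
  qed
  then show "\<exists>d>0. \<forall>c v. \<bar>c - 1\<bar> < d \<longrightarrow> norm v < d \<longrightarrow>
     L2sq (\<lambda>x. f (c *\<^sub>R x + v) + g (c *\<^sub>R x + v) - (f x + g x)) \<le> ennreal e"
    using d by (intro exI[of _ "min d1 d2"]) auto
qed

lemma L2_affine_continuous_cmult:
  fixes f :: "'a::euclidean_space \<Rightarrow> real"
  assumes [measurable]: "f \<in> borel_measurable borel" and f: "L2_affine_continuous f"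
  shows "L2_affine_continuous (\<lambda>x. a * f x)"
  unfolding L2_affine_continuous_def
proof (intro allI impI)
  fix e :: real assume e: "e > 0"
  have a: "a\<^sup>2 + 1 > 0" by (simp add: add_nonneg_pos)
  obtain d where d: "d > 0"
    "\<And>c v. \<bar>c - 1\<bar> < d \<Longrightarrow> norm v < d \<Longrightarrow> L2sq (\<lambda>x. f (c *\<^sub>R x + v) - f x) \<le> ennreal (e / (a\<^sup>2 + 1))"
    using f e a unfolding L2_affine_continuous_def by (metis divide_pos_pos)
  have "L2sq (\<lambda>x. a * f (c *\<^sub>R x + v) - a * f x) \<le> ennreal e"
    if "\<bar>c - 1\<bar> < d" "norm v < d" for c v
  proof -
    have "L2sq (\<lambda>x. a * f (c *\<^sub>R x + v) - a * f x) = ennreal (a\<^sup>2) * L2sq (\<lambda>x. f (c *\<^sub>R x + v) - f x)"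
      by (subst L2sq_cmult[symmetric]) (auto simp: algebra_simps)
    also have "\<dots> \<le> ennreal (a\<^sup>2) * ennreal (e / (a\<^sup>2 + 1))"
      using that by (intro mult_left_mono d) auto
    also have "\<dots> = ennreal (a\<^sup>2 * (e / (a\<^sup>2 + 1)))"
      using e a by (subst ennreal_mult) auto
    also have "\<dots> \<le> ennreal e"
      using e a by (intro ennreal_leI) (simp add: field_simps)
    finally show ?thesis .
  qed
  then show "\<exists>d>0. \<forall>c v. \<bar>c - 1\<bar> < d \<longrightarrow> norm v < d \<longrightarrow>
     L2sq (\<lambda>x. a * f (c *\<^sub>R x + v) - a * f x) \<le> ennreal e"
    using d by blast
qed

lemma L2_affine_continuous_limit:
  fixes f :: "'a::euclidean_space \<Rightarrow> real"
  assumes [measurable]: "f \<in> borel_measurable borel" "\<And>n. g n \<in> borel_measurable borel"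
    and g: "\<And>n. L2_affine_continuous (g n)"
    and lim: "(\<lambda>n. L2sq (\<lambda>x. f x - g n x)) \<longlonglongrightarrow> 0"
  shows "L2_affine_continuous f"
  unfolding L2_affine_continuous_def
proof (intro allI impI)
  fix e :: real assume e: "e > 0"
  \<comment> \<open>Two squared triangle inequalities and the cost 2^DIM of the affine map turn the
    error of \<open>g n\<close> into this multiple of itself. Half of e pays for it, and a quarter
    goes to the modulus of \<open>g n\<close>.\<close>
  define N where "N = 4 * (2::real) ^ DIM('a) + 4"
  have N: "N > 0" by (simp add: N_def add_pos_pos)
  have "\<forall>\<^sub>F n in sequentially. L2sq (\<lambda>x. f x - g n x) < ennreal (e / (2 * N))"
    using e N by (intro order_tendstoD(2)[OF lim]) auto
  then obtain n where n: "L2sq (\<lambda>x. f x - g n x) \<le> ennreal (e / (2 * N))"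
    by (auto simp: eventually_sequentially intro: less_imp_le)
  obtain d where d: "d > 0"
    "\<And>c v. \<bar>c - 1\<bar> < d \<Longrightarrow> norm v < d \<Longrightarrow> L2sq (\<lambda>x. g n (c *\<^sub>R x + v) - g n x) \<le> ennreal (e / 8)"
    using g[of n] e unfolding L2_affine_continuous_def by (metis divide_pos_pos zero_less_numeral)
  have "L2sq (\<lambda>x. f (c *\<^sub>R x + v) - f x) \<le> ennreal e"
    if cv: "\<bar>c - 1\<bar> < min d (1/2)" "norm v < min d (1/2)" for c v
  proof -
    let ?D = "\<lambda>x. f x - g n x"
    have c2: "c \<ge> 1/2" using cv(1) by arith
    have "L2sq (\<lambda>x. f (c *\<^sub>R x + v) - f x) =
      L2sq (\<lambda>x. (?D (c *\<^sub>R x + v) - ?D x) + (g n (c *\<^sub>R x + v) - g n x))"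
      by (simp add: algebra_simps)
    also have "\<dots> \<le> 2 * L2sq (\<lambda>x. ?D (c *\<^sub>R x + v) - ?D x) + 2 * L2sq (\<lambda>x. g n (c *\<^sub>R x + v) - g n x)"
      by (rule L2sq_add) measurable
    also have "\<dots> \<le> 2 * (2 * L2sq (\<lambda>x. ?D (c *\<^sub>R x + v)) + 2 * L2sq ?D) + 2 * ennreal (e / 8)"
      using cv by (intro add_mono mult_left_mono d L2sq_diff) auto
    also have "\<dots> \<le> 2 * (2 * (ennreal (2 ^ DIM('a)) * L2sq ?D) + 2 * L2sq ?D) + 2 * ennreal (e / 8)"
      using c2 by (intro add_mono mult_left_mono L2sq_affine_le) auto
    also have "\<dots> = ennreal N * L2sq ?D + 2 * ennreal (e / 8)"
      by (simp add: N_def algebra_simps ennreal_mult ennreal_mult')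
    also have "\<dots> \<le> ennreal N * ennreal (e / (2 * N)) + 2 * ennreal (e / 8)"
      by (intro add_mono mult_left_mono n) auto
    also have "\<dots> = ennreal (N * (e / (2 * N)) + 2 * (e / 8))"
      using e N by (simp add: numeral_mult_ennreal flip: ennreal_mult ennreal_plus)
    also have "\<dots> \<le> ennreal e"
      using e N by (intro ennreal_leI) (simp add: field_simps)
    finally show ?thesis .
  qed
  then show "\<exists>d>0. \<forall>c v. \<bar>c - 1\<bar> < d \<longrightarrow> norm v < d \<longrightarrow>
     L2sq (\<lambda>x. f (c *\<^sub>R x + v) - f x) \<le> ennreal e"
    using d by (intro exI[of _ "min d (1/2)"]) auto
qed

lemma L2_affine_continuous_sum:
  fixes f :: "'i \<Rightarrow> 'a::euclidean_space \<Rightarrow> real"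
  assumes "finite I" "\<And>i. i \<in> I \<Longrightarrow> f i \<in> borel_measurable borel"
    and "\<And>i. i \<in> I \<Longrightarrow> L2_affine_continuous (f i)"
  shows "L2_affine_continuous (\<lambda>x. \<Sum>i\<in>I. f i x)"
  using assms
proof (induction I rule: finite_induct)
  case empty
  then show ?case by (auto simp: L2_affine_continuous_def L2sq_def intro!: exI[of _ 1])
next
  case (insert i I)
  then show ?case
    by (simp add: L2_affine_continuous_add borel_measurable_sum)
qed

text \<open>Simple functions cut off at large balls are finite combinations of indicators of bounded
  Borel sets, and they converge to f in L^2. Mollified dilations are averages of affine images, so
  this is the source of all convergence in the approximation theorem.\<close>

theorem L2_affine_continuousI:
  fixes f :: "'a::euclidean_space \<Rightarrow> real"
  assumes [measurable]: "f \<in> borel_measurable borel" and int: "integrable lborel (\<lambda>x. (f x)\<^sup>2)"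
  shows "L2_affine_continuous f"
proof -
  obtain F where F: "\<And>i. simple_function lborel (F i)" "\<And>x. (\<lambda>i. F i x) \<longlonglongrightarrow> f x"
    "\<And>i x. \<bar>F i x\<bar> \<le> 2 * \<bar>f x\<bar>"
    using borel_measurable_implies_sequence_metric[of f lborel 0] by (auto simp: dist_real_def)
  have [measurable]: "F i \<in> borel_measurable borel" for i
    using borel_measurable_simple_function[OF F(1)] by simp
  \<comment> \<open>The cut-off makes the level sets bounded, as the indicator lemma demands. It
    does not affect the pointwise limit, since every x lies in almost all of the balls.\<close>
  define g where "g n x = indicator (cball 0 (real n)) x * F n x" for n x
  have [measurable]: "g n \<in> borel_measurable borel" for n unfolding g_def
    by (intro borel_measurable_times borel_measurable_indicator) auto
  show ?thesis
  proof (rule L2_affine_continuous_limit[where g=g])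
    show "L2_affine_continuous (g n)" for n
    proof -
      have eq: "g n = (\<lambda>x. \<Sum>y\<in>range (F n). y * indicator (F n -` {y} \<inter> cball 0 (real n)) x)"
      proof
        fix x
        have eq: "F n x = (\<Sum>y\<in>range (F n). indicator (F n -` {y}) x *\<^sub>R y)"
          using simple_function_indicator_representation_banach[OF F(1)[of n], of x]
          by (simp only: space_lborel space_borel Int_UNIV_right UNIV_I simp_thms)
        have "g n x = indicator (cball 0 (real n)) x * (\<Sum>y\<in>range (F n). indicator (F n -` {y}) x *\<^sub>R y)"
          unfolding g_def by (rule arg_cong[OF eq])
        also have "\<dots> = (\<Sum>y\<in>range (F n). y * indicator (F n -` {y} \<inter> cball 0 (real n)) x)"
          by (simp add: sum_distrib_left indicator_inter_arith mult_ac)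
        finally show "g n x = (\<Sum>y\<in>range (F n). y * indicator (F n -` {y} \<inter> cball 0 (real n)) x)" .
      qed
      have fin: "finite (range (F n))" using F(1)[of n] by (simp add: simple_function_def)
      have [measurable]: "F n -` {y} \<inter> cball 0 (real n) \<in> sets borel" for y
      proof -
        have "F n -` {y} \<inter> space borel \<in> sets borel" by (rule measurable_sets[of _ _ borel]) auto
        then show ?thesis by auto
      qed
      show ?thesis unfolding eq
        using fin by (intro L2_affine_continuous_sum L2_affine_continuous_cmult
            L2_affine_continuous_indicator) (auto intro: bounded_subset[OF bounded_cball])
    qed
    have "(\<lambda>n. \<integral>\<^sup>+x. ennreal ((f x - g n x)\<^sup>2) \<partial>lborel) \<longlonglongrightarrow> (\<integral>\<^sup>+(x::'a). 0 \<partial>lborel)"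
    proof (rule nn_integral_dominated_convergence[where w="\<lambda>x. ennreal (9 * (f x)\<^sup>2)"])
      show "(\<integral>\<^sup>+x. ennreal (9 * (f x)\<^sup>2) \<partial>lborel) < \<infinity>"
        by (subst nn_integral_eq_integral) (use int in auto)
      show "AE x in lborel. ennreal ((f x - g n x)\<^sup>2) \<le> ennreal (9 * (f x)\<^sup>2)" for n
      proof (intro AE_I2 ennreal_leI)
        fix x
        have "\<bar>f x - g n x\<bar> \<le> 3 * \<bar>f x\<bar>"
          using F(3)[of n x] by (auto simp: g_def indicator_def)
        then have "\<bar>f x - g n x\<bar>\<^sup>2 \<le> (3 * \<bar>f x\<bar>)\<^sup>2" by (intro power_mono) auto
        then show "(f x - g n x)\<^sup>2 \<le> 9 * (f x)\<^sup>2" by (simp add: power_mult_distrib)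
      qed
      have "(\<lambda>n. ennreal ((f x - g n x)\<^sup>2)) \<longlonglongrightarrow> 0" for x
      proof -
        have "\<forall>\<^sub>F n in sequentially. g n x = F n x"
          using eventually_ge_at_top[of "nat \<lceil>norm x\<rceil>"]
          by eventually_elim (auto simp: g_def indicator_def)
        then have "(\<lambda>n. g n x) \<longlonglongrightarrow> f x"
          using F(2)[of x] by (simp add: tendsto_cong)
        then have "(\<lambda>n. (f x - g n x)\<^sup>2) \<longlonglongrightarrow> (f x - f x)\<^sup>2" by (intro tendsto_intros)
        from tendsto_ennrealI[OF this] show ?thesis by simp
      qed
      then show "AE x in lborel. (\<lambda>n. ennreal ((f x - g n x)\<^sup>2)) \<longlonglongrightarrow> 0" by simp
    qed measurable
    then show "(\<lambda>n. L2sq (\<lambda>x. f x - g n x)) \<longlonglongrightarrow> 0" by (simp add: L2sq_def)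
  qed measurable
qed

subsection \<open>Mollification\<close>

lemma integrable_mult_L2:
  fixes f g :: "'b \<Rightarrow> real"
  assumes [measurable]: "f \<in> borel_measurable M" "g \<in> borel_measurable M"
    and "integrable M (\<lambda>x. (f x)\<^sup>2)" "integrable M (\<lambda>x. (g x)\<^sup>2)"
  shows "integrable M (\<lambda>x. f x * g x)"
proof (rule Bochner_Integration.integrable_bound)
  show "integrable M (\<lambda>x. (f x)\<^sup>2 + (g x)\<^sup>2)" using assms by simp
  show "AE x in M. norm (f x * g x) \<le> norm ((f x)\<^sup>2 + (g x)\<^sup>2)"
  proof (rule AE_I2)
    fix x
    have "2 * \<bar>f x\<bar> * \<bar>g x\<bar> \<le> \<bar>f x\<bar>\<^sup>2 + \<bar>g x\<bar>\<^sup>2" by (rule sum_squares_bound)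
    moreover have "0 \<le> \<bar>f x\<bar> * \<bar>g x\<bar>" by simp
    ultimately show "norm (f x * g x) \<le> norm ((f x)\<^sup>2 + (g x)\<^sup>2)"
      by (simp only: real_norm_def abs_mult power2_abs)
  qed
qed measurable

text \<open>Jensen's inequality for the square with respect to the density \<eta>, obtained from
  Cauchy-Schwarz for sqrt \<eta> and sqrt \<eta> |f|. If \<eta> f is not integrable, the left-hand
  integral has the default value 0.\<close>

lemma nn_integral_weighted_square:
  fixes f \<eta> :: "'b \<Rightarrow> real"
  assumes [measurable]: "f \<in> borel_measurable M" "\<eta> \<in> borel_measurable M"
    and nn: "\<And>x. \<eta> x \<ge> 0" and one: "(\<integral>\<^sup>+x. ennreal (\<eta> x) \<partial>M) = 1"
  shows "ennreal ((\<integral>x. \<eta> x * f x \<partial>M)\<^sup>2) \<le> (\<integral>\<^sup>+x. ennreal (\<eta> x * (f x)\<^sup>2) \<partial>M)"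
proof (cases "integrable M (\<lambda>x. \<eta> x * f x)")
  case True
  have "ennreal \<bar>\<integral>x. \<eta> x * f x \<partial>M\<bar> \<le> (\<integral>\<^sup>+x. ennreal \<bar>\<eta> x * f x\<bar> \<partial>M)"
    using integral_norm_bound_ennreal[OF True] by simp
  also have "\<dots> = (\<integral>\<^sup>+x. ennreal (sqrt (\<eta> x)) * ennreal (sqrt (\<eta> x) * \<bar>f x\<bar>) \<partial>M)"
    using nn by (intro nn_integral_cong) (simp add: abs_mult mult.assoc[symmetric] flip: ennreal_mult)
  finally have "(ennreal \<bar>\<integral>x. \<eta> x * f x \<partial>M\<bar>)\<^sup>2 \<le> \<dots>\<^sup>2" by (rule power_mono) simp
  also have "\<dots> \<le> (\<integral>\<^sup>+x. (ennreal (sqrt (\<eta> x)))\<^sup>2 \<partial>M) * (\<integral>\<^sup>+x. (ennreal (sqrt (\<eta> x) * \<bar>f x\<bar>))\<^sup>2 \<partial>M)"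
    by (rule Cauchy_Schwarz_nn_integral) measurable
  also have "(\<integral>\<^sup>+x. (ennreal (sqrt (\<eta> x)))\<^sup>2 \<partial>M) = 1"
    using nn one by (simp add: ennreal_power)
  also have "(\<integral>\<^sup>+x. (ennreal (sqrt (\<eta> x) * \<bar>f x\<bar>))\<^sup>2 \<partial>M) = (\<integral>\<^sup>+x. ennreal (\<eta> x * (f x)\<^sup>2) \<partial>M)"
    using nn by (simp add: ennreal_power power_mult_distrib)
  finally show ?thesis by (simp add: ennreal_power)
qed (simp add: not_integrable_integral_eq)

lemma lborel_distr_reflect:
  fixes t :: "'a::euclidean_space"
  shows "distr lborel borel (\<lambda>x. t - x) = lborel"
  using lborel_affine[of "-1" t] by (simp add: density_1)

lemma lborel_integral_reflect:
  fixes t :: "'a::euclidean_space" and f :: "'a \<Rightarrow> 'b::{banach, second_countable_topology}"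
  assumes [measurable]: "f \<in> borel_measurable borel"
  shows "(LBINT x. f (t - x)) = (LBINT x. f x)"
    and "integrable lborel (\<lambda>x. f (t - x)) \<longleftrightarrow> integrable lborel f"
  using integral_distr[of "\<lambda>x. t - x" lborel borel f] integrable_distr_eq[of "\<lambda>x. t - x" lborel borel f]
  by (simp_all add: lborel_distr_reflect)

lemma lborel_integral_translate:
  fixes t :: "'a::euclidean_space" and f :: "'a \<Rightarrow> 'b::{banach, second_countable_topology}"
  assumes [measurable]: "f \<in> borel_measurable borel"
  shows "(LBINT x. f (x + t)) = (LBINT x. f x)"
    and "integrable lborel (\<lambda>x. f (x + t)) \<longleftrightarrow> integrable lborel f"
  using integral_distr[of "\<lambda>x. t + x" lborel borel f] integrable_distr_eq[of "\<lambda>x. t + x" lborel borel f]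
  by (simp_all add: lborel_distr_plus) (simp_all add: add.commute)

section \<open>Integrability, Lipschitz and Taylor bounds for test functions\<close>

lemma continuous_bounded_support:
  fixes f :: "'a::euclidean_space \<Rightarrow> 'b::euclidean_space"
  assumes cont: "continuous_on UNIV f" and bdd: "bounded {x. f x \<noteq> 0}"
  shows "integrable lborel f" and "\<exists>B>0. \<forall>x. norm (f x) \<le> B"
proof -
  obtain R where "\<forall>x\<in>{x. f x \<noteq> 0}. norm x \<le> R" using bdd unfolding bounded_iff by blast
  then have R: "{x. f x \<noteq> 0} \<subseteq> cball 0 R" by auto
  have "integrable lborel (\<lambda>x. indicator (cball 0 R) x *\<^sub>R f x)"
    by (rule borel_integrable_compact) (auto intro: continuous_on_subset[OF cont])
  moreover have "(\<lambda>x. indicator (cball 0 R) x *\<^sub>R f x) = f"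
    using R by (force simp: indicator_def)
  ultimately show "integrable lborel f" by simp
  have "bounded (f ` cball 0 R)"
    by (intro compact_imp_bounded compact_continuous_image continuous_on_subset[OF cont]) auto
  then obtain B where B: "B > 0" "\<And>x. x \<in> cball 0 R \<Longrightarrow> norm (f x) \<le> B" by (auto simp: bounded_pos)
  have "norm (f x) \<le> B" for x
  proof (cases "f x = 0")
    case False
    then show ?thesis using R by (intro B(2)) auto
  qed (use B in simp)
  then show "\<exists>B>0. \<forall>x. norm (f x) \<le> B" using B(1) by blast
qed

lemma test_functions_bounded_support: "\<phi> \<in> test_functions \<Omega> \<Longrightarrow> bounded {x. \<phi> x \<noteq> 0}"
  by (metis (mono_tags, lifting) bounded_closure bounded_subset closure_subset compact_imp_bounded
      mem_Collect_eq test_functions_def)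

lemma grad_bounded_support:
  assumes "\<phi> \<in> test_functions \<Omega>"
  shows "bounded {x. grad \<phi> x \<noteq> 0}"
proof (rule bounded_subset)
  show "bounded (closure {x. \<phi> x \<noteq> 0})"
    using test_functions_bounded_support[OF assms] by (rule bounded_closure)
  show "{x. grad \<phi> x \<noteq> 0} \<subseteq> closure {x. \<phi> x \<noteq> 0}" using grad_eq_0 by blast
qed

lemma test_functions_measurable [measurable_dest]:
  "\<phi> \<in> test_functions \<Omega> \<Longrightarrow> \<phi> \<in> borel_measurable borel"
  by (intro borel_measurable_continuous_onI test_functions_continuous)

lemma grad_measurable: "\<phi> \<in> test_functions \<Omega> \<Longrightarrow> grad \<phi> \<in> borel_measurable borel"
  by (intro borel_measurable_continuous_onI continuous_on_grad)

lemma test_functions_integrable: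
  assumes "\<phi> \<in> test_functions \<Omega>"
  shows "integrable lborel \<phi>" and "integrable lborel (\<lambda>x. (\<phi> x)\<^sup>2)"
    and "integrable lborel (\<lambda>x. (norm (grad \<phi> x))\<^sup>2)"
  using test_functions_bounded_support[OF assms] grad_bounded_support[OF assms]
    test_functions_continuous[OF assms] continuous_on_grad[OF assms]
  by (intro continuous_bounded_support continuous_intros; simp)+

lemma test_functions_lipschitz:
  assumes "\<phi> \<in> test_functions \<Omega>"
  shows "\<exists>L>0. \<forall>x y. \<bar>\<phi> x - \<phi> y\<bar> \<le> L * norm (x - y)"
proof -
  obtain B where B: "B > 0" "\<And>x. norm (grad \<phi> x) \<le> B"
    using continuous_bounded_support(2)[OF continuous_on_grad[OF assms] grad_bounded_support[OF assms]]
    by blast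
  have "norm (\<phi> x - \<phi> y) \<le> B * norm (x - y)" for x y
  proof (rule differentiable_bound[OF convex_UNIV])
    show "(\<phi> has_derivative (\<lambda>h. h \<bullet> grad \<phi> x)) (at x within UNIV)" for x
      using test_functions_has_derivative[OF assms] by simp
    show "onorm (\<lambda>h. h \<bullet> grad \<phi> x) \<le> B" for x
    proof (rule onorm_bound)
      show "norm (h \<bullet> grad \<phi> x) \<le> B * norm h" for h
        using Cauchy_Schwarz_ineq2[of h "grad \<phi> x"] B(2)[of x]
        by (smt (verit) mult.commute mult_left_mono norm_ge_zero real_norm_def)
    qed (use B in simp)
  qed auto
  then show ?thesis using B(1) by auto
qed

lemma grad_lipschitz:
  fixes \<phi> :: "'a::euclidean_space \<Rightarrow> real"
  assumes "\<phi> \<in> test_functions \<Omega>"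
  shows "\<exists>L>0. \<forall>x y. norm (grad \<phi> x - grad \<phi> y) \<le> L * norm (x - y)"
proof -
  have "\<forall>b\<in>Basis. \<exists>L>0. \<forall>x y. \<bar>grad \<phi> x \<bullet> b - grad \<phi> y \<bullet> b\<bar> \<le> L * norm (x - y)"
    using test_functions_lipschitz[OF test_functions_grad[OF assms]] by blast
  then obtain L where L: "\<And>b. b \<in> Basis \<Longrightarrow> L b > 0"
    "\<And>b x y. b \<in> Basis \<Longrightarrow> \<bar>grad \<phi> x \<bullet> b - grad \<phi> y \<bullet> b\<bar> \<le> L b * norm (x - y)"
    by metis
  have "norm (grad \<phi> x - grad \<phi> y) \<le> sum L Basis * norm (x - y)" for x y
  proof -
    have "norm (grad \<phi> x - grad \<phi> y) \<le> (\<Sum>b\<in>Basis. \<bar>(grad \<phi> x - grad \<phi> y) \<bullet> b\<bar>)"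
      by (rule norm_le_l1)
    also have "\<dots> \<le> (\<Sum>b\<in>Basis. L b * norm (x - y))"
      by (intro sum_mono) (simp add: inner_diff_left L)
    finally show ?thesis by (simp add: sum_distrib_right)
  qed
  moreover have "sum L Basis > 0" using L(1) by (intro sum_pos) auto
  ultimately show ?thesis by blast
qed

text \<open>The remainder is uniform in x because the gradient is globally Lipschitz. This
  uniformity serves twice: for differentiating a convolution and for showing that gradients
  integrate to zero.\<close>

lemma test_functions_taylor:
  fixes \<phi> :: "'a::euclidean_space \<Rightarrow> real"
  assumes "\<phi> \<in> test_functions \<Omega>"
  shows "\<exists>L>0. \<forall>x h. \<bar>\<phi> (x + h) - \<phi> x - h \<bullet> grad \<phi> x\<bar> \<le> L * (norm h)\<^sup>2"
proof -
  obtain L where L: "L > 0" "\<And>x y. norm (grad \<phi> x - grad \<phi> y) \<le> L * norm (x - y)"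
    using grad_lipschitz[OF assms] by blast
  have "\<bar>\<phi> (x + h) - \<phi> x - h \<bullet> grad \<phi> x\<bar> \<le> L * (norm h)\<^sup>2" for x h
  proof -
    have "\<exists>t\<in>{0<..<1}. \<phi> (x + 1 *\<^sub>R h) - \<phi> (x + 0 *\<^sub>R h) = (\<lambda>r. (r *\<^sub>R h) \<bullet> grad \<phi> (x + t *\<^sub>R h)) (1 - 0)"
    proof (rule mvt_simple)
      fix t :: real
      have "((\<lambda>t. x + t *\<^sub>R h) has_derivative (\<lambda>r. r *\<^sub>R h)) (at t within {0..1})"
        by (auto intro!: derivative_eq_intros)
      from has_derivative_compose[OF this test_functions_has_derivative[OF assms]]
      show "((\<lambda>t. \<phi> (x + t *\<^sub>R h)) has_derivative (\<lambda>r. (r *\<^sub>R h) \<bullet> grad \<phi> (x + t *\<^sub>R h))) (at t within {0..1})" .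
    qed simp
    then obtain t where t: "0 < t" "t < 1" "\<phi> (x + h) - \<phi> x = h \<bullet> grad \<phi> (x + t *\<^sub>R h)" by auto
    have "\<bar>\<phi> (x + h) - \<phi> x - h \<bullet> grad \<phi> x\<bar> = \<bar>h \<bullet> (grad \<phi> (x + t *\<^sub>R h) - grad \<phi> x)\<bar>"
      by (simp add: t(3) inner_diff_right)
    also have "\<dots> \<le> norm h * norm (grad \<phi> (x + t *\<^sub>R h) - grad \<phi> x)"
      by (rule Cauchy_Schwarz_ineq2)
    also have "\<dots> \<le> norm h * (L * norm (t *\<^sub>R h))"
      using L(2)[of "x + t *\<^sub>R h" x] by (intro mult_left_mono) auto
    also have "\<dots> \<le> norm h * (L * norm h)"
      using t L(1) by (intro mult_left_mono) (auto simp: mult_left_le_one_le)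
    finally show ?thesis by (simp add: power2_eq_square mult_ac)
  qed
  then show ?thesis using L(1) by blast
qed

section \<open>Derivatives and L^2 error of mollifications\<close>

definition mollify :: "('a::euclidean_space \<Rightarrow> real) \<Rightarrow> ('a \<Rightarrow> real) \<Rightarrow> 'a \<Rightarrow> real" where
  "mollify \<eta> f x = (LBINT y. f y * \<eta> (x - y))"

lemma integrable_mult_bounded:
  fixes f g :: "'a::euclidean_space \<Rightarrow> real"
  assumes "integrable lborel f" and [measurable]: "g \<in> borel_measurable borel"
    and "\<And>x. \<bar>g x\<bar> \<le> B"
  shows "integrable lborel (\<lambda>x. f x * g x)"
proof (rule Bochner_Integration.integrable_bound)
  have [measurable]: "f \<in> borel_measurable borel" using assms(1) by auto
  show "integrable lborel (\<lambda>x. B * f x)" using assms(1) by simp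
  show "(\<lambda>x. f x * g x) \<in> borel_measurable lborel" by measurable
  show "AE x in lborel. norm (f x * g x) \<le> norm (B * f x)"
  proof (rule AE_I2)
    fix x
    have "\<bar>g x\<bar> \<le> \<bar>B\<bar>" using assms(3)[of x] by linarith
    then have "\<bar>g x\<bar> * \<bar>f x\<bar> \<le> \<bar>B\<bar> * \<bar>f x\<bar>" by (rule mult_right_mono) simp
    then show "norm (f x * g x) \<le> norm (B * f x)"
      by (simp add: abs_mult mult.commute)
  qed
qed

lemma test_functions_bounded: "\<phi> \<in> test_functions \<Omega> \<Longrightarrow> \<exists>B>0. \<forall>x. \<bar>\<phi> x\<bar> \<le> B"
  using continuous_bounded_support(2)[OF test_functions_continuous test_functions_bounded_support]
  by simp

lemma mollify_integrable:
  assumes "integrable lborel f" "\<psi> \<in> test_functions UNIV"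
  shows "integrable lborel (\<lambda>y. f y * \<psi> (x - y))"
proof -
  obtain B where "\<And>x. \<bar>\<psi> x\<bar> \<le> B" using test_functions_bounded[OF assms(2)] by blast
  moreover note [measurable] = test_functions_measurable[OF assms(2)]
  have "(\<lambda>y. \<psi> (x - y)) \<in> borel_measurable borel" by measurable
  ultimately show ?thesis
    using assms by (intro integrable_mult_bounded[where B=B]) auto
qed

text \<open>Integrating the uniform Taylor remainder of \<psi> against |f| leaves an error of order
  |h|^2 times the L^1 norm of f, so differentiation passes under the integral directly.\<close>

lemma mollify_has_derivative:
  fixes f :: "'a::euclidean_space \<Rightarrow> real"
  assumes f: "integrable lborel f" and \<psi>: "\<psi> \<in> test_functions UNIV"
  shows "(mollify \<psi> f has_derivative (\<lambda>h. \<Sum>b\<in>Basis. (h \<bullet> b) * mollify (\<lambda>x. grad \<psi> x \<bullet> b) f x)) (at x)"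
proof -
  define T where "T h = (\<Sum>b\<in>Basis. (h \<bullet> b) * mollify (\<lambda>x. grad \<psi> x \<bullet> b) f x)" for h
  have "bounded_linear T"
    unfolding T_def by (intro bounded_linear_sum bounded_linear_mult_const bounded_linear_inner_left)
  obtain L where L: "L > 0" "\<And>x h. \<bar>\<psi> (x + h) - \<psi> x - h \<bullet> grad \<psi> x\<bar> \<le> L * (norm h)\<^sup>2"
    using test_functions_taylor[OF \<psi>] by blast
  define F where "F = (LBINT y. \<bar>f y\<bar>)"
  have F: "F \<ge> 0" by (simp add: F_def)
  have est: "\<bar>mollify \<psi> f (x + h) - mollify \<psi> f x - T h\<bar> \<le> L * F * (norm h)\<^sup>2" for h
  proof -
    have Ti: "T h = (LBINT y. f y * (h \<bullet> grad \<psi> (x - y)))"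
     and Tint: "integrable lborel (\<lambda>y. f y * (h \<bullet> grad \<psi> (x - y)))"
    proof -
      have I: "integrable lborel (\<lambda>y. (h \<bullet> b) * (f y * (grad \<psi> (x - y) \<bullet> b)))" if "b \<in> Basis" for b
        using mollify_integrable[OF f test_functions_grad[OF \<psi> that]] by simp
      have eq: "f y * (h \<bullet> grad \<psi> (x - y)) = (\<Sum>b\<in>Basis. (h \<bullet> b) * (f y * (grad \<psi> (x - y) \<bullet> b)))" for y
        by (subst euclidean_inner) (simp add: sum_distrib_left mult_ac)
      show "T h = (LBINT y. f y * (h \<bullet> grad \<psi> (x - y)))"
        unfolding eq T_def mollify_def using I by (simp add: Bochner_Integration.integral_sum)
      show "integrable lborel (\<lambda>y. f y * (h \<bullet> grad \<psi> (x - y)))"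
        unfolding eq using I by (rule Bochner_Integration.integrable_sum)
    qed
    note I = mollify_integrable[OF f \<psi>]
    have "mollify \<psi> f (x + h) - mollify \<psi> f x - T h =
      (LBINT y. f y * \<psi> (x + h - y) - f y * \<psi> (x - y) - f y * (h \<bullet> grad \<psi> (x - y)))"
      unfolding Ti mollify_def using I[of "x + h"] I[of x] Tint by simp
    also have "\<bar>\<dots>\<bar> \<le> (LBINT y. L * (norm h)\<^sup>2 * \<bar>f y\<bar>)"
    proof (rule integral_abs_bound_integral)
      show "integrable lborel (\<lambda>y. L * (norm h)\<^sup>2 * \<bar>f y\<bar>)" using f by simp
      show "\<bar>f y * \<psi> (x + h - y) - f y * \<psi> (x - y) - f y * (h \<bullet> grad \<psi> (x - y))\<bar>
        \<le> L * (norm h)\<^sup>2 * \<bar>f y\<bar>" for y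
      proof -
        have "\<bar>f y * \<psi> (x + h - y) - f y * \<psi> (x - y) - f y * (h \<bullet> grad \<psi> (x - y))\<bar> =
          \<bar>f y\<bar> * \<bar>\<psi> (x - y + h) - \<psi> (x - y) - h \<bullet> grad \<psi> (x - y)\<bar>"
          by (simp add: abs_mult[symmetric] algebra_simps)
        also have "\<dots> \<le> \<bar>f y\<bar> * (L * (norm h)\<^sup>2)" by (intro mult_left_mono L) auto
        finally show ?thesis by (simp add: mult_ac)
      qed
    qed (use I Tint in auto)
    also have "\<dots> = L * F * (norm h)\<^sup>2" by (simp add: F_def mult_ac)
    finally show ?thesis .
  qed
  show ?thesis
    unfolding has_derivative_at_alt T_def[symmetric]
  proof (intro conjI allI impI)
    show "bounded_linear T" by fact
    fix e :: real assume e: "e > 0"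
    \<comment> \<open>The summand 1 keeps the denominator positive when f vanishes almost
      everywhere.\<close>
    define d where "d = e / (L * F + 1)"
    have LF: "L * F \<ge> 0" using L(1) F by simp
    have d: "d > 0" using e LF by (simp add: d_def)
    have "norm (mollify \<psi> f y - mollify \<psi> f x - T (y - x)) \<le> e * norm (y - x)" if "norm (y - x) < d" for y
    proof -
      have "\<bar>mollify \<psi> f y - mollify \<psi> f x - T (y - x)\<bar> \<le> (L * F * norm (y - x)) * norm (y - x)"
        using est[of "y - x"] by (simp add: power2_eq_square mult_ac)
      also have "\<dots> \<le> e * norm (y - x)"
      proof (rule mult_right_mono)
        have "L * F * norm (y - x) \<le> (L * F + 1) * d"
          using that LF by (intro mult_mono) auto
        also have "\<dots> = e" using LF by (simp add: d_def)
        finally show "L * F * norm (y - x) \<le> e" .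
      qed simp
      finally show ?thesis by simp
    qed
    then show "\<exists>d>0. \<forall>y. norm (y - x) < d \<longrightarrow>
        norm (mollify \<psi> f y - mollify \<psi> f x - T (y - x)) \<le> e * norm (y - x)"
      using d by blast
  qed
qed

text \<open>Derivatives fall on the mollifier and the chain rule factor c can be absorbed into it,
  so the mollifications of a fixed f, taken over all test functions, are closed under partial
  derivatives.\<close>

lemma mollify_affine_smooth:
  fixes f :: "'a::euclidean_space \<Rightarrow> real"
  assumes f: "integrable lborel f" and \<psi>: "\<psi> \<in> test_functions UNIV" and c: "c \<noteq> 0"
  shows "C_k k (\<lambda>x. mollify \<psi> f (c *\<^sub>R x + v))"
    and "b \<in> Basis \<Longrightarrow> grad (\<lambda>x. mollify \<psi> f (c *\<^sub>R x + v)) x \<bullet> b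
      = c * mollify (\<lambda>x. grad \<psi> x \<bullet> b) f (c *\<^sub>R x + v)"
proof -
  define F where "F = {\<lambda>x. mollify \<psi> f (c *\<^sub>R x + v) | \<psi>. \<psi> \<in> test_functions UNIV}"
  have der: "((\<lambda>x. mollify \<psi> f (c *\<^sub>R x + v)) has_derivative
      (\<lambda>h. \<Sum>b\<in>Basis. (c *\<^sub>R h \<bullet> b) * mollify (\<lambda>x. grad \<psi> x \<bullet> b) f (c *\<^sub>R x + v))) (at x)"
    if "\<psi> \<in> test_functions UNIV" for \<psi> x
  proof -
    have "((\<lambda>x. c *\<^sub>R x + v) has_derivative (\<lambda>h. c *\<^sub>R h)) (at x)"
      by (auto intro!: derivative_eq_intros)
    from has_derivative_compose[OF this mollify_has_derivative[OF f that]] show ?thesis .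
  qed
  have g: "grad (\<lambda>x. mollify \<psi> f (c *\<^sub>R x + v)) x \<bullet> b = c * mollify (\<lambda>x. grad \<psi> x \<bullet> b) f (c *\<^sub>R x + v)"
    if "\<psi> \<in> test_functions UNIV" "b \<in> Basis" for \<psi> x b
  proof -
    have "grad (\<lambda>x. mollify \<psi> f (c *\<^sub>R x + v)) x \<bullet> b =
      (\<Sum>i\<in>Basis. (c *\<^sub>R b \<bullet> i) * mollify (\<lambda>x. grad \<psi> x \<bullet> i) f (c *\<^sub>R x + v))"
      by (rule grad_inner_Basis[OF der[OF that(1)]])
    also have "\<dots> = (\<Sum>i\<in>Basis. if i = b then c * mollify (\<lambda>x. grad \<psi> x \<bullet> i) f (c *\<^sub>R x + v) else 0)"
      using that(2) by (intro sum.cong) (auto simp: inner_Basis)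
    finally show ?thesis using that(2) by (simp add: sum.delta)
  qed
  show "grad (\<lambda>x. mollify \<psi> f (c *\<^sub>R x + v)) x \<bullet> b = c * mollify (\<lambda>x. grad \<psi> x \<bullet> b) f (c *\<^sub>R x + v)"
    if "b \<in> Basis" using g \<psi> that by blast
  show "C_k k (\<lambda>x. mollify \<psi> f (c *\<^sub>R x + v))"
  proof (rule C_k_family[where F=F])
    show "h differentiable at x" if "h \<in> F" for h x
      using that der unfolding F_def by (auto simp: differentiable_def)
    show "(\<lambda>x. grad h x \<bullet> b) \<in> F" if h: "h \<in> F" and b: "b \<in> Basis" for h b
    proof -
      obtain \<psi> where h: "h = (\<lambda>x. mollify \<psi> f (c *\<^sub>R x + v))" and \<psi>: "\<psi> \<in> test_functions UNIV"
        using h by (auto simp: F_def)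
      have "(\<lambda>x. c * (grad \<psi> (1 *\<^sub>R x + 0) \<bullet> b)) \<in> test_functions UNIV"
        by (rule test_functions_affine(1)[OF test_functions_grad[OF \<psi> b]]) simp
      moreover have "(\<lambda>x. grad h x \<bullet> b) = (\<lambda>x. mollify (\<lambda>x. c * (grad \<psi> (1 *\<^sub>R x + 0) \<bullet> b)) f (c *\<^sub>R x + v))"
        unfolding h g[OF \<psi> b]
        by (simp add: mollify_def mult.left_commute[of _ c])
      ultimately show ?thesis unfolding F_def by blast
    qed
    show "(\<lambda>x. mollify \<psi> f (c *\<^sub>R x + v)) \<in> F" using \<psi> by (auto simp: F_def)
  qed
qed

text \<open>The mollification at c x + v is an \<eta>-average of the values f(c x + v - y). Jensen's
  inequality and Fubini bound the squared L^2 error by the worst affine difference over the support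
  of \<eta>.\<close>

lemma mollify_error:
  fixes f :: "'a::euclidean_space \<Rightarrow> real"
  assumes [measurable]: "f \<in> borel_measurable borel" and f2: "integrable lborel (\<lambda>x. (f x)\<^sup>2)"
    and \<eta>: "\<eta> \<in> test_functions UNIV" "\<And>x. \<eta> x \<ge> 0" "integral\<^sup>L lborel \<eta> = 1"
    and e: "\<And>y. \<eta> y \<noteq> 0 \<Longrightarrow> L2sq (\<lambda>x. f (c *\<^sub>R x + (v - y)) - f x) \<le> e"
  shows "L2sq (\<lambda>x. mollify \<eta> f (c *\<^sub>R x + v) - f x) \<le> e"
proof -
  note [measurable] = test_functions_measurable[OF \<eta>(1)]
  note \<eta>_int = test_functions_integrable[OF \<eta>(1)]
  have one: "(\<integral>\<^sup>+y. ennreal (\<eta> y) \<partial>lborel) = 1"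
    using \<eta> by (subst nn_integral_eq_integral[OF \<eta>_int(1)]) auto
  have eq: "mollify \<eta> f (c *\<^sub>R x + v) - f x = (LBINT y. \<eta> y * (f (c *\<^sub>R x + (v - y)) - f x))" for x
  proof -
    let ?X = "c *\<^sub>R x + v"
    have i: "integrable lborel (\<lambda>y. \<eta> y * f (?X - y))"
    proof (rule integrable_mult_L2)
      show "integrable lborel (\<lambda>y. (f (?X - y))\<^sup>2)"
        using lborel_integral_reflect(2)[of "\<lambda>y. (f y)\<^sup>2" ?X] f2 by simp
    qed (use \<eta>_int in auto)
    have "mollify \<eta> f ?X = (LBINT y. f (?X - y) * \<eta> (?X - (?X - y)))"
      unfolding mollify_def by (rule lborel_integral_reflect(1)[symmetric]) measurable
    also have "\<dots> = (LBINT y. \<eta> y * f (?X - y))" by (simp add: mult.commute)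
    finally have "mollify \<eta> f ?X - f x = (LBINT y. \<eta> y * f (?X - y)) - (LBINT y. \<eta> y * f x)"
      using \<eta>(3) by simp
    also have "\<dots> = (LBINT y. \<eta> y * f (?X - y) - \<eta> y * f x)"
      using i \<eta>_int(1) by simp
    finally show ?thesis by (simp add: algebra_simps)
  qed
  have "L2sq (\<lambda>x. mollify \<eta> f (c *\<^sub>R x + v) - f x)
    \<le> (\<integral>\<^sup>+x. \<integral>\<^sup>+y. ennreal (\<eta> y * (f (c *\<^sub>R x + (v - y)) - f x)\<^sup>2) \<partial>lborel \<partial>lborel)"
    unfolding L2sq_def eq
    by (intro nn_integral_mono nn_integral_weighted_square one \<eta>(2)) measurable
  also have "\<dots> = (\<integral>\<^sup>+y. \<integral>\<^sup>+x. ennreal (\<eta> y * (f (c *\<^sub>R x + (v - y)) - f x)\<^sup>2) \<partial>lborel \<partial>lborel)"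
    by (rule lborel_pair.Fubini') measurable
  also have "\<dots> = (\<integral>\<^sup>+y. ennreal (\<eta> y) * L2sq (\<lambda>x. f (c *\<^sub>R x + (v - y)) - f x) \<partial>lborel)"
    unfolding L2sq_def using \<eta>(2)
    by (intro nn_integral_cong) (simp add: ennreal_mult nn_integral_cmult)
  also have "\<dots> \<le> (\<integral>\<^sup>+y. ennreal (\<eta> y) * e \<partial>lborel)"
  proof (rule nn_integral_mono)
    show "ennreal (\<eta> y) * L2sq (\<lambda>x. f (c *\<^sub>R x + (v - y)) - f x) \<le> ennreal (\<eta> y) * e" for y
      using e[of y] by (cases "\<eta> y = 0") (auto intro: mult_left_mono)
  qed
  also have "\<dots> = e" using one by (simp add: nn_integral_multc)
  finally show ?thesis .
qed

subsection \<open>The kernel and the Gagliardo energy\<close>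

text \<open>The increment is the integral of a directional derivative along a segment. Jensen's
  inequality in the segment parameter and translation invariance then give the bound, which is the
  bridge from the H^1 norm to the Gagliardo energy.\<close>

lemma translation_estimate:
  fixes v :: "'a::euclidean_space \<Rightarrow> real"
  assumes v: "v \<in> test_functions \<Omega>"
  shows "L2sq (\<lambda>x. v (x + h) - v x) \<le> ennreal ((norm h)\<^sup>2) * L2sq (\<lambda>x. norm (grad v x))"
proof -
  note [measurable] = test_functions_measurable[OF v] grad_measurable[OF v]
  let ?I = "indicator {0..1::real} :: real \<Rightarrow> real"
  have ftc: "v (x + h) - v x = (LBINT t. ?I t * (h \<bullet> grad v (x + t *\<^sub>R h)))" for x
  proof -
    have "(LBINT t. ?I t *\<^sub>R (h \<bullet> grad v (x + t *\<^sub>R h))) = v (x + 1 *\<^sub>R h) - v (x + 0 *\<^sub>R h)"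
    proof (rule integral_FTC_Icc)
      fix t :: real
      have "((\<lambda>t. x + t *\<^sub>R h) has_derivative (\<lambda>r. r *\<^sub>R h)) (at t within {0..1})"
        by (auto intro!: derivative_eq_intros)
      from has_derivative_compose[OF this test_functions_has_derivative[OF v]]
      show "((\<lambda>t. v (x + t *\<^sub>R h)) has_vector_derivative (h \<bullet> grad v (x + t *\<^sub>R h))) (at t within {0..1})"
        by (simp add: has_vector_derivative_def)
    next
      show "continuous_on {0..1} (\<lambda>t. h \<bullet> grad v (x + t *\<^sub>R h))"
        by (intro continuous_on_inner continuous_on_const
            continuous_on_compose2[OF continuous_on_grad[OF v]] continuous_intros) auto
    qed simp
    then show ?thesis by simp
  qed
  have "L2sq (\<lambda>x. v (x + h) - v x)
    \<le> (\<integral>\<^sup>+x. \<integral>\<^sup>+t. ennreal (?I t * (h \<bullet> grad v (x + t *\<^sub>R h))\<^sup>2) \<partial>lborel \<partial>lborel)"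
    unfolding L2sq_def ftc
  proof (intro nn_integral_mono nn_integral_weighted_square)
    have "(\<integral>\<^sup>+t. ennreal (?I t) \<partial>lborel) = (\<integral>\<^sup>+(t::real). indicator {0..1} t \<partial>lborel)"
      by (intro nn_integral_cong) (auto simp: indicator_def)
    then show "(\<integral>\<^sup>+t. ennreal (?I t) \<partial>lborel) = 1" by simp
  qed auto
  also have "\<dots> = (\<integral>\<^sup>+t. \<integral>\<^sup>+x. ennreal (?I t * (h \<bullet> grad v (x + t *\<^sub>R h))\<^sup>2) \<partial>lborel \<partial>lborel)"
    by (rule lborel_pair.Fubini') measurable
  also have "\<dots> \<le> (\<integral>\<^sup>+(t::real). indicator {0..1} t * (ennreal ((norm h)\<^sup>2) * L2sq (\<lambda>x. norm (grad v x))) \<partial>lborel)"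
  proof (rule nn_integral_mono)
    fix t :: real
    have "(\<integral>\<^sup>+x. ennreal (?I t * (h \<bullet> grad v (x + t *\<^sub>R h))\<^sup>2) \<partial>lborel)
      \<le> (\<integral>\<^sup>+x. indicator {0..1} t * ennreal ((norm h)\<^sup>2) * ennreal ((norm (grad v (x + t *\<^sub>R h)))\<^sup>2) \<partial>lborel)"
    proof (rule nn_integral_mono)
      fix x
      have "\<bar>h \<bullet> grad v (x + t *\<^sub>R h)\<bar>\<^sup>2 \<le> (norm h * norm (grad v (x + t *\<^sub>R h)))\<^sup>2"
        by (intro power_mono Cauchy_Schwarz_ineq2) auto
      then show "ennreal (?I t * (h \<bullet> grad v (x + t *\<^sub>R h))\<^sup>2) \<le>
        indicator {0..1} t * ennreal ((norm h)\<^sup>2) * ennreal ((norm (grad v (x + t *\<^sub>R h)))\<^sup>2)"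
        by (auto simp: indicator_def power_mult_distrib intro!: ennreal_leI simp flip: ennreal_mult)
    qed
    also have "\<dots> = indicator {0..1} t * ennreal ((norm h)\<^sup>2) * L2sq (\<lambda>x. norm (grad v (x + t *\<^sub>R h)))"
      unfolding L2sq_def by (rule nn_integral_cmult) measurable
    also have "L2sq (\<lambda>x. norm (grad v (x + t *\<^sub>R h))) = L2sq (\<lambda>x. norm (grad v x))"
      by (rule L2sq_translate[of "\<lambda>x. norm (grad v x)"]) measurable
    finally show "(\<integral>\<^sup>+x. ennreal (?I t * (h \<bullet> grad v (x + t *\<^sub>R h))\<^sup>2) \<partial>lborel) \<le>
      indicator {0..1} t * (ennreal ((norm h)\<^sup>2) * L2sq (\<lambda>x. norm (grad v x)))"
      by (simp add: mult.assoc)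
  qed
  also have "\<dots> = ennreal ((norm h)\<^sup>2) * L2sq (\<lambda>x. norm (grad v x))"
    by (subst nn_integral_multc) auto
  finally show ?thesis .
qed

text \<open>A dyadic decomposition: the balls of radius \<open>2 b\<^sup>j\<close> contribute a geometric series.\<close>

lemma nn_integral_norm_powr_finite:
  fixes S :: "'a::euclidean_space set"
  assumes b: "b > 0" "b powr (q + real DIM('a)) < 1"
    and S: "\<And>h. h \<in> S \<Longrightarrow> \<exists>j::nat. b ^ j / 2 \<le> norm h \<and> norm h \<le> 2 * b ^ j"
  shows "(\<integral>\<^sup>+h. indicator S h * ennreal (norm h powr q) \<partial>lborel) < \<infinity>"
proof -
  \<comment> \<open>On the j-th shell the ratio of |h| to b^j lies between 1/2 and 2; this M bounds
    its q-th power for either sign of q.\<close>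
  define M where "M = 2 powr \<bar>q\<bar>"
  define N where "N = DIM('a)"
  have M: "M > 0" by (simp add: M_def)
  have bound: "norm h powr q \<le> M * (b ^ j) powr q" if "b ^ j / 2 \<le> norm h" "norm h \<le> 2 * b ^ j" for h :: 'a and j
  proof -
    have bj: "b ^ j > 0" using b by simp
    define r where "r = norm h / b ^ j"
    have r: "1 / 2 \<le> r" "r \<le> 2" using that bj by (auto simp: r_def field_simps)
    have rq: "r powr q \<le> M"
    proof (cases "q \<ge> 0")
      case True
      then have "r powr q \<le> 2 powr q" using r by (intro powr_mono2) auto
      then show ?thesis using True by (simp add: M_def)
    next
      case False
      then have "r powr q \<le> (1/2) powr q" using r by (intro powr_mono2') auto
      then show ?thesis using False by (simp add: M_def powr_minus powr_divide inverse_eq_divide)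
    qed
    have "norm h powr q = (r * b ^ j) powr q" using b(1) by (simp add: r_def)
    also have "\<dots> = r powr q * (b ^ j) powr q" by (rule powr_mult)
    also have "\<dots> \<le> M * (b ^ j) powr q" using rq by (rule mult_right_mono) simp
    finally show ?thesis .
  qed
  define a where "a j = M * (b ^ j) powr q" for j :: nat
  have a: "a j \<ge> 0" for j using M by (simp add: a_def)
  have "(\<integral>\<^sup>+h. indicator S h * ennreal (norm h powr q) \<partial>lborel)
    \<le> (\<integral>\<^sup>+(h::'a). (\<Sum>j. ennreal (a j) * indicator (cball 0 (2 * b ^ j)) h) \<partial>lborel)"
  proof (rule nn_integral_mono)
    fix h :: 'a
    show "indicator S h * ennreal (norm h powr q) \<le> (\<Sum>j. ennreal (a j) * indicator (cball 0 (2 * b ^ j)) h)"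
    proof (cases "h \<in> S")
      case True
      obtain j where j: "b ^ j / 2 \<le> norm h" "norm h \<le> 2 * b ^ j" using S[OF True] by blast
      have "ennreal (norm h powr q) \<le> (\<Sum>i\<in>{j}. ennreal (a i) * indicator (cball 0 (2 * b ^ i)) h)"
        using bound[OF j] j by (simp add: a_def ennreal_leI)
      also have "\<dots> \<le> (\<Sum>j. ennreal (a j) * indicator (cball 0 (2 * b ^ j)) h)"
        by (rule sum_le_suminf) auto
      finally show ?thesis using True by simp
    qed simp
  qed
  also have "\<dots> = (\<Sum>j. ennreal (a j) * emeasure lborel (cball (0::'a) (2 * b ^ j)))"
    by (subst nn_integral_suminf)
       (intro borel_measurable_times_ennreal borel_measurable_const borel_measurable_indicator,
        simp, simp add: nn_integral_cmult_indicator)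
  also have "\<dots> = (\<Sum>j. ennreal (M * unit_ball_vol (real N) * 2 ^ N * (b powr (q + real N)) ^ j))"
  proof (intro arg_cong[where f=suminf] ext)
    fix j
    have 1: "(b powr (q + real N)) ^ j = (b ^ j) powr q * (b ^ j) ^ N"
      using b(1) by (simp add: powr_realpow[symmetric] powr_powr powr_add[symmetric] algebra_simps)
    have "emeasure lborel (cball (0::'a) (2 * b ^ j)) = ennreal (unit_ball_vol (real N) * (2 * b ^ j) ^ N)"
      using b by (simp add: emeasure_cball N_def)
    then show "ennreal (a j) * emeasure lborel (cball (0::'a) (2 * b ^ j)) =
      ennreal (M * unit_ball_vol (real N) * 2 ^ N * (b powr (q + real N)) ^ j)"
      using a[of j] b(1) unfolding 1 by (simp add: a_def power_mult_distrib mult_ac flip: ennreal_mult)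
  qed
  also have "\<dots> < \<infinity>"
  proof -
    have "summable (\<lambda>j. M * unit_ball_vol (real N) * 2 ^ N * (b powr (q + real N)) ^ j)"
      using b by (intro summable_mult summable_geometric) (auto simp: N_def)
    then show ?thesis
      using M by (subst suminf_ennreal2) auto
  qed
  finally show ?thesis .
qed

text \<open>Shells of radius 2^(-j) have ratio 2^(-(q + N)), with N the dimension, which is below 1
  exactly under the hypothesis. The shell of h is found from the least j with 2^(-j) < |h|.\<close>

lemma nn_integral_norm_powr_near:
  assumes "q + real DIM('a::euclidean_space) > 0"
  shows "(\<integral>\<^sup>+(h::'a). indicator {h. 0 < norm h \<and> norm h \<le> 1} h * ennreal (norm h powr q) \<partial>lborel) < \<infinity>"
proof (rule nn_integral_norm_powr_finite[where b="1/2"])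
  have "(1/2::real) powr (q + real DIM('a)) < (1/2) powr 0"
    using assms by (intro powr_less_mono') auto
  then show "(1/2::real) powr (q + real DIM('a)) < 1" by simp
  fix h :: 'a assume "h \<in> {h. 0 < norm h \<and> norm h \<le> 1}"
  then have h: "0 < norm h" "norm h \<le> 1" by auto
  have ex: "\<exists>n. (1/2) ^ n < norm h" using h by (intro real_arch_pow_inv) auto
  define j where "j = (LEAST n. (1/2) ^ n < norm h)"
  have j: "(1/2) ^ j < norm h" unfolding j_def by (rule LeastI_ex[OF ex])
  have "j \<noteq> 0" using j h by (cases j) auto
  then have "\<not> (1/2) ^ (j - 1) < norm h" unfolding j_def by (intro not_less_Least) auto
  moreover have "(1/2::real) ^ (j - 1) = 2 * (1/2) ^ j" using \<open>j \<noteq> 0\<close> by (cases j) auto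
  ultimately show "\<exists>j. (1/2) ^ j / 2 \<le> norm h \<and> norm h \<le> 2 * (1/2) ^ j"
    using j h by (intro exI[of _ j]) auto
qed simp

lemma nn_integral_norm_powr_far:
  assumes "q + real DIM('a::euclidean_space) < 0"
  shows "(\<integral>\<^sup>+(h::'a). indicator {h. 1 \<le> norm h} h * ennreal (norm h powr q) \<partial>lborel) < \<infinity>"
proof (rule nn_integral_norm_powr_finite[where b="2"])
  have "2 powr (q + real DIM('a)) < 2 powr 0" using assms by (intro powr_less_mono) auto
  then show "2 powr (q + real DIM('a)) < 1" by simp
  fix h :: 'a assume "h \<in> {h. 1 \<le> norm h}"
  then have h: "1 \<le> norm h" by auto
  have ex: "\<exists>n. norm h < 2 ^ n" by (intro real_arch_pow) auto
  define j where "j = (LEAST n. norm h < 2 ^ n)"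
  have j: "norm h < 2 ^ j" unfolding j_def by (rule LeastI_ex[OF ex])
  have "j \<noteq> 0" using j h by (cases j) auto
  then have "\<not> norm h < 2 ^ (j - 1)" unfolding j_def by (intro not_less_Least) auto
  moreover have "(2::real) ^ (j - 1) = 2 ^ j / 2" using \<open>j \<noteq> 0\<close> by (cases j) auto
  ultimately show "\<exists>j. 2 ^ j / 2 \<le> norm h \<and> norm h \<le> 2 * 2 ^ j"
    using j h by (intro exI[of _ j]) auto
qed simp

section \<open>The fractional kernel and its moments\<close>

definition kern :: "real \<Rightarrow> 'a::euclidean_space \<Rightarrow> real" where
  "kern s h = 1 / norm h powr (real DIM('a) + 2 * s)"

lemma kern_measurable [measurable]: "kern s \<in> borel_measurable borel"
  unfolding kern_def by measurable

lemma kern_nonneg: "kern s h \<ge> 0" by (simp add: kern_def)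

lemma kern_minus: "kern s (- h) = kern s h" by (simp add: kern_def)

lemma kern_powr: "kern s (h::'a::euclidean_space) = norm h powr (- (real DIM('a) + 2 * s))"
  by (simp only: kern_def powr_minus inverse_eq_divide)

lemma powr_mult_kern:
  "norm h powr a * kern s (h::'a::euclidean_space) = norm h powr (a - (real DIM('a) + 2 * s))"
  unfolding kern_powr by (simp only: powr_add[symmetric] diff_conv_add_uminus)

text \<open>Near 0 the factor |h|^2 leaves the power 2 - 2s - N, with N the dimension, integrable
  because s < 1; far away the power -N - 2s is integrable because s > 0.\<close>

lemma kern_finite:
  assumes "0 < s" "s < 1"
  shows "(\<integral>\<^sup>+(h::'a::euclidean_space). ennreal (min 1 ((norm h)\<^sup>2) * kern s h) \<partial>lborel) < \<infinity>"
proof -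
  let ?q = "2 - (real DIM('a) + 2 * s)" and ?r = "- (real DIM('a) + 2 * s)"
  let ?A = "{h::'a. 0 < norm h \<and> norm h \<le> 1}" and ?B = "{h::'a. 1 \<le> norm h}"
  have [measurable]: "?A \<in> sets borel" "?B \<in> sets borel" by measurable
  have "(\<integral>\<^sup>+(h::'a). ennreal (min 1 ((norm h)\<^sup>2) * kern s h) \<partial>lborel)
    \<le> (\<integral>\<^sup>+h. indicator ?A h * ennreal (norm h powr ?q) + indicator ?B h * ennreal (norm h powr ?r) \<partial>lborel)"
  proof (rule nn_integral_mono)
    fix h :: 'a
    consider "h = 0" | "0 < norm h" "norm h \<le> 1" | "norm h > 1" by force
    then show "ennreal (min 1 ((norm h)\<^sup>2) * kern s h) \<le>
      indicator ?A h * ennreal (norm h powr ?q) + indicator ?B h * ennreal (norm h powr ?r)"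
    proof cases
      case 2
      have "min 1 ((norm h)\<^sup>2) * kern s h \<le> (norm h powr 2) * kern s h"
        using 2 by (intro mult_right_mono) (auto simp: kern_nonneg powr_numeral)
      then have "ennreal (min 1 ((norm h)\<^sup>2) * kern s h) \<le> ennreal (norm h powr ?q)"
        unfolding powr_mult_kern by (rule ennreal_leI)
      also have "\<dots> \<le> indicator ?A h * ennreal (norm h powr ?q) + indicator ?B h * ennreal (norm h powr ?r)"
        using 2 by simp
      finally show ?thesis .
    next
      case 3
      have "min 1 ((norm h)\<^sup>2) * kern s h \<le> 1 * kern s h"
        by (intro mult_right_mono) (auto simp: kern_nonneg)
      then have "ennreal (min 1 ((norm h)\<^sup>2) * kern s h) \<le> ennreal (norm h powr ?r)"
        by (intro ennreal_leI) (simp add: kern_powr)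
      also have "\<dots> \<le> indicator ?A h * ennreal (norm h powr ?q) + indicator ?B h * ennreal (norm h powr ?r)"
        using 3 by simp
      finally show ?thesis .
    qed simp
  qed
  also have "\<dots> = (\<integral>\<^sup>+h. indicator ?A h * ennreal (norm h powr ?q) \<partial>lborel)
      + (\<integral>\<^sup>+h. indicator ?B h * ennreal (norm h powr ?r) \<partial>lborel)"
    by (rule nn_integral_add) measurable
  also have "\<dots> < \<infinity>"
    using nn_integral_norm_powr_near[where q="?q" and 'a='a]
      nn_integral_norm_powr_far[where q="?r" and 'a='a] assms by simp
  finally show ?thesis .
qed

text \<open>The weight min(1, |h|) is the size of the defect caused by the kink of the barrier. As
  it is at most |h|^s, the integrand is dominated by |h|^(-N - s), N being the dimension, whose tail
  scales like t^(-s). The rate is not sharp, but it is the same formula for s below, at and above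
  1/2, and s < 1 leaves room for a stronger singularity of the local term.\<close>

lemma kern_tail:
  assumes s: "0 < s" "s < 1"
  shows "\<exists>C\<ge>0. \<forall>t>0. (\<integral>\<^sup>+(h::'a::euclidean_space).
      ennreal (indicator {h. t < norm h} h * min 1 (norm h) * kern s h) \<partial>lborel) \<le> ennreal (C * t powr (- s))"
proof -
  let ?q = "- (real DIM('a) + s)" and ?B = "{h::'a. 1 \<le> norm h}"
  define M where "M = (\<integral>\<^sup>+h. indicator ?B h * ennreal (norm h powr ?q) \<partial>lborel)"
  have M: "M < \<infinity>" unfolding M_def using s by (intro nn_integral_norm_powr_far) auto
  have [measurable]: "?B \<in> sets borel" by measurable
  have "(\<integral>\<^sup>+(h::'a). ennreal (indicator {h. t < norm h} h * min 1 (norm h) * kern s h) \<partial>lborel)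
      \<le> ennreal (enn2real M * t powr (- s))" if t: "t > 0" for t :: real
  proof -
    have "(\<integral>\<^sup>+(h::'a). ennreal (indicator {h. t < norm h} h * min 1 (norm h) * kern s h) \<partial>lborel)
      \<le> (\<integral>\<^sup>+h. indicator {h. t \<le> norm h} h * ennreal (norm (h::'a) powr ?q) \<partial>lborel)"
    proof (rule nn_integral_mono)
      fix h :: 'a
      show "ennreal (indicator {h. t < norm h} h * min 1 (norm h) * kern s h) \<le>
        indicator {h. t \<le> norm h} h * ennreal (norm h powr ?q)"
      proof (cases "t < norm h")
        case True
        have "min 1 (norm h) \<le> norm h powr s"
        proof (cases "norm h \<le> 1")
          case True
          have "norm h powr 1 \<le> norm h powr s" using True s by (intro powr_mono') auto
          then show ?thesis using True by simp
        next
          case False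
          then show ?thesis using s by (simp add: ge_one_powr_ge_zero)
        qed
        then have "min 1 (norm h) * kern s h \<le> norm h powr s * kern s h"
          by (intro mult_right_mono) (auto simp: kern_nonneg)
        also have "\<dots> = norm h powr ?q" unfolding powr_mult_kern by (rule arg_cong[where f="(powr) (norm h)"]) simp
        finally show ?thesis using True by (simp add: ennreal_leI)
      qed simp
    qed
    also have "\<dots> = ennreal (t ^ DIM('a)) *
      (\<integral>\<^sup>+h. indicator {h. t \<le> norm h} (t *\<^sub>R h + 0) * ennreal (norm (t *\<^sub>R h + 0 :: 'a) powr ?q) \<partial>lborel)"
      using t by (subst nn_integral_lborel_affine[where c=t and t=0]) auto
    also have "(\<integral>\<^sup>+h. indicator {h. t \<le> norm h} (t *\<^sub>R h + 0) * ennreal (norm (t *\<^sub>R h + 0 :: 'a) powr ?q) \<partial>lborel)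
      = (\<integral>\<^sup>+h. ennreal (t powr ?q) * (indicator ?B h * ennreal (norm h powr ?q)) \<partial>lborel)"
      using t by (intro nn_integral_cong) (auto simp: indicator_def powr_mult ennreal_mult)
    also have "\<dots> = ennreal (t powr ?q) * M"
      unfolding M_def by (rule nn_integral_cmult) measurable
    also have "ennreal (t ^ DIM('a)) * (ennreal (t powr ?q) * M) = ennreal (t ^ DIM('a) * t powr ?q) * M"
      using t by (simp add: ennreal_mult mult.assoc)
    also have "t ^ DIM('a) * t powr ?q = t powr (- s)"
      using t by (simp add: powr_realpow[symmetric] powr_add[symmetric])
    also have "ennreal (t powr (- s)) * M = ennreal (enn2real M * t powr (- s))"
      using M by (simp add: ennreal_mult mult.commute)
    finally show ?thesis .
  qed
  then show ?thesis by (intro exI[of _ "enn2real M"]) auto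
qed

section \<open>Gagliardo energy and the associated bilinear form\<close>

abbreviation lborel2 :: "('a::euclidean_space \<times> 'a) measure" where
  "lborel2 \<equiv> lborel \<Otimes>\<^sub>M lborel"

abbreviation gform_integrand ::
    "('a::euclidean_space \<Rightarrow> real) \<Rightarrow> ('a \<Rightarrow> real) \<Rightarrow> ('a \<Rightarrow> real) \<Rightarrow> 'a \<times> 'a \<Rightarrow> real" where
  "gform_integrand u \<phi> \<kappa> \<equiv> \<lambda>p. (u (fst p) - u (snd p)) * (\<phi> (fst p) - \<phi> (snd p)) * \<kappa> (fst p - snd p)"

definition energy :: "real \<Rightarrow> ('a::euclidean_space \<Rightarrow> real) \<Rightarrow> ennreal" where
  "energy s v = (\<integral>\<^sup>+p. ennreal ((v (fst p) - v (snd p))\<^sup>2 * kern s (fst p - snd p)) \<partial>lborel2)"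

text \<open>Substituting x = y + h writes the energy as a superposition of squared translation
  differences, which can be estimated one h at a time.\<close>

lemma energy_eq:
  fixes v :: "'a::euclidean_space \<Rightarrow> real"
  assumes [measurable]: "v \<in> borel_measurable borel"
  shows "energy s v = (\<integral>\<^sup>+h. ennreal (kern s h) * L2sq (\<lambda>x. v (x + h) - v x) \<partial>lborel)"
proof -
  have "energy s v = (\<integral>\<^sup>+y. \<integral>\<^sup>+x. ennreal ((v x - v y)\<^sup>2 * kern s (x - y)) \<partial>lborel \<partial>lborel)"
    unfolding energy_def by (subst lborel_pair.nn_integral_snd[symmetric]) auto
  also have "\<dots> = (\<integral>\<^sup>+y. \<integral>\<^sup>+h. ennreal ((v (y + h) - v y)\<^sup>2 * kern s h) \<partial>lborel \<partial>lborel)"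
  proof (rule nn_integral_cong)
    fix y :: 'a
    show "(\<integral>\<^sup>+x. ennreal ((v x - v y)\<^sup>2 * kern s (x - y)) \<partial>lborel) =
      (\<integral>\<^sup>+h. ennreal ((v (y + h) - v y)\<^sup>2 * kern s h) \<partial>lborel)"
      by (subst nn_integral_lborel_affine[where c=1 and t=y]) (auto simp: add.commute)
  qed
  also have "\<dots> = (\<integral>\<^sup>+h. \<integral>\<^sup>+y. ennreal ((v (y + h) - v y)\<^sup>2 * kern s h) \<partial>lborel \<partial>lborel)"
    by (rule lborel_pair.Fubini') measurable
  also have "\<dots> = (\<integral>\<^sup>+h. ennreal (kern s h) * L2sq (\<lambda>x. v (x + h) - v x) \<partial>lborel)"
    unfolding L2sq_def
    by (intro nn_integral_cong, subst nn_integral_cmult[symmetric])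
       (auto simp: ennreal_mult kern_nonneg mult.commute)
  finally show ?thesis .
qed

definition kern_mass :: "'a::euclidean_space itself \<Rightarrow> real \<Rightarrow> real" where
  "kern_mass _ s = enn2real (\<integral>\<^sup>+(h::'a). ennreal (min 1 ((norm h)\<^sup>2) * kern s h) \<partial>lborel)"

text \<open>The hypothesis is used for |h| at most 1 and the trivial bound by 4 times the squared
  norm beyond. The constant G is left abstract because the lemma also serves u - v, which has only a
  weak gradient.\<close>

lemma energy_le:
  fixes v :: "'a::euclidean_space \<Rightarrow> real"
  assumes s: "0 < s" "s < 1" and [measurable]: "v \<in> borel_measurable borel"
    and G: "\<And>h. L2sq (\<lambda>x. v (x + h) - v x) \<le> ennreal ((norm h)\<^sup>2) * G"
  shows "energy s v \<le> (G + 4 * L2sq v) * ennreal (kern_mass TYPE('a) s)"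
proof -
  have "energy s v \<le> (\<integral>\<^sup>+(h::'a). (G + 4 * L2sq v) * ennreal (min 1 ((norm h)\<^sup>2) * kern s h) \<partial>lborel)"
    unfolding energy_eq[OF assms(3)]
  proof (rule nn_integral_mono)
    fix h :: 'a
    have "L2sq (\<lambda>x. v (x + h) - v x) \<le> ennreal (min 1 ((norm h)\<^sup>2)) * (G + 4 * L2sq v)"
    proof (cases "(norm h)\<^sup>2 \<le> 1")
      case True
      have "ennreal ((norm h)\<^sup>2) * G \<le> ennreal ((norm h)\<^sup>2) * (G + 4 * L2sq v)"
        by (intro mult_left_mono) auto
      with G[of h] True show ?thesis by (simp add: min_def)
    next
      case False
      have "L2sq (\<lambda>x. v (x + h) - v x) \<le> 2 * L2sq (\<lambda>x. v (x + h)) + 2 * L2sq v"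
        by (rule L2sq_diff) measurable
      also have "\<dots> = 4 * L2sq v"
        by (subst L2sq_translate) (auto simp: distrib_right[symmetric])
      also have "\<dots> \<le> G + 4 * L2sq v" by simp
      finally show ?thesis using False by (simp add: min_def)
    qed
    then have "ennreal (kern s h) * L2sq (\<lambda>x. v (x + h) - v x) \<le>
      ennreal (kern s h) * (ennreal (min 1 ((norm h)\<^sup>2)) * (G + 4 * L2sq v))"
      by (rule mult_left_mono) simp
    also have "\<dots> = (G + 4 * L2sq v) * ennreal (min 1 ((norm h)\<^sup>2) * kern s h)"
      by (simp add: ennreal_mult kern_nonneg mult_ac)
    finally show "ennreal (kern s h) * L2sq (\<lambda>x. v (x + h) - v x) \<le>
      (G + 4 * L2sq v) * ennreal (min 1 ((norm h)\<^sup>2) * kern s h)" .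
  qed
  also have "\<dots> = (G + 4 * L2sq v) * (\<integral>\<^sup>+(h::'a). ennreal (min 1 ((norm h)\<^sup>2) * kern s h) \<partial>lborel)"
    by (rule nn_integral_cmult) measurable
  finally show ?thesis
    using kern_finite[OF s, where 'a='a] by (simp add: kern_mass_def)
qed

lemma energy_test_function_le:
  fixes v :: "'a::euclidean_space \<Rightarrow> real"
  assumes s: "0 < s" "s < 1" and v: "v \<in> test_functions \<Omega>"
  shows "energy s v \<le> (L2sq (\<lambda>x. norm (grad v x)) + 4 * L2sq v) * ennreal (kern_mass TYPE('a) s)"
  by (intro energy_le s translation_estimate[OF v] test_functions_measurable[OF v])

text \<open>Young's inequality with weight e. Later the first factor has squared norm of order e^2
  and the second stays bounded, so that both terms are of order e.\<close>

lemma integral_mult_le: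
  fixes f g :: "'b \<Rightarrow> real"
  assumes "f \<in> borel_measurable M" "g \<in> borel_measurable M"
    and f: "integrable M (\<lambda>x. (f x)\<^sup>2)" and g: "integrable M (\<lambda>x. (g x)\<^sup>2)" and e: "e > 0"
  shows "\<bar>\<integral>x. f x * g x \<partial>M\<bar> \<le> (\<integral>x. (f x)\<^sup>2 \<partial>M) / e + e * (\<integral>x. (g x)\<^sup>2 \<partial>M)"
proof -
  have "\<bar>\<integral>x. f x * g x \<partial>M\<bar> \<le> (\<integral>x. (f x)\<^sup>2 / e + e * (g x)\<^sup>2 \<partial>M)"
  proof (rule order_trans[OF integral_abs_bound integral_mono])
    show "integrable M (\<lambda>x. \<bar>f x * g x\<bar>)"
      by (intro integrable_abs integrable_mult_L2) fact+
    show "\<bar>f x * g x\<bar> \<le> (f x)\<^sup>2 / e + e * (g x)\<^sup>2" for x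
    proof -
      have "2 * \<bar>f x / sqrt e\<bar> * \<bar>sqrt e * g x\<bar> \<le> \<bar>f x / sqrt e\<bar>\<^sup>2 + \<bar>sqrt e * g x\<bar>\<^sup>2"
        by (rule sum_squares_bound)
      moreover have "\<bar>f x / sqrt e\<bar> * \<bar>sqrt e * g x\<bar> = \<bar>f x * g x\<bar>"
        using e by (simp add: abs_mult)
      moreover have "\<bar>f x / sqrt e\<bar>\<^sup>2 + \<bar>sqrt e * g x\<bar>\<^sup>2 = (f x)\<^sup>2 / e + e * (g x)\<^sup>2"
        using e by (simp add: power_divide power_mult_distrib)
      ultimately show ?thesis using abs_ge_zero[of "f x * g x"] by linarith
    qed
  qed (use f g in auto)
  then show ?thesis using f g by simp
qed

definition gform :: "real \<Rightarrow> ('a::euclidean_space \<Rightarrow> real) \<Rightarrow> ('a \<Rightarrow> real) \<Rightarrow> real" where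
  "gform s u \<phi> = (\<integral>p. (u (fst p) - u (snd p)) * (\<phi> (fst p) - \<phi> (snd p)) * kern s (fst p - snd p)
     \<partial>lborel2)"

lemma gform_bound:
  fixes u \<phi> :: "'a::euclidean_space \<Rightarrow> real"
  assumes [measurable]: "u \<in> borel_measurable borel" "\<phi> \<in> borel_measurable borel"
    and u: "energy s u \<le> ennreal U" and \<phi>: "energy s \<phi> \<le> ennreal P" and nn: "U \<ge> 0" "P \<ge> 0"
  shows "integrable lborel2 (gform_integrand u \<phi> (kern s))"
    and "e > 0 \<Longrightarrow> \<bar>gform s u \<phi>\<bar> \<le> U / e + e * P"
proof -
  \<comment> \<open>Giving each difference the square root of the kernel turns the form into an L^2
    product on pairs and the energies into squared norms.\<close>
  let ?f = "\<lambda>v p. (v (fst p) - v (snd p)) * sqrt (kern s (fst p - snd p :: 'a))"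
  have sq: "(?f v p)\<^sup>2 = (v (fst p) - v (snd p))\<^sup>2 * kern s (fst p - snd p)" for v p
    by (simp add: power_mult_distrib kern_nonneg)
  have L2: "integrable lborel2 (\<lambda>p. (?f v p)\<^sup>2) \<and> (\<integral>p. (?f v p)\<^sup>2 \<partial>lborel2) \<le> V"
    if [measurable]: "v \<in> borel_measurable borel" and v: "energy s v \<le> ennreal V" "V \<ge> 0" for v V
  proof -
    have fin: "energy s v < \<infinity>" using v by (simp add: le_less_trans)
    have i: "integrable lborel2 (\<lambda>p. (?f v p)\<^sup>2)"
      unfolding sq using fin by (auto simp: energy_def integrable_iff_bounded kern_nonneg)
    have "ennreal (\<integral>p. (?f v p)\<^sup>2 \<partial>lborel2) = energy s v"
      by (subst nn_integral_eq_integral[OF i, symmetric]) (simp_all only: sq energy_def, simp add: kern_nonneg)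
    then have "ennreal (\<integral>p. (?f v p)\<^sup>2 \<partial>lborel2) \<le> ennreal V" using v(1) by (simp only:)
    then show ?thesis using i ennreal_le_iff[OF v(2)] by blast
  qed
  have prod: "?f u p * ?f \<phi> p = (u (fst p) - u (snd p)) * (\<phi> (fst p) - \<phi> (snd p)) * kern s (fst p - snd p)" for p
  proof -
    have "?f u p * ?f \<phi> p = (u (fst p) - u (snd p)) * (\<phi> (fst p) - \<phi> (snd p)) *
      (sqrt (kern s (fst p - snd p)) * sqrt (kern s (fst p - snd p)))" by (simp only: mult_ac)
    then show ?thesis by (simp add: kern_nonneg)
  qed
  have m: "?f u \<in> borel_measurable lborel2" "?f \<phi> \<in> borel_measurable lborel2" by measurable
  show "integrable lborel2 (gform_integrand u \<phi> (kern s))"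
    using integrable_mult_L2[OF m] L2[OF _ u nn(1)] L2[OF _ \<phi> nn(2)] assms(1,2) unfolding prod by blast
  show "\<bar>gform s u \<phi>\<bar> \<le> U / e + e * P" if e: "e > 0"
  proof -
    have "\<bar>gform s u \<phi>\<bar> \<le> (\<integral>p. (?f u p)\<^sup>2 \<partial>lborel2) / e + e * (\<integral>p. (?f \<phi> p)\<^sup>2 \<partial>lborel2)"
      using integral_mult_le[OF m _ _ e] L2[OF _ u nn(1)] L2[OF _ \<phi> nn(2)] assms(1,2)
      unfolding prod gform_def by blast
    also have "\<dots> \<le> U / e + e * P"
      using L2[OF assms(1) u nn(1)] L2[OF assms(2) \<phi> nn(2)] e
      by (intro add_mono divide_right_mono mult_left_mono) auto
    finally show ?thesis .
  qed
qed

subsection \<open>Approximation by test functions\<close>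

lemma test_functions_diff:
  fixes f g :: "'a::euclidean_space \<Rightarrow> real"
  assumes "f \<in> test_functions \<Omega>" "g \<in> test_functions \<Omega>"
  shows "(\<lambda>x. f x - g x) \<in> test_functions \<Omega>"
    and "grad (\<lambda>x. f x - g x) x = grad f x - grad g x"
proof -
  define F where "F = {\<lambda>x. f x - g x | f g :: 'a \<Rightarrow> real. f \<in> test_functions \<Omega> \<and> g \<in> test_functions \<Omega>}"
  have der: "((\<lambda>x. f x - g x) has_derivative (\<lambda>h. h \<bullet> (grad f x - grad g x))) (at x)"
    if "f \<in> test_functions \<Omega>" "g \<in> test_functions \<Omega>" for f g x
    using has_derivative_diff[OF that[THEN test_functions_has_derivative]]
    by (simp add: inner_diff_right)
  note gr = grad_eqI[OF der]
  have "C_k k h" if "h \<in> F" for h k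
  proof (rule C_k_family[OF _ _ that])
    show "h differentiable at x" if "h \<in> F" for h x
      using that der unfolding F_def by (auto simp: differentiable_def)
    show "(\<lambda>x. grad h x \<bullet> b) \<in> F" if h: "h \<in> F" and b: "b \<in> Basis" for h b
    proof -
      obtain f g where h: "h = (\<lambda>x. f x - g x)" and fg: "f \<in> test_functions \<Omega>" "g \<in> test_functions \<Omega>"
        using h by (auto simp: F_def)
      have "(\<lambda>x. grad h x \<bullet> b) = (\<lambda>x. grad f x \<bullet> b - grad g x \<bullet> b)"
        unfolding h gr[OF fg] by (simp add: inner_diff_left)
      then show ?thesis unfolding F_def using fg[THEN test_functions_grad[OF _ b]]
        by (intro CollectI exI[of _ "\<lambda>x. grad f x \<bullet> b"] exI[of _ "\<lambda>x. grad g x \<bullet> b"]) simp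
    qed
  qed
  moreover have "(\<lambda>x. f x - g x) \<in> F" unfolding F_def using assms by blast
  moreover have "closure {x. f x - g x \<noteq> 0} \<subseteq> closure {x. f x \<noteq> 0} \<union> closure {x. g x \<noteq> 0}"
    unfolding closure_Un[symmetric] by (rule closure_mono) auto
  moreover have "compact (closure {x. f x - g x \<noteq> 0})"
  proof -
    have "bounded {x. f x - g x \<noteq> 0}"
      by (rule bounded_subset[of "{x. f x \<noteq> 0} \<union> {x. g x \<noteq> 0}"])
         (use assms[THEN test_functions_bounded_support] in auto)
    then show ?thesis by simp
  qed
  ultimately show "(\<lambda>x. f x - g x) \<in> test_functions \<Omega>"
    using assms unfolding test_functions_def by blast
  show "grad (\<lambda>x. f x - g x) x = grad f x - grad g x" by (rule gr[OF assms])
qed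

lemma grad_zero: "grad (\<lambda>_::'a::euclidean_space. 0) x = 0"
  by (rule grad_eq_0) simp

lemma zero_test_function: "(\<lambda>_::'a::euclidean_space. 0) \<in> test_functions \<Omega>"
proof -
  have "C_k k (\<lambda>_::'a. 0)" for k
    by (rule C_k_family[where F="{\<lambda>_. 0}"]) (auto simp: grad_zero)
  then show ?thesis by (simp add: test_functions_def)
qed

text \<open>The bounds on u are required at every point, which a suitable Borel representative
  provides. The weak gradient refers to the whole space, so that u, extended by zero, may be dilated
  and mollified freely.\<close>

locale weak_gradient_zero_outside =
  fixes \<Omega> :: "'a::euclidean_space set" and u :: "'a \<Rightarrow> real" and g :: "'a \<Rightarrow> 'a" and K :: real
  assumes \<Omega>: "open \<Omega>" "bounded \<Omega>" "convex \<Omega>" "\<Omega> \<noteq> {}"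
    and u_measurable [measurable]: "u \<in> borel_measurable borel"
    and u_L2: "integrable lborel (\<lambda>x. (u x)\<^sup>2)"
    and u_le: "\<And>x. u x \<le> K" and u_outside: "\<And>x. x \<notin> \<Omega> \<Longrightarrow> u x = 0"
    and g_measurable [measurable]: "g \<in> borel_measurable borel"
    and g_L2: "integrable lborel (\<lambda>x. (norm (g x))\<^sup>2)"
    and weak: "\<And>\<phi> b. \<phi> \<in> test_functions UNIV \<Longrightarrow> b \<in> Basis \<Longrightarrow>
       (LBINT x. u x * (grad \<phi> x \<bullet> b)) = - (LBINT x. (g x \<bullet> b) * \<phi> x)"
begin

lemma \<Omega>_borel [measurable]: "\<Omega> \<in> sets borel"
  using \<Omega>(1) by simp

lemma integrable_indicator_\<Omega>: "integrable lborel (indicator \<Omega> :: 'a \<Rightarrow> real)"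
  using emeasure_bounded_finite[OF \<Omega>(2)] \<Omega>(1) by (intro integrable_real_indicator) auto

lemma u_integrable: "integrable lborel u"
proof -
  have "integrable lborel (\<lambda>x. u x * indicator \<Omega> x)"
  proof (rule integrable_mult_L2)
    have "(\<lambda>x. (indicator \<Omega> x)\<^sup>2) = (indicator \<Omega> :: 'a \<Rightarrow> real)" by (auto simp: indicator_def)
    then show "integrable lborel (\<lambda>x. (indicator \<Omega> x :: real)\<^sup>2)" using integrable_indicator_\<Omega> by simp
  qed (use u_L2 in auto)
  moreover have "(\<lambda>x. u x * indicator \<Omega> x) = u" using u_outside by (auto simp: indicator_def fun_eq_iff)
  ultimately show ?thesis by simp
qed

lemma g_component_L2: 
  assumes "b \<in> Basis"
  shows "integrable lborel (\<lambda>x. (g x \<bullet> b)\<^sup>2)"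
proof (rule Bochner_Integration.integrable_bound[OF g_L2])
  show "AE x in lborel. norm ((g x \<bullet> b)\<^sup>2) \<le> norm ((norm (g x))\<^sup>2)"
    using Basis_le_norm[OF assms] by (intro AE_I2) (simp, metis abs_ge_zero power2_abs power_mono)
qed measurable

text \<open>The reflection in \<eta>(x - y) reverses the sign of the gradient and thereby cancels
  the sign in the weak identity.\<close>

lemma mollify_grad:
  assumes \<eta>: "\<eta> \<in> test_functions UNIV" and b: "b \<in> Basis"
  shows "mollify (\<lambda>x. grad \<eta> x \<bullet> b) u x = mollify \<eta> (\<lambda>x. g x \<bullet> b) x"
proof -
  have "grad (\<lambda>y. 1 * \<eta> (- 1 *\<^sub>R y + x)) y = - grad \<eta> (x - y)" for y
    by (subst test_functions_affine(2)[OF \<eta>]) auto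
  moreover have "(\<lambda>y. 1 * \<eta> (- 1 *\<^sub>R y + x)) \<in> test_functions UNIV"
    by (rule test_functions_affine(1)[OF \<eta>]) simp
  ultimately show ?thesis
    using weak[of "\<lambda>y. 1 * \<eta> (- 1 *\<^sub>R y + x)" b] b by (simp add: mollify_def)
qed

text \<open>Dilating \<open>u\<close> about an interior point pushes its support into \<open>\<Omega>\<close>, which leaves room to
  mollify.\<close>

theorem approximation:
  assumes e: "e > 0"
  shows "\<exists>v\<in>test_functions \<Omega>. (\<forall>x. v x \<le> K) \<and> L2sq (\<lambda>x. u x - v x) \<le> ennreal e \<and>
    L2sq (\<lambda>x. norm (g x - grad v x)) \<le> ennreal e"
proof -
  obtain z where z: "z \<in> \<Omega>" using \<Omega>(4) by blast
  then obtain r where r: "r > 0" "ball z r \<subseteq> \<Omega>" using \<Omega>(1) openE by blast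
  define n where "n = real DIM('a)"
  have n: "n > 0" by (simp add: n_def)
  define B where "B = (LBINT x. (norm (g x))\<^sup>2)"
  have B: "B \<ge> 0" by (simp add: B_def)
  have gb: "L2sq (\<lambda>x. g x \<bullet> b) \<le> ennreal B" if "b \<in> Basis" for b
  proof -
    have "L2sq (\<lambda>x. g x \<bullet> b) \<le> L2sq (\<lambda>x. norm (g x))"
      unfolding L2sq_def using Basis_le_norm[OF that]
      by (intro nn_integral_mono ennreal_leI) (metis abs_ge_zero power2_abs power_mono)
    then show ?thesis using L2sq_eq_integral[OF g_L2] by (simp add: B_def)
  qed
  \<comment> \<open>The affine map is dilation by 1 + 2\<tau> about z, followed by a shift of length
    below r\<tau>. It tends to the identity as \<tau> tends to 0, uniformly in the shift.\<close>
  have ev: "\<forall>\<^sub>F \<tau> in at_right (0::real). \<forall>y. norm y < r * \<tau> \<longrightarrow>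
      L2sq (\<lambda>x. f ((1 + 2 * \<tau>) *\<^sub>R x + ((- 2 * \<tau>) *\<^sub>R z - y)) - f x) \<le> ennreal \<delta>"
    if f: "f \<in> borel_measurable borel" "integrable lborel (\<lambda>x. (f x)\<^sup>2)" and "\<delta> > 0" for f \<delta>
  proof -
    obtain d where d: "d > 0" "\<And>c v. \<bar>c - 1\<bar> < d \<Longrightarrow> norm v < d \<Longrightarrow>
       L2sq (\<lambda>x. f (c *\<^sub>R x + v) - f x) \<le> ennreal \<delta>"
      using L2_affine_continuousI[OF f] \<open>\<delta> > 0\<close> unfolding L2_affine_continuous_def by blast
    have "((\<lambda>\<tau>::real. 2 * \<tau>) \<longlongrightarrow> 2 * 0) (at_right 0)" by (intro tendsto_intros)
    then have ev1: "\<forall>\<^sub>F \<tau> in at_right (0::real). 2 * \<tau> < d" using d(1) by (intro order_tendstoD(2)) auto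
    have "((\<lambda>\<tau>::real. \<tau> * (2 * norm z + r)) \<longlongrightarrow> 0 * (2 * norm z + r)) (at_right 0)" by (intro tendsto_intros)
    then have ev2: "\<forall>\<^sub>F \<tau> in at_right (0::real). \<tau> * (2 * norm z + r) < d"
      using d(1) by (intro order_tendstoD(2)) auto
    have ev3: "\<forall>\<^sub>F \<tau> in at_right (0::real). \<tau> > 0" by (rule eventually_at_right_less)
    show ?thesis
      using ev1 ev2 ev3
    proof eventually_elim
      case (elim \<tau>)
      show ?case
      proof (intro allI impI d(2))
        show "\<bar>1 + 2 * \<tau> - 1\<bar> < d" using elim by simp
        fix y :: 'a assume y: "norm y < r * \<tau>"
        have "norm ((- 2 * \<tau>) *\<^sub>R z - y) \<le> 2 * \<tau> * norm z + norm y"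
          using norm_triangle_ineq4[of "(- 2 * \<tau>) *\<^sub>R z" y] elim by simp
        also have "\<dots> < d" using y elim by (simp add: algebra_simps)
        finally show "norm ((- 2 * \<tau>) *\<^sub>R z - y) < d" .
      qed
    qed
  qed
  have ev_u: "\<forall>\<^sub>F \<tau> in at_right (0::real). \<forall>y. norm y < r * \<tau> \<longrightarrow>
      L2sq (\<lambda>x. u ((1 + 2 * \<tau>) *\<^sub>R x + ((- 2 * \<tau>) *\<^sub>R z - y)) - u x) \<le> ennreal e"
    by (rule ev[OF u_measurable u_L2 e])
  have ev_g: "\<forall>\<^sub>F \<tau> in at_right (0::real). \<forall>b\<in>Basis. \<forall>y. norm y < r * \<tau> \<longrightarrow>
      L2sq (\<lambda>x. g ((1 + 2 * \<tau>) *\<^sub>R x + ((- 2 * \<tau>) *\<^sub>R z - y)) \<bullet> b - g x \<bullet> b) \<le> ennreal (e / (16 * n))"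
  proof (rule eventually_ball_finite[OF finite_Basis], rule ballI)
    fix b :: 'a assume b: "b \<in> Basis"
    show "\<forall>\<^sub>F \<tau> in at_right (0::real). \<forall>y. norm y < r * \<tau> \<longrightarrow>
      L2sq (\<lambda>x. g ((1 + 2 * \<tau>) *\<^sub>R x + ((- 2 * \<tau>) *\<^sub>R z - y)) \<bullet> b - g x \<bullet> b) \<le> ennreal (e / (16 * n))"
      using e n by (intro ev[where f="\<lambda>x. g x \<bullet> b"] g_component_L2 b) auto
  qed
  have "((\<lambda>\<tau>::real. 8 * \<tau>\<^sup>2 * B) \<longlongrightarrow> 8 * 0\<^sup>2 * B) (at_right 0)" by (intro tendsto_intros)
  \<comment> \<open>The dilation multiplies the gradient by c = 1 + 2\<tau>. The excess contributes
    2 (c - 1)^2 B, which is the left-hand side.\<close>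
  then have ev_B: "\<forall>\<^sub>F \<tau> in at_right (0::real). 8 * \<tau>\<^sup>2 * B < e / (2 * n)"
    using e n by (intro order_tendstoD(2)) auto
  have ev_half: "\<forall>\<^sub>F \<tau> in at_right (0::real). \<tau> < 1/2"
    by (rule order_tendstoD(2)[OF tendsto_ident_at]) simp
  have "\<forall>\<^sub>F \<tau> in at_right (0::real). \<tau> > 0" by (rule eventually_at_right_less)
  then have "\<forall>\<^sub>F \<tau> in at_right (0::real). \<tau> > 0 \<and> \<tau> < 1/2 \<and> 8 * \<tau>\<^sup>2 * B < e / (2 * n) \<and>
     (\<forall>y. norm y < r * \<tau> \<longrightarrow>
      L2sq (\<lambda>x. u ((1 + 2 * \<tau>) *\<^sub>R x + ((- 2 * \<tau>) *\<^sub>R z - y)) - u x) \<le> ennreal e) \<and>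
     (\<forall>b\<in>Basis. \<forall>y. norm y < r * \<tau> \<longrightarrow>
      L2sq (\<lambda>x. g ((1 + 2 * \<tau>) *\<^sub>R x + ((- 2 * \<tau>) *\<^sub>R z - y)) \<bullet> b - g x \<bullet> b) \<le> ennreal (e / (16 * n)))"
    using ev_u ev_g ev_B ev_half by eventually_elim blast
  then obtain \<tau> where \<tau>: "\<tau> > 0" "\<tau> < 1/2" "8 * \<tau>\<^sup>2 * B < e / (2 * n)"
    and \<tau>u: "\<And>y. norm y < r * \<tau> \<Longrightarrow>
      L2sq (\<lambda>x. u ((1 + 2 * \<tau>) *\<^sub>R x + ((- 2 * \<tau>) *\<^sub>R z - y)) - u x) \<le> ennreal e"
    and \<tau>g: "\<And>b y. b \<in> Basis \<Longrightarrow> norm y < r * \<tau> \<Longrightarrow>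
      L2sq (\<lambda>x. g ((1 + 2 * \<tau>) *\<^sub>R x + ((- 2 * \<tau>) *\<^sub>R z - y)) \<bullet> b - g x \<bullet> b) \<le> ennreal (e / (16 * n))"
    using eventually_happens'[OF trivial_limit_at_right_real] by blast
  \<comment> \<open>With these values c x + w = z + c (x - z).\<close>
  define c where "c = 1 + 2 * \<tau>"
  define w where "w = (- 2 * \<tau>) *\<^sub>R z"
  have c: "c > 1" "c \<le> 2" using \<tau> by (auto simp: c_def)
  obtain \<eta> :: "'a \<Rightarrow> real" where \<eta>: "\<eta> \<in> test_functions UNIV" "\<And>x. \<eta> x \<ge> 0"
    "\<And>x. \<eta> x \<noteq> 0 \<Longrightarrow> norm x < r * \<tau>" "integrable lborel \<eta>" "integral\<^sup>L lborel \<eta> = 1"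
    using exists_mollifier[of "r * \<tau>"] r \<tau> by auto
  note [measurable] = test_functions_measurable[OF \<eta>(1)]
  define v where "v x = mollify \<eta> u (c *\<^sub>R x + w)" for x
  have v_eq: "v = (\<lambda>x. mollify \<eta> u (c *\<^sub>R x + w))" by (auto simp: v_def)
  \<comment> \<open>At such an x, the point c x + w is y + q with y in \<Omega> and |q| < r\<tau>.
    Half of the dilation absorbs q: averaging y with the point z + q/\<tau> of the ball gives a in
    \<Omega>. The other half remains as a strict contraction of a towards z.\<close>
  have supp: "{x. v x \<noteq> 0} \<subseteq> (\<lambda>a. a - (\<tau> / (1 + 2 * \<tau>)) *\<^sub>R (a - z)) ` \<Omega>"
  proof
    fix x assume "x \<in> {x. v x \<noteq> 0}"
    then have "(LBINT y. u y * \<eta> (c *\<^sub>R x + w - y)) \<noteq> 0" by (simp add: v_def mollify_def)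
    then obtain y where y: "u y * \<eta> (c *\<^sub>R x + w - y) \<noteq> 0"
      by (metis (mono_tags, lifting) Bochner_Integration.integral_cong integral_zero)
    define q where "q = c *\<^sub>R x + w - y"
    have y\<Omega>: "y \<in> \<Omega>" using y u_outside by force
    have q: "norm q < r * \<tau>" using y \<eta>(3)[of q] by (auto simp: q_def)
    define a where "a = (1 / (1 + \<tau>)) *\<^sub>R y + (\<tau> / (1 + \<tau>)) *\<^sub>R (z + (1 / \<tau>) *\<^sub>R q)"
    have "norm ((1 / \<tau>) *\<^sub>R q) < r" using q \<tau> by (simp add: field_simps)
    then have "z + (1 / \<tau>) *\<^sub>R q \<in> \<Omega>" using r(2) by (auto simp: dist_norm subset_iff)
    moreover have "1 / (1 + \<tau>) + \<tau> / (1 + \<tau>) = 1" using \<tau> by (simp add: field_simps)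
    ultimately have a: "a \<in> \<Omega>" unfolding a_def using \<tau> y\<Omega>
      by (intro convexD[OF \<Omega>(3)]) auto
    have "(1 + \<tau>) *\<^sub>R a = y + \<tau> *\<^sub>R z + q"
    proof -
      have "(1 + \<tau>) *\<^sub>R a = ((1 + \<tau>) * (1 / (1 + \<tau>))) *\<^sub>R y + ((1 + \<tau>) * (\<tau> / (1 + \<tau>))) *\<^sub>R (z + (1 / \<tau>) *\<^sub>R q)"
        unfolding a_def by (simp add: scaleR_right_distrib del: mult_eq_0_iff)
      also have "\<dots> = y + \<tau> *\<^sub>R (z + (1 / \<tau>) *\<^sub>R q)" using \<tau> by simp
      also have "\<dots> = y + \<tau> *\<^sub>R z + q" using \<tau> by (simp add: scaleR_right_distrib)
      finally show ?thesis .
    qed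
    also have "y + q = c *\<^sub>R x + w" by (simp add: q_def)
    then have "y + \<tau> *\<^sub>R z + q = c *\<^sub>R x + w + \<tau> *\<^sub>R z" by (metis add.assoc add.commute)
    finally have "c *\<^sub>R x = (1 + \<tau>) *\<^sub>R a - w - \<tau> *\<^sub>R z" by simp
    also have "\<dots> = c *\<^sub>R a - \<tau> *\<^sub>R (a - z)"
    proof -
      have "(2 * \<tau>) *\<^sub>R x = \<tau> *\<^sub>R x + \<tau> *\<^sub>R x" for x :: 'a by (simp flip: scaleR_add_left)
      then show ?thesis by (simp add: w_def c_def scaleR_add_left scaleR_diff_right)
    qed
    finally have "(1 / c) *\<^sub>R (c *\<^sub>R x) = (1 / c) *\<^sub>R (c *\<^sub>R a - \<tau> *\<^sub>R (a - z))" by simp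
    then have "x = a - (\<tau> / c) *\<^sub>R (a - z)" using c by (simp add: scaleR_diff_right)
    then show "x \<in> (\<lambda>a. a - (\<tau> / (1 + 2 * \<tau>)) *\<^sub>R (a - z)) ` \<Omega>"
      using a by (auto simp: c_def)
  qed
  have v_test: "v \<in> test_functions \<Omega>"
  proof -
    \<comment> \<open>Contracting the closure of a convex open set towards an interior point lands
      in the open set, so the compact set ?S separates the support of v from the boundary.\<close>
    let ?S = "(\<lambda>a. a - (\<tau> / (1 + 2 * \<tau>)) *\<^sub>R (a - z)) ` closure \<Omega>"
    have "compact ?S"
      using \<Omega>(2) by (intro compact_continuous_image continuous_intros) simp
    moreover have "{x. v x \<noteq> 0} \<subseteq> ?S" using supp image_mono[OF closure_subset] by (rule order_trans)
    ultimately have cl: "closure {x. v x \<noteq> 0} \<subseteq> ?S"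
      by (intro closure_minimal compact_imp_closed) auto
    have "?S \<subseteq> \<Omega>"
    proof
      fix x assume "x \<in> ?S"
      then obtain a where a: "a \<in> closure \<Omega>" "x = a - (\<tau> / (1 + 2 * \<tau>)) *\<^sub>R (a - z)" by auto
      have "x \<in> interior \<Omega>" unfolding a(2)
        using \<tau> z \<Omega> a(1) by (intro mem_interior_closure_convex_shrink) (auto simp: interior_open field_simps)
      then show "x \<in> \<Omega>" using interior_subset by blast
    qed
    moreover have "compact (closure {x. v x \<noteq> 0})"
      using compact_Int_closed[OF \<open>compact ?S\<close> closed_closure, of "{x. v x \<noteq> 0}"] cl
      by (simp add: Int_absorb1)
    ultimately show ?thesis
      using cl mollify_affine_smooth(1)[OF u_integrable \<eta>(1), of c _ w] c
      by (auto simp: test_functions_def v_eq)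
  qed
  have v_le: "v x \<le> K" for x
  proof -
    let ?X = "c *\<^sub>R x + w"
    have i: "integrable lborel (\<lambda>y. \<eta> (?X - y))" "(LBINT y. \<eta> (?X - y)) = 1"
      using lborel_integral_reflect[of \<eta> ?X] \<eta> by simp_all
    have "v x \<le> (LBINT y. K * \<eta> (?X - y))"
      unfolding v_def mollify_def
    proof (rule integral_mono[OF mollify_integrable[OF u_integrable \<eta>(1)]])
      show "integrable lborel (\<lambda>y. K * \<eta> (?X - y))" using i by simp
    qed (use \<eta>(2) u_le in \<open>auto intro: mult_right_mono\<close>)
    then show ?thesis using i by simp
  qed
  note [measurable] = test_functions_measurable[OF v_test] grad_measurable[OF v_test]
  have "L2sq (\<lambda>x. v x - u x) \<le> ennreal e"
    unfolding v_def
  proof (rule mollify_error[OF u_measurable u_L2 \<eta>(1,2,5)])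
    show "L2sq (\<lambda>x. u (c *\<^sub>R x + (w - y)) - u x) \<le> ennreal e" if "\<eta> y \<noteq> 0" for y
      using \<tau>u[OF \<eta>(3)[OF that]] by (simp add: c_def w_def)
  qed
  then have "L2sq (\<lambda>x. u x - v x) \<le> ennreal e"
    by (simp add: L2sq_def power2_commute)
  moreover have "L2sq (\<lambda>x. norm (g x - grad v x)) \<le> ennreal e"
  proof -
    have comp: "L2sq (\<lambda>x. (g x - grad v x) \<bullet> b) \<le> ennreal (e / n)" if b: "b \<in> Basis" for b
    proof -
      let ?m = "\<lambda>x. mollify \<eta> (\<lambda>x. g x \<bullet> b) (c *\<^sub>R x + w)"
      have gv: "grad v x \<bullet> b = c * ?m x" for x
        unfolding v_eq using c by (subst mollify_affine_smooth(2)[OF u_integrable \<eta>(1) _ b]) (auto simp: mollify_grad[OF \<eta>(1) b])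
      have m_eq: "?m = (\<lambda>x. (grad v x \<bullet> b) / c)" using c by (simp add: gv)
      have [measurable]: "?m \<in> borel_measurable borel" unfolding m_eq by measurable
      have err: "L2sq (\<lambda>x. ?m x - g x \<bullet> b) \<le> ennreal (e / (16 * n))"
      proof (rule mollify_error[OF _ g_component_L2[OF b] \<eta>(1,2,5)])
        show "L2sq (\<lambda>x. g (c *\<^sub>R x + (w - y)) \<bullet> b - g x \<bullet> b) \<le> ennreal (e / (16 * n))" if "\<eta> y \<noteq> 0" for y
          using \<tau>g[OF b \<eta>(3)[OF that]] by (simp add: c_def w_def)
      qed measurable
      \<comment> \<open>The two summands separate the mollification error from the factor c of the
        dilation; each receives half of the budget e/n of a coordinate.\<close>
      have "(\<lambda>x. (g x - grad v x) \<bullet> b) = (\<lambda>x. (- c) * (?m x - g x \<bullet> b) + (1 - c) * (g x \<bullet> b))"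
        by (simp add: inner_diff_left gv algebra_simps)
      then have "L2sq (\<lambda>x. (g x - grad v x) \<bullet> b) \<le>
        2 * L2sq (\<lambda>x. (- c) * (?m x - g x \<bullet> b)) + 2 * L2sq (\<lambda>x. (1 - c) * (g x \<bullet> b))"
        by (simp only:) (rule L2sq_add; measurable)
      also have "\<dots> = 2 * (ennreal (c\<^sup>2) * L2sq (\<lambda>x. ?m x - g x \<bullet> b)) +
          2 * (ennreal ((1 - c)\<^sup>2) * L2sq (\<lambda>x. g x \<bullet> b))"
        by (subst (1 2) L2sq_cmult) (auto simp: power2_minus)
      also have "\<dots> \<le> 2 * (ennreal 4 * ennreal (e / (16 * n))) + 2 * (ennreal ((1 - c)\<^sup>2) * ennreal B)"
      proof (intro add_mono mult_left_mono mult_mono err gb[OF b] ennreal_leI)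
        have "c\<^sup>2 \<le> 2\<^sup>2" using c by (intro power_mono) auto
        then show "c\<^sup>2 \<le> 4" by simp
      qed auto
      also have "\<dots> = ennreal (2 * (4 * (e / (16 * n))) + 2 * ((1 - c)\<^sup>2 * B))"
        using e n B by (simp add: numeral_mult_ennreal flip: ennreal_mult ennreal_plus)
      also have "\<dots> \<le> ennreal (e / n)"
      proof (rule ennreal_leI)
        have "2 * ((1 - c)\<^sup>2 * B) = 8 * \<tau>\<^sup>2 * B" by (simp add: c_def power2_eq_square)
        moreover have "2 * (4 * (e / (16 * n))) + e / (2 * n) = e / n" using n by (simp add: field_simps)
        ultimately show "2 * (4 * (e / (16 * n))) + 2 * ((1 - c)\<^sup>2 * B) \<le> e / n" using \<tau>(3) by linarith
      qed
      finally show ?thesis .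
    qed
    have "L2sq (\<lambda>x. norm (g x - grad v x)) = (\<Sum>b\<in>Basis. L2sq (\<lambda>x. (g x - grad v x) \<bullet> b))"
      unfolding L2sq_def
    proof (subst nn_integral_sum[symmetric])
      show "(\<integral>\<^sup>+x. ennreal ((norm (g x - grad v x))\<^sup>2) \<partial>lborel) =
        (\<integral>\<^sup>+x. (\<Sum>b\<in>Basis. ennreal (((g x - grad v x) \<bullet> b)\<^sup>2)) \<partial>lborel)"
      proof (intro nn_integral_cong)
        fix x
        have "(norm (g x - grad v x))\<^sup>2 = (\<Sum>b\<in>Basis. ((g x - grad v x) \<bullet> b)\<^sup>2)"
          unfolding power2_norm_eq_inner by (subst euclidean_inner) (simp only: power2_eq_square)
        then show "ennreal ((norm (g x - grad v x))\<^sup>2) = (\<Sum>b\<in>Basis. ennreal (((g x - grad v x) \<bullet> b)\<^sup>2))"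
          by simp
      qed
    qed measurable
    also have "\<dots> \<le> (\<Sum>b\<in>(Basis::'a set). ennreal (e / n))" by (intro sum_mono comp)
    also have "\<dots> = ennreal e" using e n by (simp add: n_def ennreal_of_nat_eq_real_of_nat flip: ennreal_mult)
    finally show ?thesis .
  qed
  ultimately show ?thesis using v_test v_le by blast
qed

text \<open>The smooth estimate is applied to v' - v for a much better approximation v' of u, whose
  own error is then sent to 0. The factor 4 comes from two squared triangle inequalities.\<close>

lemma translation_estimate_diff:
  assumes v: "v \<in> test_functions \<Omega>"
  shows "L2sq (\<lambda>x. (u (x + h) - v (x + h)) - (u x - v x)) \<le>
    ennreal ((norm h)\<^sup>2) * (4 * L2sq (\<lambda>x. norm (g x - grad v x)))"
proof (rule ennreal_le_epsilon)
  fix \<delta> :: real assume \<delta>: "\<delta> > 0"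
  define A where "A = L2sq (\<lambda>x. norm (g x - grad v x))"
  \<comment> \<open>The errors due to v' add up to (4 |h|^2 + 8) e.\<close>
  define e where "e = \<delta> / (4 * (norm h)\<^sup>2 + 8)"
  have pos: "4 * (norm h)\<^sup>2 + 8 > 0" by (simp add: add_nonneg_pos)
  have e: "e > 0" using \<delta> pos by (simp add: e_def)
  obtain v' where v': "v' \<in> test_functions \<Omega>"
    and err: "L2sq (\<lambda>x. u x - v' x) \<le> ennreal e" "L2sq (\<lambda>x. norm (g x - grad v' x)) \<le> ennreal e"
    using approximation[OF e] by blast
  note [measurable] = test_functions_measurable[OF v] test_functions_measurable[OF v']
    grad_measurable[OF v] grad_measurable[OF v']
  let ?d = "\<lambda>x. v' x - v x" and ?D = "\<lambda>x. u x - v' x"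
  have "L2sq (\<lambda>x. (u (x + h) - v (x + h)) - (u x - v x)) =
    L2sq (\<lambda>x. (?d (x + h) - ?d x) + (?D (x + h) - ?D x))" by (simp add: algebra_simps)
  also have "\<dots> \<le> 2 * L2sq (\<lambda>x. ?d (x + h) - ?d x) + 2 * L2sq (\<lambda>x. ?D (x + h) - ?D x)"
    by (rule L2sq_add) measurable
  also have "\<dots> \<le> 2 * (ennreal ((norm h)\<^sup>2) * (2 * ennreal e + 2 * A)) + 2 * (2 * ennreal e + 2 * ennreal e)"
  proof (intro add_mono mult_left_mono)
    have "L2sq (\<lambda>x. ?D (x + h) - ?D x) \<le> 2 * L2sq (\<lambda>x. ?D (x + h)) + 2 * L2sq ?D"
      by (rule L2sq_diff) measurable
    also have "L2sq (\<lambda>x. ?D (x + h)) = L2sq ?D" by (rule L2sq_translate) measurable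
    also have "2 * L2sq ?D + 2 * L2sq ?D \<le> 2 * ennreal e + 2 * ennreal e"
      by (intro add_mono mult_left_mono err) auto
    finally show "L2sq (\<lambda>x. ?D (x + h) - ?D x) \<le> 2 * ennreal e + 2 * ennreal e" .
    have "L2sq (\<lambda>x. ?d (x + h) - ?d x) \<le> ennreal ((norm h)\<^sup>2) * L2sq (\<lambda>x. norm (grad ?d x))"
      by (rule translation_estimate[OF test_functions_diff(1)[OF v' v]])
    also have "L2sq (\<lambda>x. norm (grad ?d x)) \<le> L2sq (\<lambda>x. norm (g x - grad v' x) + norm (g x - grad v x))"
      unfolding L2sq_def test_functions_diff(2)[OF v' v]
    proof (intro nn_integral_mono ennreal_leI power_mono)
      show "norm (grad v' x - grad v x) \<le> norm (g x - grad v' x) + norm (g x - grad v x)" for x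
        using dist_triangle3[of "grad v' x" "grad v x" "g x"] by (simp add: dist_norm)
    qed auto
    also have "\<dots> \<le> 2 * L2sq (\<lambda>x. norm (g x - grad v' x)) + 2 * A"
      unfolding A_def by (rule L2sq_add) measurable
    also have "\<dots> \<le> 2 * ennreal e + 2 * A" by (intro add_mono mult_left_mono err) auto
    finally show "L2sq (\<lambda>x. ?d (x + h) - ?d x) \<le> ennreal ((norm h)\<^sup>2) * (2 * ennreal e + 2 * A)"
      by (simp add: mult_left_mono)
  qed auto
  also have "\<dots> = ennreal ((norm h)\<^sup>2) * (4 * A) + (4 * (ennreal ((norm h)\<^sup>2) * ennreal e) + (4 * ennreal e + 4 * ennreal e))"
    by (simp add: algebra_simps)
  also have "4 * (ennreal ((norm h)\<^sup>2) * ennreal e) + (4 * ennreal e + 4 * ennreal e) = ennreal ((4 * (norm h)\<^sup>2 + 8) * e)"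
    using e by (simp add: numeral_mult_ennreal distrib_right mult.assoc flip: ennreal_mult ennreal_plus)
  also have "(4 * (norm h)\<^sup>2 + 8) * e = \<delta>" using pos by (simp add: e_def)
  finally show "L2sq (\<lambda>x. (u (x + h) - v (x + h)) - (u x - v x)) \<le>
    ennreal ((norm h)\<^sup>2) * (4 * L2sq (\<lambda>x. norm (g x - grad v x))) + ennreal \<delta>"
    by (simp add: A_def)
qed

lemma energy_diff_le:
  assumes s: "0 < s" "s < 1" and v: "v \<in> test_functions \<Omega>"
  shows "energy s (\<lambda>x. u x - v x) \<le>
    (4 * L2sq (\<lambda>x. norm (g x - grad v x)) + 4 * L2sq (\<lambda>x. u x - v x)) * ennreal (kern_mass TYPE('a) s)"
  using test_functions_measurable[OF v]
  by (intro energy_le s translation_estimate_diff[OF v]) measurable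

lemma energy_finite:
  assumes s: "0 < s" "s < 1"
  shows "energy s u < \<infinity>"
proof -
  have "energy s u \<le> (4 * L2sq (\<lambda>x. norm (g x)) + 4 * L2sq u) * ennreal (kern_mass TYPE('a) s)"
    using energy_diff_le[OF s zero_test_function] by (simp add: grad_zero)
  also have "\<dots> < \<infinity>"
    using L2sq_eq_integral[OF g_L2] L2sq_eq_integral[OF u_L2]
    by (simp add: ennreal_mult_less_top)
  finally show ?thesis .
qed

end

subsection \<open>The barrier\<close>

lemma test_functions_support: "\<psi> \<in> test_functions \<Omega> \<Longrightarrow> closure {x. \<psi> x \<noteq> 0} \<subseteq> \<Omega>"
  by (simp add: test_functions_def)

text \<open>The second derivative is -(2 - \<sigma>)(1 - \<sigma>) r^(-\<sigma>), which is singular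
  at 0, while the slope on (0, 1] stays between 0 and 2. The coefficient 2 of the linear term is
  what keeps the profile increasing and between r and 2r there.\<close>

definition profile :: "real \<Rightarrow> real \<Rightarrow> real" where
  "profile \<sigma> r = 2 * r - r powr (2 - \<sigma>)"

lemma DERIV_profile:
  assumes "r > 0"
  shows "(profile \<sigma> has_real_derivative (2 - (2 - \<sigma>) * r powr (1 - \<sigma>))) (at r)"
  unfolding profile_def using assms by (auto intro!: derivative_eq_intros)

lemma profile_ge:
  assumes "0 < \<sigma>" "\<sigma> < 1" "0 \<le> r" "r \<le> 1"
  shows "r \<le> profile \<sigma> r"
proof (cases "r = 0")
  case False
  then have "r powr (2 - \<sigma>) \<le> r powr 1" using assms by (intro powr_mono') auto
  then show ?thesis using assms by (simp add: profile_def)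
qed (simp add: profile_def)

lemma profile_deriv_bounds:
  fixes \<sigma> r :: real
  assumes "0 < \<sigma>" "\<sigma> < 1" "0 < r" "r \<le> 1"
  shows "0 \<le> 2 - (2 - \<sigma>) * r powr (1 - \<sigma>)" "2 - (2 - \<sigma>) * r powr (1 - \<sigma>) \<le> 2"
proof -
  have "r powr (1 - \<sigma>) \<le> 1" using assms powr_mono2[of "1 - \<sigma>" r 1] by simp
  then have "(2 - \<sigma>) * r powr (1 - \<sigma>) \<le> 2 - \<sigma>" using assms by (intro mult_left_le) auto
  then show "0 \<le> 2 - (2 - \<sigma>) * r powr (1 - \<sigma>)" using assms by linarith
  show "2 - (2 - \<sigma>) * r powr (1 - \<sigma>) \<le> 2" using assms by simp
qed

lemma profile_mono:
  assumes \<sigma>: "0 < \<sigma>" "\<sigma> < 1" and r: "0 \<le> r" "r \<le> r'" "r' \<le> 1"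
  shows "profile \<sigma> r \<le> profile \<sigma> r'"
proof (cases "r = 0")
  case True
  then show ?thesis using profile_ge[of \<sigma> r'] assms by (simp add: profile_def)
next
  case False
  show ?thesis
  proof (rule DERIV_nonneg_imp_nondecreasing[OF r(2)])
    fix x assume "r \<le> x" "x \<le> r'"
    then show "\<exists>y. DERIV (profile \<sigma>) x :> y \<and> 0 \<le> y"
      using False r DERIV_profile[of x \<sigma>] profile_deriv_bounds(1)[OF \<sigma>, of x] by auto
  qed
qed

lemma profile_diff_le:
  assumes "0 < \<sigma>" "\<sigma> < 1" "0 \<le> r" "r \<le> r'"
  shows "profile \<sigma> r' - profile \<sigma> r \<le> 2 * (r' - r)"
proof -
  have "r powr (2 - \<sigma>) \<le> r' powr (2 - \<sigma>)" using assms by (intro powr_mono2) auto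
  then show ?thesis by (simp add: profile_def)
qed

lemma profile_midpoint:
  assumes \<sigma>: "0 < \<sigma>" "\<sigma> < 1" and xy: "0 \<le> x" "0 \<le> y"
  shows "profile \<sigma> x + profile \<sigma> y \<le> 2 * profile \<sigma> ((x + y) / 2)"
proof -
  let ?a = "2 - \<sigma>"
  \<comment> \<open>Convexity of the power is invoked for positive arguments below; this bound
    covers the case in which one endpoint is 0.\<close>
  have half: "(z / 2) powr ?a \<le> z powr ?a / 2" if "z \<ge> 0" for z :: real
  proof -
    have "2 powr 1 \<le> 2 powr ?a" using \<sigma> by (intro powr_mono) auto
    then have "z powr ?a / 2 powr ?a \<le> z powr ?a / 2" by (intro divide_left_mono) auto
    then show ?thesis using that by (simp add: powr_divide)
  qed
  have "((x + y) / 2) powr ?a \<le> (x powr ?a + y powr ?a) / 2"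
  proof (cases "x = 0 \<or> y = 0")
    case True
    then show ?thesis using half[of x] half[of y] xy by auto
  next
    case False
    then have "x > 0" "y > 0" using xy by auto
    then have "((1 - 1/2) *\<^sub>R x + (1/2) *\<^sub>R y) powr ?a \<le> (1 - 1/2) * x powr ?a + (1/2) * y powr ?a"
      using \<sigma> by (intro convex_onD[OF powr_convex]) auto
    then show ?thesis by (simp add: field_simps)
  qed
  then show ?thesis by (simp add: profile_def field_simps)
qed

definition barrier :: "real \<Rightarrow> real \<Rightarrow> real \<Rightarrow> real" where
  "barrier \<sigma> \<delta> t = profile \<sigma> (max 0 (min t \<delta>))"

lemma barrier_measurable [measurable]: "barrier \<sigma> \<delta> \<in> borel_measurable borel"
  unfolding barrier_def profile_def by measurable

locale barrier_params =
  fixes \<sigma> \<delta> :: real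
  assumes \<sigma>: "0 < \<sigma>" "\<sigma> < 1" and \<delta>: "0 < \<delta>" "\<delta> \<le> 1"
begin

abbreviation W :: "real \<Rightarrow> real" where "W \<equiv> barrier \<sigma> \<delta>"

lemma W_eq_0: "t \<le> 0 \<Longrightarrow> W t = 0"
  using \<delta> by (simp add: barrier_def profile_def min_def)

lemma W_mono: "t \<le> t' \<Longrightarrow> W t \<le> W t'"
  unfolding barrier_def using \<sigma> \<delta> by (intro profile_mono) auto

lemma W_nonneg: "W t \<ge> 0"
  using W_mono[of "min t 0" t] W_eq_0[of "min t 0"] by simp

lemma W_diff_le:
  assumes "t \<le> t'"
  shows "W t' - W t \<le> 2 * (t' - t)"
proof -
  have "W t' - W t \<le> 2 * (max 0 (min t' \<delta>) - max 0 (min t \<delta>))"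
    unfolding barrier_def using \<sigma> \<delta> assms by (intro profile_diff_le) auto
  also have "\<dots> \<le> 2 * (t' - t)" using assms by (auto simp: max_def min_def)
  finally show ?thesis .
qed

lemma W_le: "W t \<le> 2 * max 0 t"
  using W_diff_le[of 0 t] W_eq_0[of 0] W_eq_0[of t] by (cases "t \<ge> 0") auto

lemma W_le_2: "W t \<le> 2"
proof -
  have "W t \<le> W \<delta>" if "t \<ge> \<delta>" using that by (simp add: barrier_def)
  then have "W t \<le> W \<delta>" using W_mono[of t \<delta>] by linarith
  also have "\<dots> \<le> 2 * \<delta>" using W_le[of \<delta>] \<delta> by simp
  finally show ?thesis using \<delta> by simp
qed

lemma W_ge:
  assumes "t \<ge> \<delta> / 2"
  shows "W t \<ge> \<delta> / 2"
proof -
  have "min t \<delta> \<le> profile \<sigma> (min t \<delta>)" using \<sigma> \<delta> assms by (intro profile_ge) auto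
  moreover have "max 0 (min t \<delta>) = min t \<delta>" using \<delta> assms by auto
  ultimately show ?thesis using \<delta> assms by (auto simp: barrier_def)
qed

text \<open>For \<eta> at most t both points stay in the half line t >= 0, where clamping at
  \<delta> is concave. The midpoint of the clamped points is then at most the clamped midpoint, and
  the profile is increasing.\<close>

lemma W_concave:
  assumes "0 \<le> \<eta>" "\<eta> \<le> t"
  shows "W (t + \<eta>) + W (t - \<eta>) \<le> 2 * W t"
proof -
  let ?x = "max 0 (min (t + \<eta>) \<delta>)" and ?y = "max 0 (min (t - \<eta>) \<delta>)"
  have "W (t + \<eta>) + W (t - \<eta>) \<le> 2 * profile \<sigma> ((?x + ?y) / 2)"
    unfolding barrier_def using \<sigma> by (intro profile_midpoint) auto
  also have "\<dots> \<le> 2 * W t"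
    unfolding barrier_def using \<sigma> \<delta> assms by (intro mult_left_mono profile_mono) (auto simp: max_def min_def)
  finally show ?thesis .
qed

text \<open>Only increments that cross the kink can spoil concavity. For those one of the two values
  is 0, and the other exceeds \<open>W t\<close> by at most 2|\<eta>| because of the slope and by at
  most 2 because W is bounded.\<close>

lemma W_second_difference:
  assumes t: "t > 0"
  shows "2 * W t - W (t + \<eta>) - W (t - \<eta>) \<ge> - 2 * (if \<bar>\<eta>\<bar> > t then min 1 \<bar>\<eta>\<bar> else 0)"
proof -
  have "2 * W t - W (t + \<eta>) - W (t - \<eta>) \<ge> - 2 * (if \<eta> > t then min 1 \<eta> else 0)" if "\<eta> \<ge> 0" for \<eta>
  proof (cases "\<eta> > t")
    case True
    then have "W (t - \<eta>) = 0" using W_eq_0 by simp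
    moreover have "W (t + \<eta>) - W t \<le> 2 * \<eta>" using W_diff_le[of t "t + \<eta>"] that by simp
    moreover have "W (t + \<eta>) \<le> 2" by (rule W_le_2)
    moreover have "W t \<ge> 0" by (rule W_nonneg)
    ultimately show ?thesis using True by (auto simp: min_def)
  next
    case False
    then show ?thesis using W_concave[of \<eta> t] that by simp
  qed
  from this[of "\<bar>\<eta>\<bar>"] show ?thesis by (cases "\<eta> \<ge> 0") auto
qed

lemma W_has_derivative:
  assumes "0 < t" "t < \<delta>"
  shows "(W has_real_derivative (2 - (2 - \<sigma>) * t powr (1 - \<sigma>))) (at t)"
proof (rule has_field_derivative_transform_within_open[OF DERIV_profile[OF assms(1)]])
  show "open {0<..<\<delta>}" by simp
qed (use assms in \<open>auto simp: barrier_def\<close>)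

end

subsection \<open>The test function built from the barrier\<close>

text \<open>Naming C here fixes one constant for the whole development, before any boundary point is
  chosen. The argument \<open>dim\<close> only pins down the dimension.\<close>

locale kernel_tail =
  fixes dim :: "'a::euclidean_space itself" and s C :: real
  assumes s: "0 < s" "s < 1" and C: "C \<ge> 0"
    and tail: "\<And>t. t > 0 \<Longrightarrow> (\<integral>\<^sup>+(h::'a). ennreal (indicator {h. t < norm h} h * min 1 (norm h) * kern s h) \<partial>lborel)
      \<le> ennreal (C * t powr (- s))"

text \<open>In the application p is a boundary point, e the inner normal of a supporting hyperplane
  and v an approximation of u. The condition \<open>K \<le> A * (\<delta> / 2)\<close> lifts the
  barrier above v at distance \<delta>/2.\<close>

locale comparison = barrier_params \<sigma> \<delta> + kernel_tail "TYPE('a)" s C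
  for \<sigma> \<delta> s C and \<Omega> :: "'a::euclidean_space set" +
  fixes v :: "'a \<Rightarrow> real" and p e :: 'a and A K :: real
  assumes \<Omega>_pos: "\<And>x. x \<in> \<Omega> \<Longrightarrow> (x - p) \<bullet> e > 0" and e: "norm e = 1"
    and v_test: "v \<in> test_functions \<Omega>" and v_le: "\<And>x. v x \<le> K"
    and A: "A > 0" "K \<le> A * (\<delta> / 2)"
begin

definition T :: "'a \<Rightarrow> real" where "T x = (x - p) \<bullet> e"

definition V :: "'a \<Rightarrow> real" where "V x = v x - A * W (T x)"

definition \<phi> :: "'a \<Rightarrow> real" where "\<phi> x = flat 0 (V x)"

lemma T_continuous: "continuous_on S T"
  unfolding T_def by (intro continuous_intros)

lemma T_measurable [measurable]: "T \<in> borel_measurable borel"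
  by (intro borel_measurable_continuous_onI T_continuous)

lemma V_measurable [measurable]: "V \<in> borel_measurable borel"
  using test_functions_measurable[OF v_test] unfolding V_def by measurable

lemma T_has_derivative: "(T has_derivative (\<lambda>h. h \<bullet> e)) (at x)"
  unfolding T_def by (auto intro!: derivative_eq_intros)

text \<open>Outside \<Omega> the function v vanishes while W is non-negative; for T at least
  \<delta>/2 the barrier is at least K. So V can be positive only in a strip where W is
  smooth.\<close>

lemma V_pos_imp:
  assumes "V x > 0"
  shows "v x > 0" "x \<in> \<Omega>" "0 < T x" "T x < \<delta> / 2"
proof -
  have "A * W (T x) \<ge> 0" using A W_nonneg by simp
  then show "v x > 0" using assms by (simp add: V_def)
  then have "x \<in> {x. v x \<noteq> 0}" by simp
  from subsetD[OF closure_subset this] show "x \<in> \<Omega>"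
    by (rule subsetD[OF test_functions_support[OF v_test]])
  then show "0 < T x" using \<Omega>_pos by (simp add: T_def)
  show "T x < \<delta> / 2"
  proof (rule ccontr)
    assume "\<not> T x < \<delta> / 2"
    then have "A * (\<delta> / 2) \<le> A * W (T x)" using A(1) W_ge by (intro mult_left_mono) auto
    then show False using assms v_le[of x] A(2) by (simp add: V_def)
  qed
qed

text \<open>For smoothness a whole neighbourhood is needed. Where T is at most 0, it comes from the
  gap between the support of v and the complement of \<Omega>; where T is at least \<delta>, from
  the gap between \<delta>/2 and \<delta>. This is why the barrier must win already at half its
  width.\<close>

lemma flat_V_zero_nbhd:
  assumes "\<not> (0 < T x \<and> T x < \<delta>)"
  shows "\<exists>S. open S \<and> x \<in> S \<and> (\<forall>y\<in>S. V y \<le> 0)"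
proof (cases "T x > 0")
  case False
  then have "x \<in> - closure {x. v x \<noteq> 0}"
    using v_test \<Omega>_pos[of x] unfolding test_functions_def T_def by auto
  moreover have "V y \<le> 0" if "y \<in> - closure {x. v x \<noteq> 0}" for y
    using that closure_subset[of "{x. v x \<noteq> 0}"] V_pos_imp(1)[of y] by (force simp: not_less)
  ultimately show ?thesis by (intro exI[of _ "- closure {x. v x \<noteq> 0}"]) auto
next
  case True
  then have "T x > \<delta> / 2" using assms \<delta> by auto
  moreover have "open {x. T x > \<delta> / 2}"
    using open_Collect_less[OF continuous_on_const T_continuous] .
  moreover have "V y \<le> 0" if "T y > \<delta> / 2" for y
    using V_pos_imp(4)[of y] that by linarith
  ultimately show ?thesis by (intro exI[of _ "{x. T x > \<delta> / 2}"]) auto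
qed

lemma V_has_derivative:
  assumes "0 < T x" "T x < \<delta>"
  shows "(V has_derivative (\<lambda>h. h \<bullet> (grad v x - (A * (2 - (2 - \<sigma>) * T x powr (1 - \<sigma>))) *\<^sub>R e))) (at x)"
proof -
  have "((\<lambda>x. W (T x)) has_derivative (\<lambda>h. (2 - (2 - \<sigma>) * T x powr (1 - \<sigma>)) * (h \<bullet> e))) (at x)"
    using has_derivative_compose[OF T_has_derivative W_has_derivative[OF assms, unfolded has_field_derivative_def]] .
  from has_derivative_diff[OF test_functions_has_derivative[OF v_test] has_derivative_mult_right[OF this, of A]]
  show ?thesis unfolding V_def by (simp add: inner_diff_right mult_ac)
qed

text \<open>These are the factors that arise when flat functions of V are differentiated repeatedly.
  Powers of T are smooth only for T > 0, so derivatives are described only there.\<close>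

inductive_set coeff :: "('a \<Rightarrow> real) set" where
  const: "(\<lambda>_. c) \<in> coeff"
| test: "f \<in> test_functions \<Omega> \<Longrightarrow> f \<in> coeff"
| power: "(\<lambda>x. T x powr a) \<in> coeff"
| add: "f \<in> coeff \<Longrightarrow> g \<in> coeff \<Longrightarrow> (\<lambda>x. f x + g x) \<in> coeff"
| mult: "f \<in> coeff \<Longrightarrow> g \<in> coeff \<Longrightarrow> (\<lambda>x. f x * g x) \<in> coeff"

lemma coeff_derivative:
  assumes "f \<in> coeff"
  shows "(\<forall>x. T x > 0 \<longrightarrow> f differentiable (at x)) \<and>
    (\<forall>b\<in>Basis. \<exists>f'\<in>coeff. \<forall>x. T x > 0 \<longrightarrow> grad f x \<bullet> b = f' x)"
  using assms
proof induction
  case (const c)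
  have "((\<lambda>_. c) has_derivative (\<lambda>_. 0)) (at x)" for x :: 'a by simp
  from grad_inner_Basis[OF this] show ?case by (auto intro!: bexI[OF _ coeff.const[of 0]])
next
  case (test f)
  then show ?case
    by (auto intro!: test_functions_differentiable[OF test] bexI[OF _ coeff.test[OF test_functions_grad[OF test]]])
next
  case (power a)
  have der: "((\<lambda>x. T x powr a) has_derivative (\<lambda>h. a * T x powr (a - 1) * (h \<bullet> e))) (at x)" if "T x > 0" for x
    using has_derivative_compose[OF T_has_derivative has_real_derivative_powr[OF that, unfolded has_field_derivative_def]] .
  have "(\<lambda>x. a * T x powr (a - 1) * (b \<bullet> e)) \<in> coeff" for b by (intro coeff.intros)
  with grad_inner_Basis[OF der] der show ?case by (force simp: differentiable_def)
next
  case (add f g)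
  then have der: "((\<lambda>x. f x + g x) has_derivative (\<lambda>h. h \<bullet> grad f x + h \<bullet> grad g x)) (at x)" if "T x > 0" for x
    using that by (auto intro!: derivative_intros has_derivative_grad)
  show ?case
  proof (intro conjI ballI allI impI)
    show "(\<lambda>x. f x + g x) differentiable (at x)" if "T x > 0" for x
      using der[OF that] by (auto simp: differentiable_def)
    fix b :: 'a assume "b \<in> Basis"
    then obtain f' g' where "f' \<in> coeff" "g' \<in> coeff"
      "\<And>x. T x > 0 \<Longrightarrow> grad f x \<bullet> b = f' x" "\<And>x. T x > 0 \<Longrightarrow> grad g x \<bullet> b = g' x"
      using add.IH by metis
    then show "\<exists>f'\<in>coeff. \<forall>x. T x > 0 \<longrightarrow> grad (\<lambda>x. f x + g x) x \<bullet> b = f' x"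
      using grad_inner_Basis[OF der]
      by (intro bexI[of _ "\<lambda>x. f' x + g' x"]) (auto simp: inner_commute[of b] intro: coeff.add)
  qed
next
  case (mult f g)
  then have der: "((\<lambda>x. f x * g x) has_derivative (\<lambda>h. f x * (h \<bullet> grad g x) + (h \<bullet> grad f x) * g x)) (at x)" if "T x > 0" for x
    using that by (auto intro!: derivative_intros has_derivative_grad)
  show ?case
  proof (intro conjI ballI allI impI)
    show "(\<lambda>x. f x * g x) differentiable (at x)" if "T x > 0" for x
      using der[OF that] by (auto simp: differentiable_def)
    fix b :: 'a assume "b \<in> Basis"
    then obtain f' g' where "f' \<in> coeff" "g' \<in> coeff"
      "\<And>x. T x > 0 \<Longrightarrow> grad f x \<bullet> b = f' x" "\<And>x. T x > 0 \<Longrightarrow> grad g x \<bullet> b = g' x"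
      using mult.IH by metis
    then show "\<exists>f'\<in>coeff. \<forall>x. T x > 0 \<longrightarrow> grad (\<lambda>x. f x * g x) x \<bullet> b = f' x"
      using grad_inner_Basis[OF der] mult.hyps
      by (intro bexI[of _ "\<lambda>x. f x * g' x + f' x * g x"])
         (auto simp: inner_commute[of b] intro!: coeff.add coeff.mult)
  qed
qed

lemma V_derivative_coeff:
  assumes "b \<in> Basis"
  shows "\<exists>V'\<in>coeff. \<forall>x. 0 < T x \<longrightarrow> T x < \<delta> \<longrightarrow> grad V x \<bullet> b = V' x"
proof -
  have "(\<lambda>x. grad v x \<bullet> b + (- A * (b \<bullet> e)) * (2 + (- (2 - \<sigma>)) * T x powr (1 - \<sigma>))) \<in> coeff"
    using test_functions_grad[OF v_test assms] by (intro coeff.intros)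
  then show ?thesis
    by (rule bexI[rotated])
       (auto simp: grad_inner_Basis[OF V_has_derivative] inner_diff_right inner_commute[of b] algebra_simps)
qed

text \<open>A flat factor vanishes near every point at which V or a coefficient may fail to be
  smooth. Hence these products are smooth everywhere, and the class is closed under partial
  derivatives.\<close>

inductive_set cut :: "('a \<Rightarrow> real) set" where
  flat: "g \<in> coeff \<Longrightarrow> (\<lambda>x. flat j (V x) * g x) \<in> cut"
| add: "f \<in> cut \<Longrightarrow> g \<in> cut \<Longrightarrow> (\<lambda>x. f x + g x) \<in> cut"

lemma grad_zero_nbhd:
  assumes "open S" "x \<in> S" "\<And>y. y \<in> S \<Longrightarrow> f y = 0"
  shows "f differentiable (at x)" "grad f x = 0"
proof -
  have "((\<lambda>_. 0) has_derivative (\<lambda>h. h \<bullet> 0)) (at x)" by simp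
  then have "(f has_derivative (\<lambda>h. h \<bullet> 0)) (at x)"
    by (rule has_derivative_transform_within_open[OF _ assms(1,2)]) (simp add: assms(3))
  then show "f differentiable (at x)" "grad f x = 0"
    by (auto simp: differentiable_def intro: grad_eqI simp del: inner_zero_right)
qed

lemma flat_V_has_derivative:
  assumes "0 < T x" "T x < \<delta>"
  shows "((\<lambda>x. flat j (V x)) has_derivative
    (\<lambda>h. (flat (j + 2) (V x) - j * flat (j + 1) (V x)) * (h \<bullet> grad V x))) (at x)"
proof -
  have "V differentiable (at x)" using V_has_derivative[OF assms] by (auto simp: differentiable_def)
  from has_derivative_compose[OF has_derivative_grad[OF this] DERIV_flat[unfolded has_field_derivative_def]]
  show ?thesis .
qed

lemma cut_zero: "f \<in> cut \<Longrightarrow> V x \<le> 0 \<Longrightarrow> f x = 0"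
  by (induction rule: cut.induct) (auto simp: flat_eq_0)

lemma cut_derivative:
  assumes "f \<in> cut"
  shows "(\<forall>x. f differentiable (at x)) \<and> (\<forall>b\<in>Basis. (\<lambda>x. grad f x \<bullet> b) \<in> cut)"
  using assms
proof induction
  case (flat g j)
  let ?f = "\<lambda>x. flat j (V x) * g x"
  have zero: "?f differentiable (at x) \<and> grad ?f x = 0" if outside: "\<not> (0 < T x \<and> T x < \<delta>)" for x
  proof -
    obtain S where S: "open S" "x \<in> S" "\<And>y. y \<in> S \<Longrightarrow> V y \<le> 0"
      using flat_V_zero_nbhd[OF outside] by blast
    then show ?thesis by (intro conjI grad_zero_nbhd[OF S(1,2)]) (simp_all add: flat_eq_0)
  qed
  have der: "(?f has_derivative (\<lambda>h. flat j (V x) * (h \<bullet> grad g x) +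
      ((flat (j + 2) (V x) - j * flat (j + 1) (V x)) * (h \<bullet> grad V x)) * g x)) (at x)"
    if "0 < T x" "T x < \<delta>" for x
    using coeff_derivative[OF flat] that
    by (intro has_derivative_mult flat_V_has_derivative has_derivative_grad) auto
  show ?case
  proof (intro conjI allI ballI)
    show "?f differentiable (at x)" for x
      using zero[of x] der[of x] by (auto simp: differentiable_def)
    fix b :: 'a assume b: "b \<in> Basis"
    obtain g' where g': "g' \<in> coeff" "\<And>x. T x > 0 \<Longrightarrow> grad g x \<bullet> b = g' x"
      using coeff_derivative[OF flat] b by metis
    obtain V' where V': "V' \<in> coeff" "\<And>x. 0 < T x \<Longrightarrow> T x < \<delta> \<Longrightarrow> grad V x \<bullet> b = V' x"
      using V_derivative_coeff[OF b] by metis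
    have "grad ?f x \<bullet> b = flat j (V x) * g' x +
      (flat (j + 2) (V x) * (V' x * g x) + flat (j + 1) (V x) * ((- real j) * (V' x * g x)))" for x
    proof (cases "0 < T x \<and> T x < \<delta>")
      case True
      then show ?thesis
        by (subst grad_inner_Basis[OF der])
           (auto simp: inner_commute[of b] g' V' algebra_simps)
    next
      case False
      then have "V x \<le> 0" using flat_V_zero_nbhd by blast
      then show ?thesis using zero[OF False] by (simp add: flat_eq_0)
    qed
    then show "(\<lambda>x. grad ?f x \<bullet> b) \<in> cut"
      using g'(1) V'(1) flat by (simp only:) (intro cut.intros coeff.mult coeff.const)
  qed
next
  case (add f g)
  then have der: "((\<lambda>x. f x + g x) has_derivative (\<lambda>h. h \<bullet> grad f x + h \<bullet> grad g x)) (at x)" for x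
    by (auto intro!: derivative_intros has_derivative_grad)
  from grad_inner_Basis[OF der] der add show ?case
    by (auto simp: inner_commute[of _ "grad _ _"] differentiable_def intro: cut.add)
qed

lemma cut_test_functions: "f \<in> cut \<Longrightarrow> f \<in> test_functions \<Omega>"
proof -
  assume f: "f \<in> cut"
  have "C_k k f" for k by (rule C_k_family[OF _ _ f]) (use cut_derivative in blast)+
  moreover have "{x. f x \<noteq> 0} \<subseteq> {x. v x \<noteq> 0}"
  proof
    fix x assume "x \<in> {x. f x \<noteq> 0}"
    then have "V x > 0" using cut_zero[OF f, of x] by (cases "V x \<le> 0") auto
    then show "x \<in> {x. v x \<noteq> 0}" using V_pos_imp(1)[of x] by simp
  qed
  then have "closure {x. f x \<noteq> 0} \<subseteq> closure {x. v x \<noteq> 0}" by (rule closure_mono)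
  moreover have "compact (closure {x. f x \<noteq> 0})"
    using bounded_subset[OF test_functions_bounded_support[OF v_test]] \<open>{x. f x \<noteq> 0} \<subseteq> {x. v x \<noteq> 0}\<close>
    by simp
  ultimately show ?thesis using v_test unfolding test_functions_def by blast
qed

lemma cut_mult: 
  assumes "g \<in> coeff"
  shows "(\<lambda>x. \<phi> x * g x) \<in> cut"
  unfolding \<phi>_def by (rule cut.flat[OF assms])

lemma \<phi>_cut: "\<phi> \<in> cut"
  using cut_mult[OF coeff.const[of 1]] by simp

lemmas \<phi>_test = cut_test_functions[OF \<phi>_cut]

lemma \<phi>_nonneg: "\<phi> x \<ge> 0" by (simp add: \<phi>_def flat_nonneg)

lemma \<phi>_nz: "\<phi> x \<noteq> 0 \<Longrightarrow> V x > 0"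
  using flat_eq_0[of "V x" 0] by (auto simp: \<phi>_def not_le[symmetric])

lemma \<phi>_zero_nbhd:
  assumes "\<not> (0 < T x \<and> T x < \<delta>)"
  shows "\<exists>S. open S \<and> x \<in> S \<and> (\<forall>y\<in>S. \<phi> y = 0)"
proof -
  obtain S where S: "open S" "x \<in> S" "\<And>y. y \<in> S \<Longrightarrow> V y \<le> 0"
    using flat_V_zero_nbhd[OF assms] by blast
  then have "\<phi> y = 0" if "y \<in> S" for y using that by (simp add: \<phi>_def flat_eq_0)
  then show ?thesis using S by blast
qed

section \<open>Gradient estimates for the test function\<close>

lemma grad_\<phi>:
  "grad \<phi> x = (if 0 < T x \<and> T x < \<delta> then flat 2 (V x) *\<^sub>R
     (grad v x - (A * (2 - (2 - \<sigma>) * T x powr (1 - \<sigma>))) *\<^sub>R e) else 0)"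
proof (cases "0 < T x \<and> T x < \<delta>")
  case True
  have "grad V x = grad v x - (A * (2 - (2 - \<sigma>) * T x powr (1 - \<sigma>))) *\<^sub>R e"
    using True by (intro grad_eqI V_has_derivative) auto
  moreover have "(\<phi> has_derivative (\<lambda>h. h \<bullet> (flat 2 (V x) *\<^sub>R grad V x))) (at x)"
    using flat_V_has_derivative[of x 0] True unfolding \<phi>_def[abs_def] by (simp add: numeral_2_eq_2)
  moreover have "grad \<phi> x = flat 2 (V x) *\<^sub>R grad V x" by (rule grad_eqI) fact
  ultimately show ?thesis using True by simp
next
  case False
  obtain S where "open S" "x \<in> S" "\<And>y. y \<in> S \<Longrightarrow> \<phi> y = 0"
    using \<phi>_zero_nbhd[OF False] by blast
  from grad_zero_nbhd(2)[OF this] show ?thesis using False by (simp only: if_False)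
qed

lemma grad_\<phi>_outside: "x \<notin> \<Omega> \<Longrightarrow> grad \<phi> x = 0"
  by (intro grad_eq_0 contra_subsetD[OF test_functions_support[OF \<phi>_test]])

text \<open>The derivative of f is at most 2 and the slope of W lies between 0 and 2. The bound
  involves v only through its gradient, so the H^1 norm of \<phi> stays controlled while v
  approaches u.\<close>

lemma norm_grad_\<phi>_le: "norm (grad \<phi> x) \<le> 2 * norm (grad v x) + 4 * A * indicator \<Omega> x"
proof (cases "x \<in> \<Omega> \<and> 0 < T x \<and> T x < \<delta>")
  case True
  let ?d = "2 - (2 - \<sigma>) * T x powr (1 - \<sigma>)"
  have d: "0 \<le> ?d" "?d \<le> 2" using profile_deriv_bounds[OF \<sigma>, of "T x"] True \<delta> by auto
  have "norm (grad \<phi> x) = flat 2 (V x) * norm (grad v x - (A * ?d) *\<^sub>R e)"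
    using True by (simp add: grad_\<phi> flat_nonneg)
  also have "\<dots> \<le> 2 * norm (grad v x - (A * ?d) *\<^sub>R e)"
    using flat_le[of 2 "V x"] by (intro mult_right_mono) auto
  also have "norm (grad v x - (A * ?d) *\<^sub>R e) \<le> norm (grad v x) + A * ?d"
    using norm_triangle_ineq4[of "grad v x" "(A * ?d) *\<^sub>R e"] e A d by (simp add: abs_mult)
  also have "A * ?d \<le> A * 2" using A d by (intro mult_left_mono) auto
  finally show ?thesis using True by simp
next
  case False
  then have "grad \<phi> x = 0" using grad_\<phi>[of x] grad_\<phi>_outside[of x] by auto
  then show ?thesis using A by simp
qed

text \<open>The product of grad V and grad \<phi> is f'(V) |grad V|^2, hence non-negative, so v may
  be replaced by the barrier. The product rule then writes W' times the e-derivative of \<phi> as an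
  exact derivative, which integrates to 0, minus W'' \<phi>, the singular gain.\<close>

lemma grad_v_inner_grad_\<phi>:
  "grad v x \<bullet> grad \<phi> x \<ge> A * (grad (\<lambda>x. \<phi> x * (2 + (- (2 - \<sigma>)) * T x powr (1 - \<sigma>))) x \<bullet> e) +
     A * ((2 - \<sigma>) * (1 - \<sigma>)) * (T x powr (- \<sigma>) * \<phi> x)"
proof (cases "0 < T x \<and> T x < \<delta>")
  case True
  let ?d = "2 - (2 - \<sigma>) * T x powr (1 - \<sigma>)"
  let ?F = "\<lambda>x. \<phi> x * (2 + (- (2 - \<sigma>)) * T x powr (1 - \<sigma>))"
  have "(?F has_derivative (\<lambda>h. \<phi> x * ((- (2 - \<sigma>)) * ((1 - \<sigma>) * T x powr (1 - \<sigma> - 1) * (h \<bullet> e)))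
       + (h \<bullet> grad \<phi> x) * (2 + (- (2 - \<sigma>)) * T x powr (1 - \<sigma>)))) (at x)"
  proof -
    have d: "((\<lambda>x. T x powr (1 - \<sigma>)) has_derivative (\<lambda>h. (1 - \<sigma>) * T x powr (1 - \<sigma> - 1) * (h \<bullet> e))) (at x)"
      using has_derivative_compose[OF T_has_derivative
          has_real_derivative_powr[OF conjunct1[OF True], unfolded has_field_derivative_def]] .
    from has_derivative_mult[OF test_functions_has_derivative[OF \<phi>_test, of x]
        has_derivative_add[OF has_derivative_const[of 2] has_derivative_mult_right[OF d, of "- (2 - \<sigma>)"]]]
    show ?thesis by (simp add: mult.assoc)
  qed
  from grad_inner_Basis[OF this, of e]
  have F: "grad ?F x \<bullet> e = - ((2 - \<sigma>) * (1 - \<sigma>)) * (T x powr (- \<sigma>) * \<phi> x) + ?d * (e \<bullet> grad \<phi> x)"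
    using e by (simp add: norm_eq_1 algebra_simps)
  have "grad v x \<bullet> grad \<phi> x - A * ?d * (e \<bullet> grad \<phi> x) = (grad v x - (A * ?d) *\<^sub>R e) \<bullet> grad \<phi> x"
    by (simp add: inner_diff_left)
  also have "\<dots> = flat 2 (V x) * ((grad v x - (A * ?d) *\<^sub>R e) \<bullet> (grad v x - (A * ?d) *\<^sub>R e))"
    using True by (simp add: grad_\<phi>)
  also have "\<dots> \<ge> 0" by (simp add: flat_nonneg)
  finally show ?thesis unfolding F by (simp add: algebra_simps)
next
  case False
  let ?F = "\<lambda>x. \<phi> x * (2 + (- (2 - \<sigma>)) * T x powr (1 - \<sigma>))"
  obtain S where S: "open S" "x \<in> S" "\<And>y. y \<in> S \<Longrightarrow> \<phi> y = 0"
    using \<phi>_zero_nbhd[OF False] by blast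
  have "grad ?F x = 0" by (rule grad_zero_nbhd(2)[OF S(1,2)]) (simp add: S(3))
  moreover have "\<phi> x = 0" using S by blast
  moreover have "grad \<phi> x = 0" using False by (simp only: grad_\<phi> if_False)
  ultimately show ?thesis by simp
qed

end

subsection \<open>Lower bounds for the two parts of the form\<close>

text \<open>By translation invariance the increments of F integrate to 0, so the Taylor remainder
  bounds the integral of \<open>h \<bullet> grad F\<close> by a multiple of |h|^2. Being linear in
  h, that integral must vanish.\<close>

lemma integral_grad_eq_0:
  fixes F :: "'a::euclidean_space \<Rightarrow> real"
  assumes F: "F \<in> test_functions \<Omega>"
  shows "(LBINT x. grad F x \<bullet> e) = 0"
proof -
  note [measurable] = test_functions_measurable[OF F] grad_measurable[OF F]
  obtain L where L: "L > 0" "\<And>x h. \<bar>F (x + h) - F x - h \<bullet> grad F x\<bar> \<le> L * (norm h)\<^sup>2"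
    using test_functions_taylor[OF F] by blast
  have "bounded (closure {x. F x \<noteq> 0})"
    using test_functions_bounded_support[OF F] by (rule bounded_closure)
  then obtain R where R: "\<And>x. x \<in> closure {x. F x \<noteq> 0} \<Longrightarrow> norm x \<le> R" by (auto simp: bounded_iff)
  define m where "m = measure lborel (cball (0::'a) (R + 1))"
  have int_cball: "integrable lborel (indicator (cball (0::'a) (R + 1)) :: 'a \<Rightarrow> real)"
    using emeasure_bounded_finite[OF bounded_cball[of "0::'a" "R + 1"]]
    by (intro integrable_real_indicator) auto
  have int_F: "integrable lborel F" by (rule test_functions_integrable(1)[OF F])
  have int_g: "integrable lborel (\<lambda>x. h \<bullet> grad F x)" for h
    using grad_bounded_support[OF F]
    by (intro continuous_bounded_support(1) continuous_intros continuous_on_grad[OF F])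
       (auto elim!: bounded_subset)
  have key: "\<bar>\<integral>x. h \<bullet> grad F x \<partial>lborel\<bar> \<le> L * m * (norm h)\<^sup>2" if h: "norm h \<le> 1" for h
  proof -
    have int_t: "integrable lborel (\<lambda>x. F (x + h))" "(LBINT x. F (x + h)) = (LBINT x. F x)"
      using lborel_integral_translate[of F h] int_F by auto
    have "\<bar>\<integral>x. h \<bullet> grad F x \<partial>lborel\<bar> = \<bar>\<integral>x. F (x + h) - F x - h \<bullet> grad F x \<partial>lborel\<bar>"
      using int_t int_F int_g[of h] by simp
    also have "\<dots> \<le> (LBINT x. L * (norm h)\<^sup>2 * indicator (cball (0::'a) (R + 1)) x)"
    proof (rule integral_abs_bound_integral)
      show "\<bar>F (x + h) - F x - h \<bullet> grad F x\<bar> \<le> L * (norm h)\<^sup>2 * indicator (cball (0::'a) (R + 1)) x" for x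
      proof (cases "norm x \<le> R + 1")
        case True
        then show ?thesis using L(2)[of x h] by simp
      next
        case False
        have out: "F y = 0 \<and> grad F y = 0" if "norm y > R" for y
        proof -
          have "y \<notin> closure {x. F x \<noteq> 0}" using R[of y] that by auto
          then show ?thesis using grad_eq_0[of y F] closure_subset[of "{x. F x \<noteq> 0}"] by auto
        qed
        have "norm x \<le> norm (x + h) + norm h"
          by (metis add_diff_cancel_right' norm_triangle_ineq4)
        then have "norm (x + h) > R" using False h by linarith
        then show ?thesis using out[of x] out[of "x + h"] False by simp
      qed
    qed (use int_t int_F int_g[of h] int_cball in auto)
    also have "\<dots> = L * m * (norm h)\<^sup>2"
      using int_cball by (simp add: m_def mult_ac)
    finally show ?thesis .
  qed
  define I where "I = \<bar>\<integral>x. grad F x \<bullet> e \<partial>lborel\<bar>"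
  define C where "C = L * m * (norm e)\<^sup>2"
  have est: "I \<le> \<tau> * C" if \<tau>: "\<tau> > 0" "\<tau> * norm e \<le> 1" for \<tau>
  proof -
    have "\<tau> * I = \<bar>\<integral>x. (\<tau> *\<^sub>R e) \<bullet> grad F x \<partial>lborel\<bar>"
      using \<tau> by (simp add: I_def inner_commute[of e] abs_mult)
    also have "\<dots> \<le> L * m * (norm (\<tau> *\<^sub>R e))\<^sup>2" using \<tau> by (intro key) simp
    also have "\<dots> = \<tau> * (\<tau> * C)" by (simp add: C_def power_mult_distrib power2_eq_square)
    finally show ?thesis using \<tau> by simp
  qed
  have ev1: "\<forall>\<^sub>F \<tau> in at_right (0::real). \<tau> > 0" by (rule eventually_at_right_less)
  have ev2: "\<forall>\<^sub>F \<tau> in at_right (0::real). \<tau> * norm e < 1"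
  proof (rule order_tendstoD(2))
    show "((\<lambda>\<tau>. \<tau> * norm e) \<longlongrightarrow> 0 * norm e) (at_right 0)" by (intro tendsto_intros)
  qed simp
  have "\<forall>\<^sub>F \<tau> in at_right (0::real). I \<le> \<tau> * C"
    using ev1 ev2 by eventually_elim (simp add: est)
  moreover have "((\<lambda>\<tau>. \<tau> * C) \<longlongrightarrow> 0 * C) (at_right 0)" by (intro tendsto_intros)
  ultimately have "I \<le> 0 * C"
    by (intro tendsto_lowerbound[of _ _ "at_right (0::real)"]) auto
  then show ?thesis by (simp add: I_def)
qed

text \<open>By Tonelli the product of \<phi>(x) and \<kappa>(x - y) has norm equal to the product of
  the two L^1 norms; a bounded factor does no harm.\<close>

lemma integrable_convolution_pair:
  fixes \<phi> \<kappa> :: "'a::euclidean_space \<Rightarrow> real" and a :: "'a \<times> 'a \<Rightarrow> real"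
  assumes \<phi>: "integrable lborel \<phi>" and \<kappa>: "integrable lborel \<kappa>"
    and a [measurable]: "a \<in> borel_measurable lborel2" and B: "\<And>p. \<bar>a p\<bar> \<le> B"
  shows "integrable lborel2 (\<lambda>p. a p * (\<phi> (fst p) * \<kappa> (fst p - snd p)))"
proof -
  have [measurable]: "\<phi> \<in> borel_measurable borel" "\<kappa> \<in> borel_measurable borel"
    using \<phi> \<kappa> by auto
  have "(\<integral>\<^sup>+p. ennreal (norm (\<phi> (fst p) * \<kappa> (fst p - snd p))) \<partial>lborel2) =
    (\<integral>\<^sup>+x. \<integral>\<^sup>+y. ennreal (norm (\<phi> x)) * ennreal (norm (\<kappa> (x - y))) \<partial>lborel \<partial>lborel)"
    by (subst lborel.nn_integral_fst[symmetric]) (auto simp: abs_mult ennreal_mult)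
  also have "\<dots> = (\<integral>\<^sup>+x. ennreal (norm (\<phi> x)) * (\<integral>\<^sup>+y. ennreal (norm (\<kappa> y)) \<partial>lborel) \<partial>lborel)"
  proof (intro nn_integral_cong)
    fix x :: 'a
    have "(\<integral>\<^sup>+y. ennreal (norm (\<kappa> y)) \<partial>lborel) = (\<integral>\<^sup>+y. ennreal (norm (\<kappa> (x - y))) \<partial>lborel)"
      using nn_integral_lborel_affine[of "\<lambda>y. ennreal (norm (\<kappa> y))" "-1" x] by simp
    then show "(\<integral>\<^sup>+y. ennreal (norm (\<phi> x)) * ennreal (norm (\<kappa> (x - y))) \<partial>lborel) =
      ennreal (norm (\<phi> x)) * (\<integral>\<^sup>+y. ennreal (norm (\<kappa> y)) \<partial>lborel)"
      by (simp add: nn_integral_cmult)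
  qed
  also have "\<dots> = (\<integral>\<^sup>+x. ennreal (norm (\<phi> x)) \<partial>lborel) * (\<integral>\<^sup>+y. ennreal (norm (\<kappa> y)) \<partial>lborel)"
    by (rule nn_integral_multc) measurable
  also have "\<dots> < \<infinity>" using \<phi> \<kappa> by (simp add: integrable_iff_bounded ennreal_mult_less_top)
  finally have "integrable lborel2 (\<lambda>p. \<phi> (fst p) * \<kappa> (fst p - snd p))"
    by (intro integrableI_bounded) measurable
  then have "integrable lborel2 (\<lambda>p. B * (\<phi> (fst p) * \<kappa> (fst p - snd p)))" by simp
  then show ?thesis
  proof (rule Bochner_Integration.integrable_bound)
    show "AE p in lborel2. norm (a p * (\<phi> (fst p) * \<kappa> (fst p - snd p)))
      \<le> norm (B * (\<phi> (fst p) * \<kappa> (fst p - snd p)))"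
    proof (rule AE_I2)
      fix p
      have "\<bar>a p\<bar> \<le> \<bar>B\<bar>" using B[of p] by linarith
      then have "\<bar>a p\<bar> * \<bar>\<phi> (fst p) * \<kappa> (fst p - snd p)\<bar> \<le> \<bar>B\<bar> * \<bar>\<phi> (fst p) * \<kappa> (fst p - snd p)\<bar>"
        by (rule mult_right_mono) simp
      then show "norm (a p * (\<phi> (fst p) * \<kappa> (fst p - snd p))) \<le> norm (B * (\<phi> (fst p) * \<kappa> (fst p - snd p)))"
        by (simp only: real_norm_def abs_mult)
    qed
  qed measurable
qed

text \<open>An integrable even kernel allows the two terms of \<phi>(x) - \<phi>(y) to be integrated
  separately and exchanged. The form becomes \<phi> against second differences of w, for which
  boundedness of w suffices.\<close>

lemma truncated_form:
  fixes w \<phi> \<kappa> :: "'a::euclidean_space \<Rightarrow> real"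
  assumes [measurable]: "w \<in> borel_measurable borel" and B: "\<And>x. \<bar>w x\<bar> \<le> B"
    and \<phi>: "integrable lborel \<phi>" and \<kappa>: "integrable lborel \<kappa>" "\<And>h. \<kappa> (- h) = \<kappa> h"
  shows "integrable lborel2 (gform_integrand w \<phi> \<kappa>)"
      (is "integrable lborel2 ?F")
    and "integrable lborel (\<lambda>x. \<phi> x * (LBINT h. (2 * w x - w (x + h) - w (x - h)) * \<kappa> h))"
    and "(\<integral>p. (w (fst p) - w (snd p)) * (\<phi> (fst p) - \<phi> (snd p)) * \<kappa> (fst p - snd p) \<partial>lborel2) =
      (LBINT x. \<phi> x * (LBINT h. (2 * w x - w (x + h) - w (x - h)) * \<kappa> h))"
proof -
  have [measurable]: "\<phi> \<in> borel_measurable borel" "\<kappa> \<in> borel_measurable borel"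
    using \<phi> \<kappa> by auto
  \<comment> \<open>This is the term with \<phi>(x) only. Exchanging the variables gives the other
    one, since the kernel is even, and accounts for the factor 2.\<close>
  let ?G = "\<lambda>p. (w (fst p) - w (snd p)) * (\<phi> (fst p) * \<kappa> (fst p - snd p))"
  have wB: "\<bar>w x - w y\<bar> \<le> 2 * B" for x y using B[of x] B[of y] by linarith
  have G: "integrable lborel2 ?G"
    by (rule integrable_convolution_pair[OF \<phi> \<kappa>(1)]) (use wB in auto)
  have swap_eq: "?G (snd p, fst p) = - ((w (fst p) - w (snd p)) * (\<phi> (snd p) * \<kappa> (fst p - snd p)))" for p
    using \<kappa>(2)[of "fst p - snd p"] by (simp add: algebra_simps)
  have G': "integrable lborel2 (\<lambda>p. ?G (snd p, fst p))" "(\<integral>p. ?G (snd p, fst p) \<partial>lborel2) = (\<integral>p. ?G p \<partial>lborel2)"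
    using lborel_pair.integrable_product_swap[OF G] lborel_pair.integral_product_swap[of ?G] G
    by (auto simp: case_prod_unfold)
  have F_eq: "?F = (\<lambda>p. ?G p + ?G (snd p, fst p))"
    by (rule ext) (simp only: swap_eq, simp add: algebra_simps)
  show "integrable lborel2 ?F" unfolding F_eq by (rule Bochner_Integration.integrable_add[OF G G'(1)])
  have F_int: "(\<integral>p. ?F p \<partial>lborel2) = 2 * (\<integral>p. ?G p \<partial>lborel2)"
    unfolding F_eq by (subst Bochner_Integration.integral_add[OF G G'(1)]) (simp only: G'(2) mult_2)
  have inner: "2 * (LBINT y. ?G (x, y)) = \<phi> x * (LBINT h. (2 * w x - w (x + h) - w (x - h)) * \<kappa> h)" for x
  proof -
    have i1: "integrable lborel (\<lambda>h. \<kappa> h * (w x - w (x - h)))" "integrable lborel (\<lambda>h. \<kappa> h * (w x - w (x + h)))"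
      using wB by (intro integrable_mult_bounded[OF \<kappa>(1), where B="2 * B"]; measurable)+
    let ?f = "\<lambda>y. (w x - w y) * \<kappa> (x - y)"
    have e1: "(LBINT y. ?f y) = (LBINT h. \<kappa> h * (w x - w (x - h)))"
      using lborel_integral_reflect(1)[of ?f x] by (simp add: mult.commute)
    have e2: "(LBINT y. ?f y) = (LBINT h. \<kappa> h * (w x - w (x + h)))"
      using lborel_integral_translate(1)[of ?f x] \<kappa>(2) by (simp add: mult.commute add.commute)
    have "2 * (LBINT y. ?f y) = (LBINT h. \<kappa> h * (w x - w (x - h)) + \<kappa> h * (w x - w (x + h)))"
      by (subst Bochner_Integration.integral_add[OF i1]) (simp only: e1[symmetric] e2[symmetric] mult_2)
    also have "\<dots> = (LBINT h. (2 * w x - w (x + h) - w (x - h)) * \<kappa> h)"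
      by (simp add: algebra_simps)
    finally have "2 * (LBINT y. ?f y) = \<dots>" .
    moreover have "(LBINT y. ?G (x, y)) = \<phi> x * (LBINT y. ?f y)"
      by (subst integral_mult_right_zero[symmetric]) (simp add: mult_ac)
    ultimately show ?thesis by (simp add: mult.left_commute)
  qed
  have "integrable lborel (\<lambda>x. 2 * (LBINT y. ?G (x, y)))"
    using lborel_pair.integrable_fst'[OF G] by simp
  then show "integrable lborel (\<lambda>x. \<phi> x * (LBINT h. (2 * w x - w (x + h) - w (x - h)) * \<kappa> h))"
    unfolding inner .
  have "(\<integral>p. ?F p \<partial>lborel2) = (LBINT x. 2 * (LBINT y. ?G (x, y)))"
    unfolding F_int lborel_pair.integral_fst'[OF G, symmetric] by simp
  then show "(\<integral>p. ?F p \<partial>lborel2) = (LBINT x. \<phi> x * (LBINT h. (2 * w x - w (x + h) - w (x - h)) * \<kappa> h))"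
    unfolding inner .
qed

lemma kern_truncated_integrable:
  assumes s: "0 < s" "s < 1" and \<rho>: "\<rho> > 0"
  shows "integrable lborel (\<lambda>h::'a::euclidean_space. indicator {h. \<rho> < norm h} h * kern s h)"
proof -
  have "integrable lborel (\<lambda>h::'a. min 1 ((norm h)\<^sup>2) * kern s h)"
    using kern_finite[OF s, where 'a='a] by (simp add: integrable_iff_bounded kern_nonneg)
  then have "integrable lborel (\<lambda>h::'a. (1 / min 1 (\<rho>\<^sup>2)) * (min 1 ((norm h)\<^sup>2) * kern s h))" by simp
  then show ?thesis
  proof (rule Bochner_Integration.integrable_bound)
    show "AE h::'a in lborel. norm (indicator {h. \<rho> < norm h} h * kern s h)
      \<le> norm ((1 / min 1 (\<rho>\<^sup>2)) * (min 1 ((norm h)\<^sup>2) * kern s h))"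
    proof (rule AE_I2)
      fix h :: 'a
      show "norm (indicator {h. \<rho> < norm h} h * kern s h)
        \<le> norm ((1 / min 1 (\<rho>\<^sup>2)) * (min 1 ((norm h)\<^sup>2) * kern s h))"
      proof (cases "\<rho> < norm h")
        case True
        have pos: "min 1 (\<rho>\<^sup>2) > 0" using \<rho> by simp
        have "\<rho>\<^sup>2 \<le> (norm h)\<^sup>2" using True \<rho> by (intro power_mono) auto
        then have "min 1 (\<rho>\<^sup>2) \<le> min 1 ((norm h)\<^sup>2)" by auto
        then have "1 \<le> (1 / min 1 (\<rho>\<^sup>2)) * min 1 ((norm h)\<^sup>2)" using pos by (simp add: field_simps)
        then have "1 * kern s h \<le> (1 / min 1 (\<rho>\<^sup>2)) * min 1 ((norm h)\<^sup>2) * kern s h"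
          by (rule mult_right_mono) (rule kern_nonneg)
        then show ?thesis using True pos by (simp add: kern_nonneg mult.assoc)
      qed simp
    qed
  qed measurable
qed

context comparison
begin

lemma local_lower_bound:
  shows "integrable lborel (\<lambda>x. T x powr (- r) * \<phi> x)"
    and "(LBINT x. grad v x \<bullet> grad \<phi> x) \<ge> A * ((2 - \<sigma>) * (1 - \<sigma>)) * (LBINT x. T x powr (- \<sigma>) * \<phi> x)"
proof -
  \<comment> \<open>The weight is singular at T = 0, but \<phi> vanishes near that set, so the
    product is itself a test function.\<close>
  have pw: "integrable lborel (\<lambda>x. T x powr (- r) * \<phi> x)" for r
    using test_functions_integrable(1)[OF cut_test_functions[OF cut_mult[OF coeff.power[of "- r"]]]]
    by (simp add: mult.commute)
  then show "integrable lborel (\<lambda>x. T x powr (- r) * \<phi> x)" .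
  let ?F = "\<lambda>x. \<phi> x * (2 + (- (2 - \<sigma>)) * T x powr (1 - \<sigma>))"
  have "?F \<in> cut" by (intro cut_mult coeff.add coeff.mult coeff.const coeff.power)
  then have F: "?F \<in> test_functions \<Omega>" by (rule cut_test_functions)
  have i: "integrable lborel (\<lambda>x. grad ?F x \<bullet> e)"
    using grad_bounded_support[OF F]
    by (intro continuous_bounded_support(1) continuous_intros continuous_on_grad[OF F]) (auto elim!: bounded_subset)
  have j: "integrable lborel (\<lambda>x. grad v x \<bullet> grad \<phi> x)"
    using grad_bounded_support[OF v_test]
    by (intro continuous_bounded_support(1) continuous_intros continuous_on_grad[OF v_test] continuous_on_grad[OF \<phi>_test])
       (auto elim!: bounded_subset)
  have "(LBINT x. A * (grad ?F x \<bullet> e) + A * ((2 - \<sigma>) * (1 - \<sigma>)) * (T x powr (- \<sigma>) * \<phi> x))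
    \<le> (LBINT x. grad v x \<bullet> grad \<phi> x)"
  proof (rule integral_mono[OF _ j])
    show "integrable lborel (\<lambda>x. A * (grad ?F x \<bullet> e) + A * ((2 - \<sigma>) * (1 - \<sigma>)) * (T x powr (- \<sigma>) * \<phi> x))"
      using i pw[of \<sigma>] by (intro Bochner_Integration.integrable_add integrable_mult_right)
  qed (rule grad_v_inner_grad_\<phi>)
  moreover have "(LBINT x. A * (grad ?F x \<bullet> e) + A * ((2 - \<sigma>) * (1 - \<sigma>)) * (T x powr (- \<sigma>) * \<phi> x))
    = A * (LBINT x. grad ?F x \<bullet> e) + A * ((2 - \<sigma>) * (1 - \<sigma>)) * (LBINT x. T x powr (- \<sigma>) * \<phi> x)"
    using i pw[of \<sigma>] by (subst Bochner_Integration.integral_add) (auto simp del: mult_eq_0_iff)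
  ultimately show "(LBINT x. grad v x \<bullet> grad \<phi> x) \<ge> A * ((2 - \<sigma>) * (1 - \<sigma>)) * (LBINT x. T x powr (- \<sigma>) * \<phi> x)"
    using integral_grad_eq_0[OF F] by simp
qed

text \<open>Since |h . e| is at most |h|, the one-dimensional defect is dominated by a radial
  function, so the tail bound applies in every direction e. The truncation radius does not enter the
  bound.\<close>

lemma second_difference_integral:
  assumes \<rho>: "\<rho> > 0" and x: "T x > 0"
  shows "(LBINT h. (2 * (A * W (T x)) - A * W (T (x + h)) - A * W (T (x - h))) * (indicator {h. \<rho> < norm h} h * kern s h))
    \<ge> - (2 * A * C) * T x powr (- s)"
proof -
  let ?q = "\<lambda>h::'a. indicator {h. T x < norm h} h * min 1 (norm h) * kern s h"
  let ?\<kappa> = "\<lambda>h::'a. indicator {h. \<rho> < norm h} h * kern s h"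
  let ?D = "\<lambda>h. 2 * (A * W (T x)) - A * W (T (x + h)) - A * W (T (x - h))"
  have q0: "?q h \<ge> 0" for h by (simp add: kern_nonneg)
  have q: "integrable lborel ?q"
    using tail[OF x] by (auto simp: integrable_iff_bounded kern_nonneg abs_mult intro: le_less_trans)
  have "ennreal (LBINT h. ?q h) \<le> ennreal (C * T x powr (- s))"
    using tail[OF x] q0 by (subst nn_integral_eq_integral[OF q, symmetric]) auto
  then have qC: "(LBINT h. ?q h) \<le> C * T x powr (- s)" using C by (simp add: ennreal_le_iff)
  have Wb: "\<bar>A * W t\<bar> \<le> A * 2" for t using A W_nonneg[of t] W_le_2[of t] by (simp add: abs_mult)
  have D: "\<bar>?D h\<bar> \<le> 4 * (A * 2)" for h using Wb[of "T x"] Wb[of "T (x + h)"] Wb[of "T (x - h)"] by linarith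
  have int: "integrable lborel (\<lambda>h. ?\<kappa> h * ?D h)"
    by (rule integrable_mult_bounded[OF kern_truncated_integrable[OF s \<rho>] _ D]) measurable
  have "(LBINT h. - (2 * A) * ?q h) \<le> (LBINT h. ?\<kappa> h * ?D h)"
  proof (rule integral_mono)
    show "integrable lborel (\<lambda>h. - (2 * A) * ?q h)" using q by simp
    show "- (2 * A) * ?q h \<le> ?\<kappa> h * ?D h" for h
    proof -
      define \<eta> where "\<eta> = h \<bullet> e"
      have \<eta>: "\<bar>\<eta>\<bar> \<le> norm h" using Cauchy_Schwarz_ineq2[of h e] e by (simp add: \<eta>_def)
      have T: "T (x + h) = T x + \<eta>" "T (x - h) = T x - \<eta>"
        by (simp_all add: T_def \<eta>_def inner_diff_left inner_add_left)
      let ?r = "indicator {h. T x < norm h} h * min 1 (norm h)"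
      have "(if \<bar>\<eta>\<bar> > T x then min 1 \<bar>\<eta>\<bar> else 0) \<le> ?r" using \<eta> by (auto simp: indicator_def)
      then have "A * (- 2 * ?r) \<le> A * (2 * W (T x) - W (T x + \<eta>) - W (T x - \<eta>))"
        using W_second_difference[OF x, of \<eta>] A by (intro mult_left_mono) auto
      then have Dr: "- (2 * A) * ?r \<le> ?D h" unfolding T by (simp add: algebra_simps)
      have "?\<kappa> h * (- (2 * A) * ?r) \<le> ?\<kappa> h * ?D h"
        using Dr by (rule mult_left_mono) (simp add: kern_nonneg)
      moreover have "kern s h * (- (2 * A) * ?r) \<le> ?\<kappa> h * (- (2 * A) * ?r)"
        using A by (intro mult_right_mono_neg) (auto simp: indicator_def kern_nonneg mult_nonneg_nonneg)
      ultimately show ?thesis by (simp only: mult_ac)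
    qed
  qed (rule int)
  moreover have "(LBINT h. - (2 * A) * ?q h) = - (2 * A) * (LBINT h. ?q h)" by simp
  moreover have "- (2 * A) * (C * T x powr (- s)) \<le> - (2 * A) * (LBINT h. ?q h)"
    using A by (intro mult_left_mono_neg qC) auto
  ultimately have "- (2 * A) * (C * T x powr (- s)) \<le> (LBINT h. ?\<kappa> h * ?D h)" by linarith
  then show ?thesis by (simp add: mult_ac)
qed

text \<open>With a truncated kernel, monotonicity replaces v by the barrier and the second
  differences give a bound uniform in the truncation. Both v and \<phi> have finite energy, so
  dominated convergence restores the full kernel in the form of v; the form of the barrier itself
  never appears untruncated.\<close>

lemma nonlocal_lower_bound: "gform s v \<phi> \<ge> - (2 * A * C) * (LBINT x. T x powr (- s) * \<phi> x)"
proof -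
  note [measurable] = test_functions_measurable[OF v_test] test_functions_measurable[OF \<phi>_test]
  let ?w = "\<lambda>x. A * W (T x)"
  let ?F = "\<lambda>p. (v (fst p) - v (snd p)) * (\<phi> (fst p) - \<phi> (snd p)) * kern s (fst p - snd p)"
  let ?I = "\<lambda>m p. indicator {h::'a. 1 / real (Suc m) < norm h} (fst p - snd p) :: real"
  have fin: "\<exists>P\<ge>0. energy s f \<le> ennreal P" if f: "f \<in> test_functions \<Omega>" for f
  proof -
    have "(L2sq (\<lambda>x. norm (grad f x)) + 4 * L2sq f) * ennreal (kern_mass TYPE('a) s) < \<infinity>"
      using L2sq_eq_integral[OF test_functions_integrable(2)[OF f]]
        L2sq_eq_integral[OF test_functions_integrable(3)[OF f]] by (simp add: ennreal_mult_less_top)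
    then have "energy s f < \<infinity>" using energy_test_function_le[OF s f] by (rule le_less_trans[rotated])
    then show ?thesis by (intro exI[of _ "enn2real (energy s f)"]) auto
  qed
  obtain P1 P2 where "P1 \<ge> 0" "energy s v \<le> ennreal P1" "P2 \<ge> 0" "energy s \<phi> \<le> ennreal P2"
    using fin[OF v_test] fin[OF \<phi>_test] by blast
  then have F: "integrable lborel2 ?F" by (intro gform_bound(1)[of v \<phi> s P1 P2]) auto
  have lower: "- (2 * A * C) * (LBINT x. T x powr (- s) * \<phi> x) \<le> (\<integral>p. ?I m p * ?F p \<partial>lborel2)" for m
  proof -
    define \<rho> where "\<rho> = 1 / real (Suc m)"
    have \<rho>: "\<rho> > 0" by (simp add: \<rho>_def)
    let ?\<kappa> = "\<lambda>h::'a. indicator {h. \<rho> < norm h} h * kern s h"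
    have wB: "\<bar>?w x\<bar> \<le> A * 2" for x using A W_nonneg[of "T x"] W_le_2[of "T x"] by (simp add: abs_mult)
    have \<kappa>s: "?\<kappa> (- h) = ?\<kappa> h" for h by (simp add: kern_minus indicator_def)
    note tf = truncated_form[of ?w, OF _ wB test_functions_integrable(1)[OF \<phi>_test] kern_truncated_integrable[OF s \<rho>] \<kappa>s]
    let ?G = "\<lambda>p. (?w (fst p) - ?w (snd p)) * (\<phi> (fst p) - \<phi> (snd p)) * ?\<kappa> (fst p - snd p)"
    have "(LBINT x. (- (2 * A * C)) * (T x powr (- s) * \<phi> x))
      \<le> (LBINT x. \<phi> x * (LBINT h. (2 * ?w x - ?w (x + h) - ?w (x - h)) * ?\<kappa> h))"
    proof (rule integral_mono)
      show "integrable lborel (\<lambda>x. (- (2 * A * C)) * (T x powr (- s) * \<phi> x))"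
        using local_lower_bound(1)[of s] by simp
      show "integrable lborel (\<lambda>x. \<phi> x * (LBINT h. (2 * ?w x - ?w (x + h) - ?w (x - h)) * ?\<kappa> h))"
        by (rule tf(2)) measurable
      fix x
      show "(- (2 * A * C)) * (T x powr (- s) * \<phi> x) \<le> \<phi> x * (LBINT h. (2 * ?w x - ?w (x + h) - ?w (x - h)) * ?\<kappa> h)"
      proof (cases "\<phi> x = 0")
        case False
        then have "T x > 0" using \<phi>_nz V_pos_imp by blast
        from mult_left_mono[OF second_difference_integral[OF \<rho> this] \<phi>_nonneg[of x]]
        show ?thesis by (simp only: mult_ac)
      qed simp
    qed
    also have "\<dots> = (\<integral>p. ?G p \<partial>lborel2)" by (rule tf(3)[symmetric]) measurable
    also have "\<dots> \<le> (\<integral>p. ?I m p * ?F p \<partial>lborel2)"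
    proof (rule integral_mono)
      show "integrable lborel2 ?G" by (rule tf(1)) measurable
      show "integrable lborel2 (\<lambda>p. ?I m p * ?F p)"
      proof (rule Bochner_Integration.integrable_bound[OF F])
        show "AE p in lborel2. norm (?I m p * ?F p) \<le> norm (?F p)"
          by (intro AE_I2) (auto simp: indicator_def)
      qed measurable
      show "?G p \<le> ?I m p * ?F p" for p
      proof -
        obtain x y where p: "p = (x, y)" by (cases p)
        \<comment> \<open>Since f is increasing, V and \<phi> = f(V) change in the same
          direction.\<close>
        have "(V x - V y) * (\<phi> x - \<phi> y) \<ge> 0"
          using flat_mono[of "V x" "V y"] flat_mono[of "V y" "V x"] unfolding \<phi>_def
          by (cases "V x \<le> V y") (auto intro: mult_nonneg_nonneg mult_nonpos_nonpos)
        then have "(?w x - ?w y) * (\<phi> x - \<phi> y) \<le> (v x - v y) * (\<phi> x - \<phi> y)"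
          by (simp add: V_def algebra_simps)
        then have "(?w x - ?w y) * (\<phi> x - \<phi> y) * ?\<kappa> (x - y) \<le> (v x - v y) * (\<phi> x - \<phi> y) * ?\<kappa> (x - y)"
          by (rule mult_right_mono) (simp add: kern_nonneg)
        then show ?thesis by (simp add: p \<rho>_def mult_ac)
      qed
    qed
    finally show ?thesis by simp
  qed
  have "(\<lambda>m. \<integral>p. ?I m p * ?F p \<partial>lborel2) \<longlonglongrightarrow> (\<integral>p. ?F p \<partial>lborel2)"
  proof (rule integral_dominated_convergence[where w="\<lambda>p. norm (?F p)"])
    show "integrable lborel2 (\<lambda>p. norm (?F p))" using F by (rule integrable_norm)
    show "AE p in lborel2. norm (?I m p * ?F p) \<le> norm (?F p)" for m
      by (intro AE_I2) (auto simp: indicator_def)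
    show "AE p in lborel2. (\<lambda>m. ?I m p * ?F p) \<longlonglongrightarrow> ?F p"
    proof (intro AE_I2)
      fix p
      show "(\<lambda>m. ?I m p * ?F p) \<longlonglongrightarrow> ?F p"
      proof (cases "fst p = snd p")
        case False
        then have "norm (fst p - snd p) > 0" by simp
        then have "\<forall>\<^sub>F m in sequentially. 1 / real (Suc m) < norm (fst p - snd p)"
          using LIMSEQ_inverse_real_of_nat by (intro order_tendstoD(2)) (auto simp: inverse_eq_divide)
        then have "\<forall>\<^sub>F m in sequentially. ?I m p * ?F p = ?F p" by eventually_elim simp
        then show ?thesis by (rule tendsto_eventually)
      qed simp
    qed
  qed measurable
  then show ?thesis unfolding gform_def
    by (rule tendsto_lowerbound) (use lower in auto)
qed

end

subsection \<open>Comparison with the barrier\<close>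

lemma L2sq_leD:
  assumes [measurable]: "f \<in> borel_measurable borel" and le: "L2sq f \<le> ennreal a" and a: "a \<ge> 0"
  shows "integrable lborel (\<lambda>x. (f x)\<^sup>2)" "(LBINT x. (f x)\<^sup>2) \<le> a"
proof -
  have "L2sq f < \<infinity>" using le by (rule le_less_trans) simp
  then show i: "integrable lborel (\<lambda>x. (f x)\<^sup>2)" using L2sq_finite_iff assms(1) by blast
  then show "(LBINT x. (f x)\<^sup>2) \<le> a"
    using le a by (simp add: L2sq_eq_integral ennreal_le_iff)
qed

lemma gform_diff:
  fixes u v \<phi> :: "'a::euclidean_space \<Rightarrow> real"
  assumes "integrable lborel2 (gform_integrand u \<phi> (kern s))"
    and "integrable lborel2 (gform_integrand v \<phi> (kern s))"
  shows "gform s (\<lambda>x. u x - v x) \<phi> = gform s u \<phi> - gform s v \<phi>"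
proof -
  have "((u (fst p) - v (fst p)) - (u (snd p) - v (snd p))) * (\<phi> (fst p) - \<phi> (snd p)) * kern s (fst p - snd p) =
    (u (fst p) - u (snd p)) * (\<phi> (fst p) - \<phi> (snd p)) * kern s (fst p - snd p) -
    (v (fst p) - v (snd p)) * (\<phi> (fst p) - \<phi> (snd p)) * kern s (fst p - snd p)" for p
    by (simp add: algebra_simps)
  then show ?thesis unfolding gform_def using assms by (simp only: Bochner_Integration.integral_diff)
qed

lemma nonpos_of_le_small_multiples:
  assumes "\<And>\<epsilon>. 0 < \<epsilon> \<Longrightarrow> \<epsilon> \<le> 1 \<Longrightarrow> I \<le> \<epsilon> * M"
  shows "I \<le> (0::real)"
proof (rule tendsto_lowerbound)
  show "((\<lambda>\<epsilon>. \<epsilon> * M) \<longlongrightarrow> 0) (at_right 0)" by (auto intro!: tendsto_eq_intros)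
  have "\<forall>\<^sub>F \<epsilon> in at_right (0::real). \<epsilon> < 1" by (rule order_tendstoD(2)[OF tendsto_ident_at]) simp
  moreover have "\<forall>\<^sub>F \<epsilon> in at_right (0::real). \<epsilon> > 0" by (rule eventually_at_right_less)
  ultimately show "\<forall>\<^sub>F \<epsilon> in at_right 0. I \<le> \<epsilon> * M"
    by eventually_elim (simp add: assms)
qed simp

text \<open>The coefficient c A C in \<open>super\<close> is c/2 times the constant 2 A C of the
  nonlocal bound. Asking for 2K there, against the K in \<open>subsol\<close>, leaves a spare K that
  controls the integral of the test function.\<close>

locale subsolution = weak_gradient_zero_outside \<Omega> u g K + barrier_params \<sigma> \<delta> + kernel_tail "TYPE('a)" s C
  for \<Omega> :: "'a::euclidean_space set" and u g K \<sigma> \<delta> s C +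
  fixes c A :: real and p e :: 'a
  assumes c: "c \<ge> 0" and K: "K > 0"
    and subsol: "\<And>\<phi>. \<phi> \<in> test_functions \<Omega> \<Longrightarrow> (\<And>x. \<phi> x \<ge> 0) \<Longrightarrow>
      (LBINT x. g x \<bullet> grad \<phi> x) + c / 2 * gform s u \<phi> \<le> K * (LBINT x. \<phi> x)"
    and half: "\<And>x. x \<in> \<Omega> \<Longrightarrow> (x - p) \<bullet> e > 0" "norm e = 1"
    and A: "A > 0" "K \<le> A * (\<delta> / 2)"
    and super: "\<And>t. 0 < t \<Longrightarrow> t < \<delta> \<Longrightarrow> 2 * K \<le> A * ((2 - \<sigma>) * (1 - \<sigma>)) * t powr (- \<sigma>) - c * A * C * t powr (- s)"
begin

definition vol :: real where "vol = measure lborel \<Omega>"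

lemma indicator_integral: "(LBINT x. indicator \<Omega> x) = vol"
  by (simp add: vol_def)

text \<open>The factor of \<epsilon> on the right involves neither \<epsilon> nor the approximation
  v. It is linear in \<epsilon> because v is chosen with squared errors \<epsilon>^2 and all
  products are split by Young's inequality with weight \<epsilon>.\<close>

lemma comparison_step:
  assumes \<epsilon>: "0 < \<epsilon>" "\<epsilon> \<le> 1"
  defines "B \<equiv> (LBINT x. (norm (g x))\<^sup>2)"
  defines "G \<equiv> 8 * (2 * B + 2) + 32 * A\<^sup>2 * vol"
  defines "k \<equiv> kern_mass TYPE('a) s"
  shows "(LBINT x. flat 0 (u x - A * W ((x - p) \<bullet> e))) \<le>
    \<epsilon> * ((1 + G + c / 2 * (8 * k + (G + 4 * vol) * k)) / K + 2 * (1 + vol))"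
proof -
  have e2: "\<epsilon>\<^sup>2 > 0" "\<epsilon>\<^sup>2 \<le> 1" using \<epsilon> by (auto simp: power_le_one)
  have B0: "B \<ge> 0" by (simp add: B_def)
  have vol0: "vol \<ge> 0" by (simp add: vol_def)
  have k0: "k \<ge> 0" by (simp add: k_def kern_mass_def)
  have G0: "G \<ge> 0" using B0 vol0 by (simp add: G_def)
  obtain v where v: "v \<in> test_functions \<Omega>" "\<And>x. v x \<le> K"
    and err: "L2sq (\<lambda>x. u x - v x) \<le> ennreal (\<epsilon>\<^sup>2)" "L2sq (\<lambda>x. norm (g x - grad v x)) \<le> ennreal (\<epsilon>\<^sup>2)"
    using approximation[OF e2(1)] by blast
  interpret comparison \<sigma> \<delta> s C \<Omega> v p e A K
    by unfold_locales (use half v A in auto)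
  note [measurable] = test_functions_measurable[OF v(1)] test_functions_measurable[OF \<phi>_test]
    grad_measurable[OF v(1)] grad_measurable[OF \<phi>_test]
  have v_outside: "v x = 0" if "x \<notin> \<Omega>" for x
    using subsetD[OF test_functions_support[OF v(1)] subsetD[OF closure_subset], of x] that by auto
  have \<phi>_outside: "\<phi> x = 0" if "x \<notin> \<Omega>" for x
    using \<phi>_nz[of x] V_pos_imp(2)[of x] that by blast
  have \<phi>_le_1: "\<phi> x \<le> 1" for x by (simp add: \<phi>_def flat_0_le_1)
  note int_\<phi> = test_functions_integrable(1)[OF \<phi>_test]

  have \<phi>_sq: "L2sq \<phi> \<le> ennreal vol"
  proof -
    have "L2sq \<phi> \<le> (\<integral>\<^sup>+x. ennreal (indicator \<Omega> x) \<partial>lborel)"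
      unfolding L2sq_def
    proof (intro nn_integral_mono ennreal_leI)
      show "(\<phi> x)\<^sup>2 \<le> indicator \<Omega> x" for x
        using \<phi>_outside[of x] \<phi>_le_1[of x] \<phi>_nonneg[of x] by (cases "x \<in> \<Omega>") (auto simp: power_le_one)
    qed
    also have "\<dots> = ennreal (LBINT x. indicator \<Omega> x)"
      by (rule nn_integral_eq_integral[OF integrable_indicator_\<Omega>]) simp
    finally show ?thesis by (simp only: indicator_integral)
  qed
  \<comment> \<open>Here \<epsilon> <= 1 is used, which makes the gradient bounds for v and hence
    for \<phi> independent of \<epsilon>.\<close>
  have gv: "L2sq (\<lambda>x. norm (grad v x)) \<le> ennreal (2 * B + 2)"
  proof -
    have "L2sq (\<lambda>x. norm (grad v x)) \<le> L2sq (\<lambda>x. norm (g x) + norm (g x - grad v x))"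
      unfolding L2sq_def
    proof (intro nn_integral_mono ennreal_leI power_mono)
      show "norm (grad v x) \<le> norm (g x) + norm (g x - grad v x)" for x
        using norm_triangle_sub[of "grad v x" "g x"] by (simp add: norm_minus_commute)
    qed simp
    also have "\<dots> \<le> 2 * L2sq (\<lambda>x. norm (g x)) + 2 * L2sq (\<lambda>x. norm (g x - grad v x))"
      by (rule L2sq_add) measurable
    also have "\<dots> \<le> 2 * ennreal B + 2 * ennreal 1"
    proof (intro add_mono mult_left_mono)
      show "L2sq (\<lambda>x. norm (g x)) \<le> ennreal B" using L2sq_eq_integral[OF g_L2] by (simp add: B_def)
      show "L2sq (\<lambda>x. norm (g x - grad v x)) \<le> ennreal 1"
        using err(2) e2(2) ennreal_leI order_trans by blast
    qed auto
    also have "\<dots> = ennreal (2 * B + 2)" using B0 by (simp add: numeral_mult_ennreal ennreal_plus)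
    finally show ?thesis .
  qed
  have g\<phi>: "L2sq (\<lambda>x. norm (grad \<phi> x)) \<le> ennreal G"
  proof -
    have "L2sq (\<lambda>x. norm (grad \<phi> x)) \<le> L2sq (\<lambda>x. 2 * norm (grad v x) + 4 * A * indicator \<Omega> x)"
      unfolding L2sq_def by (intro nn_integral_mono ennreal_leI power_mono norm_grad_\<phi>_le) simp
    also have "\<dots> \<le> 2 * L2sq (\<lambda>x. 2 * norm (grad v x)) + 2 * L2sq (\<lambda>x. 4 * A * indicator \<Omega> x)"
      by (rule L2sq_add) measurable
    also have "L2sq (\<lambda>x. 2 * norm (grad v x)) = ennreal 4 * L2sq (\<lambda>x. norm (grad v x))"
      by (subst L2sq_cmult) auto
    also have "L2sq (\<lambda>x. 4 * A * indicator \<Omega> x) = ennreal (16 * A\<^sup>2) * ennreal vol"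
    proof -
      have sq: "(\<lambda>x. (indicator \<Omega> x)\<^sup>2) = (indicator \<Omega> :: 'a \<Rightarrow> real)" by (auto simp: indicator_def)
      have "L2sq (indicator \<Omega> :: 'a \<Rightarrow> real) = ennreal vol"
        using L2sq_eq_integral[of "indicator \<Omega> :: 'a \<Rightarrow> real"] integrable_indicator_\<Omega>
        by (simp only: sq indicator_integral)
      then show ?thesis by (subst L2sq_cmult) (auto simp: power_mult_distrib)
    qed
    also have "2 * (ennreal 4 * L2sq (\<lambda>x. norm (grad v x))) + 2 * (ennreal (16 * A\<^sup>2) * ennreal vol) \<le>
      2 * (ennreal 4 * ennreal (2 * B + 2)) + 2 * (ennreal (16 * A\<^sup>2) * ennreal vol)"
      by (intro add_mono mult_left_mono gv) auto
    also have "\<dots> = ennreal (2 * (4 * (2 * B + 2)) + 2 * (16 * A\<^sup>2 * vol))"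
      using B0 vol0 by (simp add: numeral_mult_ennreal flip: ennreal_mult ennreal_plus)
    also have "2 * (4 * (2 * B + 2)) + 2 * (16 * A\<^sup>2 * vol) = G" by (simp add: G_def)
    finally show ?thesis .
  qed

  have energy_\<phi>: "energy s \<phi> \<le> ennreal ((G + 4 * vol) * k)"
  proof -
    have "energy s \<phi> \<le> (L2sq (\<lambda>x. norm (grad \<phi> x)) + 4 * L2sq \<phi>) * ennreal k"
      unfolding k_def by (rule energy_test_function_le[OF s \<phi>_test])
    also have "\<dots> \<le> (ennreal G + 4 * ennreal vol) * ennreal k"
      by (intro mult_right_mono add_mono mult_left_mono g\<phi> \<phi>_sq) auto
    also have "\<dots> = ennreal ((G + 4 * vol) * k)"
      using G0 vol0 k0 by (simp add: numeral_mult_ennreal flip: ennreal_mult ennreal_plus)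
    finally show ?thesis .
  qed
  have energy_d: "energy s (\<lambda>x. u x - v x) \<le> ennreal (8 * k * \<epsilon>\<^sup>2)"
  proof -
    have "energy s (\<lambda>x. u x - v x) \<le>
      (4 * L2sq (\<lambda>x. norm (g x - grad v x)) + 4 * L2sq (\<lambda>x. u x - v x)) * ennreal k"
      unfolding k_def by (rule energy_diff_le[OF s v(1)])
    also have "\<dots> \<le> (4 * ennreal (\<epsilon>\<^sup>2) + 4 * ennreal (\<epsilon>\<^sup>2)) * ennreal k"
      by (intro mult_right_mono add_mono mult_left_mono err) auto
    also have "\<dots> = ennreal ((4 * \<epsilon>\<^sup>2 + 4 * \<epsilon>\<^sup>2) * k)"
      using k0 by (simp add: numeral_mult_ennreal flip: ennreal_mult ennreal_plus)
    also have "(4 * \<epsilon>\<^sup>2 + 4 * \<epsilon>\<^sup>2) * k = 8 * k * \<epsilon>\<^sup>2" by simp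
    finally show ?thesis .
  qed
  have P0: "(G + 4 * vol) * k \<ge> 0" "8 * k * \<epsilon>\<^sup>2 \<ge> 0" using G0 vol0 k0 by simp_all
  have "\<bar>gform s (\<lambda>x. u x - v x) \<phi>\<bar> \<le> 8 * k * \<epsilon>\<^sup>2 / \<epsilon> + \<epsilon> * ((G + 4 * vol) * k)"
    by (rule gform_bound(2)[OF _ _ energy_d energy_\<phi> P0(2,1) \<epsilon>(1)]) measurable
  also have "\<dots> = \<epsilon> * (8 * k + (G + 4 * vol) * k)"
    using \<epsilon> by (simp add: power2_eq_square algebra_simps)
  finally have gform_d: "\<bar>gform s (\<lambda>x. u x - v x) \<phi>\<bar> \<le> \<epsilon> * (8 * k + (G + 4 * vol) * k)" .
  have gform_eq: "gform s u \<phi> = gform s v \<phi> + gform s (\<lambda>x. u x - v x) \<phi>"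
  proof -
    have U: "energy s u \<le> ennreal (enn2real (energy s u))" using energy_finite[OF s] by simp
    have iu: "integrable lborel2 (gform_integrand u \<phi> (kern s))"
      by (rule gform_bound(1)[OF _ _ U energy_\<phi> _ P0(1)]) auto
    have "integrable lborel2 (gform_integrand (\<lambda>x. u x - v x) \<phi> (kern s))"
      by (rule gform_bound(1)[OF _ _ energy_d energy_\<phi> P0(2,1)]) measurable
    from gform_diff[OF iu this] show ?thesis by simp
  qed

  have i1: "integrable lborel (\<lambda>x. (norm (g x - grad v x))\<^sup>2)" "(LBINT x. (norm (g x - grad v x))\<^sup>2) \<le> \<epsilon>\<^sup>2"
    using L2sq_leD[OF _ err(2)] by auto
  have i2: "integrable lborel (\<lambda>x. (norm (grad \<phi> x))\<^sup>2)" "(LBINT x. (norm (grad \<phi> x))\<^sup>2) \<le> G"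
    using L2sq_leD[OF _ g\<phi> G0] by auto
  have int_prod: "integrable lborel (\<lambda>x. norm (f x) * norm (grad \<phi> x)) \<and> integrable lborel (\<lambda>x. f x \<bullet> grad \<phi> x)"
    if [measurable]: "f \<in> borel_measurable borel" and "integrable lborel (\<lambda>x. (norm (f x))\<^sup>2)" for f :: "'a \<Rightarrow> 'a"
  proof -
    have i: "integrable lborel (\<lambda>x. norm (f x) * norm (grad \<phi> x))"
      using that i2(1) by (intro integrable_mult_L2) auto
    moreover have "integrable lborel (\<lambda>x. f x \<bullet> grad \<phi> x)"
      by (rule Bochner_Integration.integrable_bound[OF i]) (auto simp: Cauchy_Schwarz_ineq2 abs_mult)
    ultimately show ?thesis by blast
  qed
  have ig: "integrable lborel (\<lambda>x. g x \<bullet> grad \<phi> x)" using int_prod[OF g_measurable g_L2] by blast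
  have iv: "integrable lborel (\<lambda>x. grad v x \<bullet> grad \<phi> x)"
    using int_prod[OF grad_measurable[OF v(1)] test_functions_integrable(3)[OF v(1)]] by blast
  have "\<bar>\<integral>x. (g x - grad v x) \<bullet> grad \<phi> x \<partial>lborel\<bar> \<le> (LBINT x. norm (g x - grad v x) * norm (grad \<phi> x))"
    using int_prod[OF _ i1(1)] by (intro integral_abs_bound_integral) (auto simp: Cauchy_Schwarz_ineq2)
  also have "\<dots> \<le> \<bar>\<dots>\<bar>" by simp
  also have "\<dots> \<le> (LBINT x. (norm (g x - grad v x))\<^sup>2) / \<epsilon> + \<epsilon> * (LBINT x. (norm (grad \<phi> x))\<^sup>2)"
    by (rule integral_mult_le[OF _ _ i1(1) i2(1) \<epsilon>(1)]) measurable
  also have "\<dots> \<le> \<epsilon>\<^sup>2 / \<epsilon> + \<epsilon> * G"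
    using \<epsilon> i1 i2 by (intro add_mono divide_right_mono mult_left_mono) auto
  also have "\<dots> = \<epsilon> * (1 + G)" using \<epsilon> by (simp add: power2_eq_square algebra_simps)
  finally have local_d: "\<bar>\<integral>x. (g x - grad v x) \<bullet> grad \<phi> x \<partial>lborel\<bar> \<le> \<epsilon> * (1 + G)" .
  have local_eq: "(LBINT x. g x \<bullet> grad \<phi> x) = (LBINT x. grad v x \<bullet> grad \<phi> x) + (LBINT x. (g x - grad v x) \<bullet> grad \<phi> x)"
    using ig iv by (simp add: inner_diff_left)

  \<comment> \<open>Where \<phi> is non-zero, T lies in the range of \<open>super\<close>, which is
    multiplied by \<phi> and integrated. The local and nonlocal lower bounds then identify the
    result as at most the form of v.\<close>
  have "2 * K * (LBINT x. \<phi> x) \<le>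
    (LBINT x. grad v x \<bullet> grad \<phi> x) + c / 2 * gform s v \<phi>"
  proof -
    let ?\<kappa> = "(2 - \<sigma>) * (1 - \<sigma>)"
    have "(LBINT x. 2 * K * \<phi> x) \<le>
      (LBINT x. A * ?\<kappa> * (T x powr (- \<sigma>) * \<phi> x) - c * A * C * (T x powr (- s) * \<phi> x))"
    proof (rule integral_mono)
      show "integrable lborel (\<lambda>x. 2 * K * \<phi> x)" using int_\<phi> by simp
      show "integrable lborel (\<lambda>x. A * ?\<kappa> * (T x powr (- \<sigma>) * \<phi> x) - c * A * C * (T x powr (- s) * \<phi> x))"
        by (intro Bochner_Integration.integrable_diff integrable_mult_right local_lower_bound(1))
      show "2 * K * \<phi> x \<le> A * ?\<kappa> * (T x powr (- \<sigma>) * \<phi> x) - c * A * C * (T x powr (- s) * \<phi> x)" for x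
      proof (cases "\<phi> x = 0")
        case False
        have t: "0 < T x" "T x < \<delta>" using V_pos_imp(3,4)[OF \<phi>_nz[OF False]] \<delta> by linarith+
        show ?thesis using mult_right_mono[OF super[OF t] \<phi>_nonneg[of x]] by (simp add: algebra_simps)
      qed simp
    qed
    also have "\<dots> = A * ?\<kappa> * (LBINT x. T x powr (- \<sigma>) * \<phi> x) - c * A * C * (LBINT x. T x powr (- s) * \<phi> x)"
      by (subst Bochner_Integration.integral_diff)
         (intro integrable_mult_right local_lower_bound(1), intro integrable_mult_right local_lower_bound(1),
          simp only: integral_mult_right_zero)
    also have "\<dots> = A * ?\<kappa> * (LBINT x. T x powr (- \<sigma>) * \<phi> x) +
      c / 2 * (- (2 * A * C) * (LBINT x. T x powr (- s) * \<phi> x))" by simp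
    also have "\<dots> \<le> (LBINT x. grad v x \<bullet> grad \<phi> x) + c / 2 * gform s v \<phi>"
      using c by (intro add_mono local_lower_bound(2) mult_left_mono nonlocal_lower_bound) auto
    finally show ?thesis by simp
  qed
  moreover have "(LBINT x. g x \<bullet> grad \<phi> x) + c / 2 * gform s u \<phi> \<le> K * (LBINT x. \<phi> x)"
    by (rule subsol[OF \<phi>_test \<phi>_nonneg])
  moreover have "c / 2 * \<bar>gform s (\<lambda>x. u x - v x) \<phi>\<bar> \<le> c / 2 * (\<epsilon> * (8 * k + (G + 4 * vol) * k))"
    using c by (intro mult_left_mono gform_d) auto
  moreover have "c / 2 * gform s (\<lambda>x. u x - v x) \<phi> \<ge> - (c / 2 * \<bar>gform s (\<lambda>x. u x - v x) \<phi>\<bar>)"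
    using c mult_left_mono[of "- \<bar>gform s (\<lambda>x. u x - v x) \<phi>\<bar>" "gform s (\<lambda>x. u x - v x) \<phi>" "c / 2"] by simp
  moreover have "c / 2 * gform s u \<phi> = c / 2 * gform s v \<phi> + c / 2 * gform s (\<lambda>x. u x - v x) \<phi>"
    unfolding gform_eq by (rule distrib_left)
  \<comment> \<open>The form of v is at least twice K times the integral of \<phi>, that of u at
    most once, and they differ by O(\<epsilon>). Hence the remaining multiple is
    O(\<epsilon>).\<close>
  ultimately have "K * (LBINT x. \<phi> x) \<le> \<epsilon> * (1 + G) + c / 2 * (\<epsilon> * (8 * k + (G + 4 * vol) * k))"
    using local_eq local_d by linarith
  also have "\<dots> = \<epsilon> * (1 + G + c / 2 * (8 * k + (G + 4 * vol) * k))" by (simp add: algebra_simps)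
  finally have \<phi>_small: "(LBINT x. \<phi> x) \<le> \<epsilon> * ((1 + G + c / 2 * (8 * k + (G + 4 * vol) * k)) / K)"
    using K by (simp add: field_simps)

  have id: "integrable lborel (\<lambda>x. (u x - v x)\<^sup>2)" "(LBINT x. (u x - v x)\<^sup>2) \<le> \<epsilon>\<^sup>2"
    using L2sq_leD[OF _ err(1)] by auto
  let ?d = "\<lambda>x. \<bar>u x - v x\<bar> * indicator \<Omega> x"
  have sqi: "(\<lambda>x. (indicator \<Omega> x)\<^sup>2) = (indicator \<Omega> :: 'a \<Rightarrow> real)" by (auto simp: indicator_def)
  have ii: "integrable lborel (\<lambda>x. (indicator \<Omega> x :: real)\<^sup>2)" unfolding sqi by (rule integrable_indicator_\<Omega>)
  have idi: "integrable lborel ?d"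
    by (rule integrable_mult_L2) (use id(1) ii in auto)
  have "(LBINT x. ?d x) \<le> \<bar>\<integral>x. ?d x \<partial>lborel\<bar>" by simp
  also have "\<dots> \<le> (LBINT x. \<bar>u x - v x\<bar>\<^sup>2) / \<epsilon> + \<epsilon> * (LBINT x. (indicator \<Omega> x)\<^sup>2)"
    by (rule integral_mult_le[OF _ _ _ ii \<epsilon>(1)]) (use id(1) in auto)
  also have "\<dots> \<le> \<epsilon>\<^sup>2 / \<epsilon> + \<epsilon> * vol"
    unfolding sqi indicator_integral using \<epsilon> id(2) by (intro add_mono divide_right_mono) auto
  also have "\<dots> = \<epsilon> * (1 + vol)" using \<epsilon> by (simp add: power2_eq_square algebra_simps)
  finally have d_small: "(LBINT x. ?d x) \<le> \<epsilon> * (1 + vol)" .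

  \<comment> \<open>Return from v to u: f has Lipschitz constant 2, and on the bounded set \<Omega>
    the L^1 distance of u and v is O(\<epsilon>). Outside \<Omega> the integrand is 0.\<close>
  let ?f = "\<lambda>x. flat 0 (u x - A * W (T x))"
  have "(LBINT x. ?f x) \<le> (LBINT x. \<phi> x + 2 * ?d x)"
  proof (rule integral_mono_AE')
    show "integrable lborel (\<lambda>x. \<phi> x + 2 * ?d x)" using int_\<phi> idi by simp
    show "AE x in lborel. ?f x \<le> \<phi> x + 2 * ?d x"
    proof (rule AE_I2)
      fix x
      show "?f x \<le> \<phi> x + 2 * ?d x"
      proof (cases "x \<in> \<Omega>")
        case True
        have "\<bar>?f x - \<phi> x\<bar> \<le> 2 * \<bar>u x - v x\<bar>"
          using flat_lipschitz[of "u x - A * W (T x)" "V x"] by (simp add: \<phi>_def V_def)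
        then have "?f x \<le> \<phi> x + 2 * \<bar>u x - v x\<bar>" by linarith
        then show ?thesis using True by simp
      next
        case False
        have "0 \<le> A * W (T x)" using A W_nonneg by simp
        then have "?f x = 0" using u_outside[OF False] by (simp add: flat_eq_0)
        then show ?thesis using \<phi>_nonneg[of x] by simp
      qed
    qed
    show "AE x in lborel. 0 \<le> \<phi> x + 2 * ?d x" using \<phi>_nonneg by simp
  qed
  also have "\<dots> = (LBINT x. \<phi> x) + 2 * (LBINT x. ?d x)" using int_\<phi> idi by simp
  also have "\<dots> \<le> \<epsilon> * ((1 + G + c / 2 * (8 * k + (G + 4 * vol) * k)) / K) + 2 * (\<epsilon> * (1 + vol))"
    by (intro add_mono mult_left_mono \<phi>_small d_small) simp
  finally show ?thesis by (simp add: T_def algebra_simps)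
qed

text \<open>The integral of f(u - A W) is below every small multiple of a fixed constant, hence 0;
  and f vanishes only on non-positive arguments.\<close>

theorem comparison_principle: "AE x in lborel. u x \<le> A * W ((x - p) \<bullet> e)"
proof -
  let ?f = "\<lambda>x. flat 0 (u x - A * W ((x - p) \<bullet> e))"
  have flat_measurable [measurable]: "flat 0 \<in> borel_measurable borel"
    unfolding flat_def by measurable
  have "(LBINT x. ?f x) \<le> 0"
    using comparison_step by (rule nonpos_of_le_small_multiples)
  moreover have "(LBINT x. ?f x) \<ge> 0"
    by (rule integral_nonneg_AE) (simp add: flat_nonneg)
  moreover have "integrable lborel ?f"
  proof (rule Bochner_Integration.integrable_bound[OF integrable_indicator_\<Omega>])
    show "AE x in lborel. norm (?f x) \<le> norm (indicator \<Omega> x :: real)"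
    proof (rule AE_I2)
      fix x
      show "norm (?f x) \<le> norm (indicator \<Omega> x :: real)"
      proof (cases "x \<in> \<Omega>")
        case True
        then show ?thesis by (simp add: flat_nonneg flat_0_le_1)
      next
        case False
        have "0 \<le> A * W ((x - p) \<bullet> e)" using A W_nonneg by simp
        then show ?thesis using u_outside[OF False] by (simp add: flat_eq_0)
      qed
    qed
  qed measurable
  ultimately have "AE x in lborel. ?f x = 0"
    using integral_nonneg_eq_0_iff_AE[of lborel ?f] by (simp add: flat_nonneg)
  then show ?thesis
  proof eventually_elim
    case (elim x)
    then show ?case using flat_pos_iff[of 0 "u x - A * W ((x - p) \<bullet> e)"] by auto
  qed
qed

end

subsection \<open>Reduction to Borel representatives\<close>

lemma integral_lebesgue_AE_borel:
  fixes f g :: "'a::euclidean_space \<Rightarrow> real"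
  assumes [measurable]: "g \<in> borel_measurable borel" and ae: "AE x in lborel. f x = g x"
  shows "integral\<^sup>L lebesgue f = integral\<^sup>L lborel g"
proof -
  have g: "g \<in> borel_measurable lebesgue" by (rule measurable_completion) simp
  have ae': "AE x in lebesgue. g x = f x" using AE_completion[OF ae] by eventually_elim simp
  have f: "f \<in> borel_measurable lebesgue" by (rule borel_measurable_AE[OF g ae'])
  have "integral\<^sup>L lebesgue f = integral\<^sup>L lebesgue g"
    using ae' by (intro integral_cong_AE f g) (auto elim: eventually_mono)
  also have "\<dots> = integral\<^sup>L lborel g" by (rule integral_completion) simp
  finally show ?thesis .
qed

text \<open>A null set in one variable is null in the product. This lets the representative of u be
  exchanged inside the double integral.\<close>

lemma AE_lborel_pair:
  assumes "AE x in lborel. P (x::'a::euclidean_space)"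
  shows "AE p in lborel. P (fst p) \<and> P (snd p :: 'a)"
proof -
  obtain N where N: "{x\<in>space lborel. \<not> P x} \<subseteq> N" "emeasure lborel N = 0" "N \<in> sets lborel"
    using AE_E[OF assms] by blast
  have "N \<times> UNIV \<in> null_sets lborel2" "UNIV \<times> N \<in> null_sets lborel2"
    using N(2,3) by (auto intro!: null_setsI simp: lborel.emeasure_pair_measure_Times)
  then have "AE p in lborel2. p \<notin> N \<times> UNIV \<and> p \<notin> UNIV \<times> N"
    by (intro AE_conjI AE_not_in)
  then have "AE p in lborel2. P (fst p) \<and> P (snd p)"
    by eventually_elim (use N(1) in \<open>force simp: mem_Times_iff\<close>)
  then show ?thesis by (simp only: lborel_prod)
qed

lemma borel_representative_vector:
  fixes g :: "'a::euclidean_space \<Rightarrow> 'b::euclidean_space"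
  assumes [measurable]: "g \<in> borel_measurable lebesgue"
  shows "\<exists>g'\<in>borel_measurable borel. AE x in lborel. g x = g' x"
proof -
  have "\<exists>h\<in>borel_measurable lborel. AE x in lborel. g x \<bullet> b = h x" for b
    by (rule completion_ex_borel_measurable_real) measurable
  then have "\<forall>b. \<exists>h. h \<in> borel_measurable borel \<and> (AE x in lborel. g x \<bullet> b = h x)" by auto
  from choice[OF this] obtain h
    where h: "\<And>b. h b \<in> borel_measurable borel" "\<And>b. AE x in lborel. g x \<bullet> b = h b x"
    by blast
  have "AE x in lborel. \<forall>b\<in>Basis. g x \<bullet> b = h b x"
    using h(2) by (intro AE_finite_allI) auto
  then have "AE x in lborel. g x = (\<Sum>b\<in>Basis. h b x *\<^sub>R b)"
  proof eventually_elim
    case (elim x)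
    then show ?case using euclidean_representation[of "g x"] by simp
  qed
  moreover have "(\<lambda>x. \<Sum>b\<in>Basis. h b x *\<^sub>R b) \<in> borel_measurable borel"
    using h(1) by measurable
  ultimately show ?thesis by (intro bexI[of _ "\<lambda>x. \<Sum>b\<in>Basis. h b x *\<^sub>R b"])
qed

text \<open>Separation gives a weak inequality; it is strict because an open subset of a closed half
  space lies in its interior.\<close>

lemma supporting_half_space:
  fixes \<Omega> :: "'a::euclidean_space set"
  assumes "open \<Omega>" "convex \<Omega>" "\<Omega> \<noteq> {}" "p \<notin> \<Omega>"
  shows "\<exists>e. norm e = 1 \<and> (\<forall>x\<in>\<Omega>. (x - p) \<bullet> e > 0)"
proof -
  obtain a b where ab: "a \<noteq> 0" "\<forall>x\<in>{p}. a \<bullet> x \<le> b" "\<forall>x\<in>\<Omega>. a \<bullet> x \<ge> b"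
    using separating_hyperplane_sets[of "{p}" \<Omega>] assms by auto
  have "\<Omega> \<subseteq> interior {x. a \<bullet> x \<ge> b}" using ab(3) assms(1) by (intro interior_maximal) auto
  then have *: "a \<bullet> x > b" if "x \<in> \<Omega>" for x using that ab(1) by (auto simp: interior_halfspace_ge)
  have "(x - p) \<bullet> ((1 / norm a) *\<^sub>R a) > 0" if "x \<in> \<Omega>" for x
  proof -
    have "(x - p) \<bullet> a > 0" using *[OF that] ab(2) by (simp add: inner_commute[of _ a] inner_diff_right)
    then show ?thesis using ab(1) by simp
  qed
  moreover have "norm ((1 / norm a) *\<^sub>R a) = 1" using ab(1) by simp
  ultimately show ?thesis by blast
qed

lemma strictly_convex_imp_convex:
  assumes "open S" "strictly_convex S"
  shows "convex S"
  unfolding convex_contains_open_segment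
proof (intro ballI)
  fix x y assume "x \<in> S" "y \<in> S"
  then have "open_segment x y \<subseteq> interior S"
    using assms(2) closure_subset[of S] unfolding strictly_convex_def by blast
  then show "open_segment x y \<subseteq> S" using interior_subset by blast
qed

text \<open>For t up to q the stronger singularity gives
  \<open>\<kappa> * t powr (- \<sigma>) \<ge> (M + 1) * t powr (- s)\<close>. The extra copy of
  t^(-s) is at least 1 for t < 1, and M + 1 also avoids division by 0.\<close>

lemma exists_barrier_width:
  fixes s \<sigma> \<kappa> M :: real
  assumes "0 < s" "s < \<sigma>" "\<kappa> > 0" "M \<ge> 0"
  shows "\<exists>\<delta>>0. \<delta> \<le> 1 \<and> (\<forall>t. 0 < t \<longrightarrow> t < \<delta> \<longrightarrow> 1 \<le> \<kappa> * t powr (- \<sigma>) - M * t powr (- s))"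
proof -
  define q where "q = (\<kappa> / (M + 1)) powr (1 / (\<sigma> - s))"
  have q: "q > 0" using assms by (simp add: q_def)
  have "1 \<le> \<kappa> * t powr (- \<sigma>) - M * t powr (- s)" if t: "0 < t" "t < min 1 q" for t
  proof -
    have "t powr (\<sigma> - s) \<le> q powr (\<sigma> - s)" using t assms by (intro powr_mono2) auto
    also have "\<dots> = \<kappa> / (M + 1)" using assms by (simp add: q_def powr_powr)
    finally have "(M + 1) * t powr (\<sigma> - s) \<le> \<kappa>" using assms by (simp add: field_simps)
    then have "(M + 1) * t powr (\<sigma> - s) * t powr (- \<sigma>) \<le> \<kappa> * t powr (- \<sigma>)" by (rule mult_right_mono) simp
    moreover have "t powr (\<sigma> - s) * t powr (- \<sigma>) = t powr (- s)" using t by (simp add: powr_add[symmetric])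
    ultimately have "(M + 1) * t powr (- s) \<le> \<kappa> * t powr (- \<sigma>)" by (simp add: mult.assoc)
    moreover have "1 \<le> t powr (- s)"
      using t assms powr_mono'[of "- s" 0 t] by simp
    ultimately show ?thesis by (simp add: distrib_right)
  qed
  then show ?thesis using q by (intro exI[of _ "min 1 q"]) auto
qed

lemma frac_const_nonneg: "frac_const TYPE('a::euclidean_space) s \<ge> 0"
  unfolding frac_const_def by (simp add: integral_nonneg_AE)

theorem theorem1p5:
  fixes \<Omega> :: "'a::euclidean_space set"
    and s Cbar :: real
    and u :: "'a \<Rightarrow> real"
  assumes "open \<Omega>" and "bounded \<Omega>" and "C1_boundary \<Omega>"
    and "0 < s" and "s < 1"
    and "strictly_convex \<Omega>"
    and "Cbar > 0"
    and "u \<in> H1"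
    and "satisfies_system \<Omega> s Cbar u"
  shows "\<exists>C>0. \<exists>l>0. \<forall>p\<in>frontier \<Omega>.
    AE x in lebesgue. x \<in> ball p l \<longrightarrow> u x \<le> C * Cbar * norm (x - p)"
proof (cases "\<Omega> = {}")
  \<comment> \<open>The empty set has no boundary points; from here on \<Omega> contains a centre
    for the dilation.\<close>
  case True
  then show ?thesis by (auto intro!: exI[of _ "1::real"])
next
  case nonempty: False
  have conv: "convex \<Omega>" using assms by (intro strictly_convex_imp_convex)
  define g where "g = weak_grad u"
  have u_L2: "u \<in> borel_measurable lebesgue" "integrable lebesgue (\<lambda>x. (u x)\<^sup>2)"
    and ex: "\<exists>g. has_L2_weak_gradient u g"
    using assms(8) by (auto simp: H1_def)
  from someI_ex[OF ex] have "has_L2_weak_gradient u g" unfolding g_def weak_grad_def .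
  then have g: "g \<in> borel_measurable lebesgue" "integrable lebesgue (\<lambda>x. (norm (g x))\<^sup>2)"
    and weak: "\<And>\<phi> b. \<phi> \<in> test_functions UNIV \<Longrightarrow> b \<in> Basis \<Longrightarrow>
        (LINT x|lebesgue. u x * (grad \<phi> x \<bullet> b)) = - (LINT x|lebesgue. (g x \<bullet> b) * \<phi> x)"
    by (auto simp: has_L2_weak_gradient_def)
  obtain u0 where u0 [measurable]: "u0 \<in> borel_measurable borel" and u_u0: "AE x in lborel. u x = u0 x"
    using completion_ex_borel_measurable_real[OF u_L2(1)] by auto
  obtain g' where g' [measurable]: "g' \<in> borel_measurable borel" and g_g': "AE x in lborel. g x = g' x"
    using borel_representative_vector[OF g(1)] by blast
  have [measurable]: "\<Omega> \<in> sets borel" using assms(1) by simp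
  \<comment> \<open>This Borel representative satisfies the bound and vanishes outside \<Omega> at
    every point, as the locale demands. The changes are confined to a null set and leave all
    integrals of the weak formulation unchanged.\<close>
  define u' where "u' x = (if x \<in> \<Omega> then min (u0 x) Cbar else 0)" for x
  have u' [measurable]: "u' \<in> borel_measurable borel" unfolding u'_def by measurable
  have "AE x in lborel. u x \<le> Cbar" "AE x in lborel. x \<notin> \<Omega> \<longrightarrow> u x = 0"
    using assms(9) by (simp_all add: satisfies_system_def AE_completion_iff)
  with u_u0 have u_u': "AE x in lborel. u x = u' x"
    by eventually_elim (auto simp: u'_def)
  have square_integrable: "integrable lborel f" if "f \<in> borel_measurable borel" "AE x in lborel. h x = f x" "integrable lebesgue h"
    for f h :: "'a \<Rightarrow> real"
  proof -
    have f: "f \<in> borel_measurable lebesgue" using that(1) by (intro measurable_completion) simp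
    have "integrable lebesgue f"
      using that(3) AE_completion[OF that(2)] f by (subst integrable_cong_AE[symmetric, of h]) auto
    then show ?thesis using that(1) by (simp add: integrable_completion)
  qed
  interpret weak_gradient_zero_outside \<Omega> u' g' Cbar
  proof
    show "integrable lborel (\<lambda>x. (u' x)\<^sup>2)"
      by (rule square_integrable[OF _ _ u_L2(2)]) (use u_u' in \<open>auto elim!: eventually_mono\<close>)
    show "integrable lborel (\<lambda>x. (norm (g' x))\<^sup>2)"
      by (rule square_integrable[OF _ _ g(2)]) (use g_g' in \<open>auto elim!: eventually_mono\<close>)
    fix \<phi> :: "'a \<Rightarrow> real" and b :: 'a assume \<phi>: "\<phi> \<in> test_functions UNIV" and b: "b \<in> Basis"
    note [measurable] = test_functions_measurable[OF \<phi>] grad_measurable[OF \<phi>]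
    have "(LINT x|lebesgue. u x * (grad \<phi> x \<bullet> b)) = (LBINT x. u' x * (grad \<phi> x \<bullet> b))"
      by (rule integral_lebesgue_AE_borel) (use u_u' in \<open>auto elim!: eventually_mono\<close>)
    moreover have "(LINT x|lebesgue. (g x \<bullet> b) * \<phi> x) = (LBINT x. (g' x \<bullet> b) * \<phi> x)"
      by (rule integral_lebesgue_AE_borel) (use g_g' in \<open>auto elim!: eventually_mono\<close>)
    ultimately show "(LBINT x. u' x * (grad \<phi> x \<bullet> b)) = - (LBINT x. (g' x \<bullet> b) * \<phi> x)"
      using weak[OF \<phi> b] by simp
  qed (use assms conv nonempty in \<open>auto simp: u'_def\<close>)
  define c where "c = frac_const TYPE('a) s"
  have c: "c \<ge> 0" by (simp add: c_def frac_const_nonneg)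
  have subsol: "(LBINT x. g' x \<bullet> grad \<phi> x) + c / 2 * gform s u' \<phi> \<le> Cbar * (LBINT x. \<phi> x)"
    if \<phi>: "\<phi> \<in> test_functions \<Omega>" "\<And>x. \<phi> x \<ge> 0" for \<phi>
  proof -
    note [measurable] = test_functions_measurable[OF \<phi>(1)] grad_measurable[OF \<phi>(1)]
    have out: "grad \<phi> x = 0 \<and> \<phi> x = 0" if "x \<notin> \<Omega>" for x
    proof -
      have "x \<notin> closure {x. \<phi> x \<noteq> 0}" using test_functions_support[OF \<phi>(1)] that by blast
      then show ?thesis using grad_eq_0[of x \<phi>] subsetD[OF closure_subset, of x "{x. \<phi> x \<noteq> 0}"] by auto
    qed
    have 1: "(LINT x:\<Omega>|lebesgue. weak_grad u x \<bullet> grad \<phi> x) = (LBINT x. g' x \<bullet> grad \<phi> x)"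
      unfolding set_lebesgue_integral_def g_def[symmetric]
    proof (rule integral_lebesgue_AE_borel)
      show "AE x in lborel. indicator \<Omega> x *\<^sub>R (g x \<bullet> grad \<phi> x) = g' x \<bullet> grad \<phi> x"
        using g_g' by eventually_elim (use out in \<open>auto simp: indicator_def\<close>)
    qed measurable
    have 2: "(LINT x:\<Omega>|lebesgue. \<phi> x) = (LBINT x. \<phi> x)"
      unfolding set_lebesgue_integral_def
      by (rule integral_lebesgue_AE_borel) (use out in \<open>auto simp: indicator_def\<close>)
    have 3: "(LINT (x, y)|(lebesgue :: ('a \<times> 'a) measure).
          (u x - u y) * (\<phi> x - \<phi> y) / norm (x - y) powr (real DIM('a) + 2 * s)) = gform s u' \<phi>"
      unfolding gform_def lborel_prod
    proof (rule integral_lebesgue_AE_borel)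
      show "AE p in lborel. (case p of (x, y) \<Rightarrow> (u x - u y) * (\<phi> x - \<phi> y) / norm (x - y) powr (real DIM('a) + 2 * s))
        = (u' (fst p) - u' (snd p)) * (\<phi> (fst p) - \<phi> (snd p)) * kern s (fst p - snd p)"
        using AE_lborel_pair[OF u_u'] by eventually_elim (auto simp: kern_def)
      have "(gform_integrand u' \<phi> (kern s))
        \<in> borel_measurable lborel2" by measurable
      then show "(gform_integrand u' \<phi> (kern s))
        \<in> borel_measurable borel" by (simp add: lborel_prod)
    qed
    have "mixed_form \<Omega> s u \<phi> \<le> Cbar * (LINT x:\<Omega>|lebesgue. \<phi> x)"
      using assms(9) \<phi> by (simp add: satisfies_system_def)
    then show ?thesis unfolding mixed_form_def 1 2 3 c_def .
  qed
  \<comment> \<open>The midpoint is one choice of exponent strictly between s and 1.\<close>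
  define \<sigma> where "\<sigma> = (1 + s) / 2"
  have \<sigma>: "0 < \<sigma>" "\<sigma> < 1" "s < \<sigma>" using assms by (auto simp: \<sigma>_def)
  obtain C where C: "C \<ge> 0" "\<And>t. t > 0 \<Longrightarrow> (\<integral>\<^sup>+(h::'a). ennreal (indicator {h. t < norm h} h * min 1 (norm h) * kern s h) \<partial>lborel)
      \<le> ennreal (C * t powr (- s))"
    using kern_tail[OF assms(4,5), where 'a='a] by blast
  \<comment> \<open>The inequality is stated for amplitude 1, so \<delta> is chosen without
    reference to \<open>Cbar\<close> or to a boundary point.\<close>
  obtain \<delta> where \<delta>: "\<delta> > 0" "\<delta> \<le> 1"
    "\<And>t. 0 < t \<Longrightarrow> t < \<delta> \<Longrightarrow> 1 \<le> (2 - \<sigma>) * (1 - \<sigma>) * t powr (- \<sigma>) - c * C * t powr (- s)"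
    using exists_barrier_width[of s \<sigma> "(2 - \<sigma>) * (1 - \<sigma>)" "c * C"] \<sigma> assms(4) c C(1) by auto
  \<comment> \<open>This is the smallest amplitude reaching \<open>Cbar\<close> at height
    \<delta>/2. As \<delta> is at most 1, it is also at least \<open>2 * Cbar\<close>, which turns
    the normalised inequality into \<open>super\<close>.\<close>
  define A where "A = 2 * Cbar / \<delta>"
  have A: "A > 0" "Cbar \<le> A * (\<delta> / 2)" using assms(7) \<delta> by (auto simp: A_def)
  have A2: "2 * Cbar \<le> A" using assms(7) \<delta> by (simp add: A_def field_simps)
  have super: "2 * Cbar \<le> A * ((2 - \<sigma>) * (1 - \<sigma>)) * t powr (- \<sigma>) - c * A * C * t powr (- s)"
    if "0 < t" "t < \<delta>" for t
  proof -
    have "A * 1 \<le> A * ((2 - \<sigma>) * (1 - \<sigma>) * t powr (- \<sigma>) - c * C * t powr (- s))"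
      using \<delta>(3)[OF that] A(1) by (intro mult_left_mono) auto
    also have "\<dots> = A * ((2 - \<sigma>) * (1 - \<sigma>)) * t powr (- \<sigma>) - c * A * C * t powr (- s)"
      by (simp only: right_diff_distrib mult_ac)
    finally show ?thesis using A2 by simp
  qed
  interpret bp: barrier_params \<sigma> \<delta> using \<sigma> \<delta> by unfold_locales auto
  \<comment> \<open>The comparison holds on the whole space, so any radius will do and 1 is taken.
    The constant 4/\<delta> arises from A = 2 Cbar/\<delta> and W(t) <= 2 max(0, t).\<close>
  have "AE x in lebesgue. x \<in> ball p 1 \<longrightarrow> u x \<le> 4 / \<delta> * Cbar * norm (x - p)" if "p \<in> frontier \<Omega>" for p
  proof -
    have "p \<notin> \<Omega>" using that assms(1) by (simp add: frontier_def interior_open)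
    then obtain e where e: "norm e = 1" "\<And>x. x \<in> \<Omega> \<Longrightarrow> (x - p) \<bullet> e > 0"
      using supporting_half_space[OF assms(1) conv nonempty] by blast
    interpret subsolution \<Omega> u' g' Cbar \<sigma> \<delta> s C c A p e
      by unfold_locales (use assms(4,5,7) c subsol e A C super in auto)
    from u_u' comparison_principle have "AE x in lborel. u x \<le> 4 / \<delta> * Cbar * norm (x - p)"
    proof eventually_elim
      case (elim x)
      have "max 0 ((x - p) \<bullet> e) \<le> norm (x - p)"
        using Cauchy_Schwarz_ineq2[of "x - p" e] e(1) by auto
      then have "bp.W ((x - p) \<bullet> e) \<le> 2 * norm (x - p)" using bp.W_le[of "(x - p) \<bullet> e"] by linarith
      then have "A * bp.W ((x - p) \<bullet> e) \<le> A * (2 * norm (x - p))" using A(1) by (intro mult_left_mono) auto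
      also have "\<dots> = 4 / \<delta> * Cbar * norm (x - p)" by (simp add: A_def)
      finally show ?case using elim by linarith
    qed
    then show ?thesis by (intro AE_completion) (auto elim: eventually_mono)
  qed
  then show ?thesis using \<delta>(1) by (intro exI[of _ "4 / \<delta>"] conjI exI[of _ 1] ballI) auto
qed

end
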